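(* Let $A$ be an operator on a Banach space $X$ which admits a $\mathcal B$-calculus $\Phi$. Then $\Phi$ is unique; in fact, for all $f\in\mathcal B$, $x\in X$, $x^*\in X^*$, \[\langle\Phi(f)x,x^*\rangle=f(\infty)\langle x,x^*\rangle-\frac2\pi\int_0^\infty\alpha\int_{\mathbb R}\langle(\alpha-i\beta+A)^{-2}x,x^*\rangle f'(\alpha+i\beta)\,d\beta\,d\alpha.\]
   Context: $\mathbb C_+=\{z:\Re z>0\}$. $\mathcal B$ is the Banach algebra of holomorphic $f$ on $\mathbb C_+$ with $\|f\|_{\mathcal B_0}:=\int_0^\infty\sup_{\beta\in\mathbb R}|f'(\alpha+i\beta)|\,d\alpha<\infty$, with norm $\|f\|_{\mathcal B}=\sup_{\mathbb C_+}|f|+\|f\|_{\mathcal B_0}$; $f(\infty):=\lim_{\Re z\to\infty}f(z)$ exists for $f\in\mathcal B$. For $z\in\mathbb C_+$, $r_z(\lambda)=(z+\lambda)^{-1}$. An operator $A$ on $X$ admits a $\mathcal B$-calculus if $A$ is densely defined, $\sigma(A)\subset\overline{\mathbb C}_+$, and there is a bounded algebra homomorphism $\Phi:\mathcal B\to L(X)$ with $\Phi(r_z)=(z+A)^{-1}$ for all $z\in\mathbb C_+$. (It is known that whenever $\sup_{\alpha>0}\alpha\int_{\mathbb R}|\langle(\alpha+i\beta+A)^{-2}x,x^*\rangle|d\beta<\infty$ for all $x,x^*$, the displayed formula defines such a $\Phi$.) *)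

theory Defs
  imports "HOL-Analysis.Analysis"
begin

text \<open>HOL-Analysis only provides real normed spaces. A complex Banach space is a real
Banach space together with a complex scalar multiplication extending the real one and
compatible with the norm.\<close>

class cbanach = banach +
  fixes scaleC :: "complex \<Rightarrow> 'a \<Rightarrow> 'a" (infixr \<open>*\<^sub>C\<close> 75)
  assumes scaleC_of_real: "scaleC (of_real r) x = r *\<^sub>R x"
    and scaleC_add_left: "scaleC (a + b) x = scaleC a x + scaleC b x"
    and scaleC_add_right: "scaleC a (x + y) = scaleC a x + scaleC a y"
    and scaleC_scaleC: "scaleC a (scaleC b x) = scaleC (a * b) x"
    and norm_scaleC: "norm (scaleC a x) = cmod a * norm x"

definition bounded_clinear_op :: "('a::cbanach \<Rightarrow> 'a) \<Rightarrow> bool" where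
  "bounded_clinear_op T \<longleftrightarrow> bounded_linear T \<and> (\<forall>c x. T (c *\<^sub>C x) = c *\<^sub>C T x)"

definition dual_elem :: "('a::cbanach \<Rightarrow> complex) \<Rightarrow> bool" where
  "dual_elem \<phi> \<longleftrightarrow> bounded_linear \<phi> \<and> (\<forall>c x. \<phi> (c *\<^sub>C x) = c * \<phi> x)"

definition lin_operator :: "'a::cbanach set \<Rightarrow> ('a \<Rightarrow> 'a) \<Rightarrow> bool" where
  "lin_operator D A \<longleftrightarrow> 0 \<in> D \<and> (\<forall>x\<in>D. \<forall>y\<in>D. x + y \<in> D \<and> A (x + y) = A x + A y)
     \<and> (\<forall>c. \<forall>x\<in>D. c *\<^sub>C x \<in> D \<and> A (c *\<^sub>C x) = c *\<^sub>C A x)"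

definition is_resolvent :: "'a::cbanach set \<Rightarrow> ('a \<Rightarrow> 'a) \<Rightarrow> complex \<Rightarrow> ('a \<Rightarrow> 'a) \<Rightarrow> bool" where
  "is_resolvent D A z R \<longleftrightarrow> bounded_clinear_op R
     \<and> (\<forall>x. R x \<in> D \<and> z *\<^sub>C R x + A (R x) = x)
     \<and> (\<forall>y\<in>D. R (z *\<^sub>C y + A y) = y)"

definition resolv :: "'a::cbanach set \<Rightarrow> ('a \<Rightarrow> 'a) \<Rightarrow> complex \<Rightarrow> ('a \<Rightarrow> 'a)" where
  "resolv D A z = (THE R. is_resolvent D A z R)"

definition spectrum_op :: "'a::cbanach set \<Rightarrow> ('a \<Rightarrow> 'a) \<Rightarrow> complex set" where
  "spectrum_op D A = {w. \<not> (\<exists>R. is_resolvent D A (- w) R)}"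

definition RHP :: "complex set" where
  "RHP = {z. Re z > 0}"

definition B0norm_enn :: "(complex \<Rightarrow> complex) \<Rightarrow> ennreal" where
  "B0norm_enn f = (\<integral>\<^sup>+ \<alpha>. indicator {0<..} \<alpha> *
       (SUP \<beta>. ennreal (cmod (deriv f (Complex \<alpha> \<beta>)))) \<partial>lborel)"

definition Balg :: "(complex \<Rightarrow> complex) set" where
  "Balg = {f. f holomorphic_on RHP \<and> bounded (f ` RHP) \<and> B0norm_enn f < \<infinity>}"

definition Bnorm :: "(complex \<Rightarrow> complex) \<Rightarrow> real" where
  "Bnorm f = Sup ((\<lambda>z. cmod (f z)) ` RHP) + enn2real (B0norm_enn f)"

definition f_infty :: "(complex \<Rightarrow> complex) \<Rightarrow> complex" where
  "f_infty f = Lim (filtercomap Re at_top) f"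

definition rz :: "complex \<Rightarrow> complex \<Rightarrow> complex" where
  "rz z = (\<lambda>w. inverse (z + w))"

definition B_calculus :: "'a::cbanach set \<Rightarrow> ('a \<Rightarrow> 'a) \<Rightarrow> ((complex \<Rightarrow> complex) \<Rightarrow> 'a \<Rightarrow> 'a) \<Rightarrow> bool" where
  "B_calculus D A \<Phi> \<longleftrightarrow>
     lin_operator D A \<and> closure D = UNIV \<and>
     spectrum_op D A \<subseteq> {z. Re z \<ge> 0} \<and>
     (\<forall>f\<in>Balg. bounded_clinear_op (\<Phi> f)) \<and>
     (\<forall>f\<in>Balg. \<forall>g\<in>Balg. \<Phi> (\<lambda>z. f z + g z) = (\<lambda>x. \<Phi> f x + \<Phi> g x)) \<and>
     (\<forall>c. \<forall>f\<in>Balg. \<Phi> (\<lambda>z. c * f z) = (\<lambda>x. c *\<^sub>C \<Phi> f x)) \<and>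
     (\<forall>f\<in>Balg. \<forall>g\<in>Balg. \<Phi> (\<lambda>z. f z * g z) = \<Phi> f \<circ> \<Phi> g) \<and>
     (\<exists>C. \<forall>f\<in>Balg. onorm (\<Phi> f) \<le> C * Bnorm f) \<and>
     (\<forall>z. Re z > 0 \<longrightarrow> \<Phi> (rz z) = resolv D A z)"

end

theory Submission
  imports Defs "HOL-Complex_Analysis.Complex_Analysis"
begin

text \<open>Let $\psi$ be a bounded linear functional on the algebra, for instance $\psi(f)=\langle\Phi(f)x,x^*\rangle$.
Along the shifts $f(\cdot+s)$ the function $p(s)=\psi(f(\cdot+s))$ is smooth on $(0,\infty)$ with $p''(s)=\psi(f''(\cdot+s))$,
it tends to $\psi(f)$ at $0$ and to $f(\infty)\psi(1)$ at $\infty$, and $s p'(s)$ vanishes at both ends; hence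
$\psi(f)=f(\infty)\psi(1)+\int_0^\infty s\,p''(s)\,ds$. By the differentiated Cauchy formula on the line
$\Re w=\alpha=s/2$,
$p''(2\alpha)=-\frac1{2\pi}\int f'(\alpha+i\beta)\,\psi(r_{\alpha-i\beta}^2)\,d\beta$.
Moving $\psi$ under this integral requires decay of $f'$, which is arranged by the factor $(m r_m)^2$; since
$m(m+A)^{-1}\to I$ strongly, it can be removed, with dominated convergence provided by
$\int|\psi(r_{\alpha-i\beta}^2)|\,d\beta=O(1/\alpha)$. Uniqueness uses the same argument for the
vector-valued functional $f\mapsto\Phi(f)x-\Psi(f)x$, which vanishes on all squares of resolvents, so no
separation by $X^*$ is needed.\<close>

text \<open>The bound on the L^1 norm of t -> \<psi>(r_{a-it}^2) is not a hypothesis and has to be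
  extracted from the boundedness of the calculus. It rests on one estimate: a holomorphic function
  that is O(1/Re z) lies, after a shift by a, in the algebra with norm O(1/a). Weighted integrals of
  the kernels are of this kind, because |w - it|^{-2} is a multiple of the Poisson kernel. The
  weight \<alpha> in the formula cancels this 1/\<alpha>, and what remains is the vertical supremum
  of |f'|, integrable by definition of the algebra. Nearly all norm estimates use that this supremum
  decreases in \<alpha>, by the maximum principle: shifts are then contractions, and differentiation
  is bounded at the cost of a shift. The factor 2/pi arises from s ds = 4 \<alpha> d\<alpha> for s =
  2 \<alpha>, together with the 1/(2 pi) of Cauchy's formula. Members of \<open>Balg\<close> are
  total functions constrained only on \<open>RHP\<close>, so \<open>Bnorm\<close> is a seminorm on
  them, and identities valid on \<open>RHP\<close> must be carried through a functional by
  \<open>psi_cong\<close>.\<close>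

lemma open_RHP: "open RHP"
  unfolding RHP_def by (rule open_halfspace_Re_gt)

lemma holomorphic_on_shift_RHP:
  assumes "f holomorphic_on RHP" "0 \<le> s"
  shows "(\<lambda>z. f (z + of_real s)) holomorphic_on RHP"
  using assms(2)
  by (intro holomorphic_on_compose_gen[OF _ assms(1), unfolded o_def] holomorphic_intros)
     (auto simp: RHP_def)

lemma DERIV_RHP:
  assumes "f holomorphic_on RHP" "0 < Re z"
  shows "(f has_field_derivative deriv f z) (at z)"
  using assms by (intro holomorphic_derivI[OF _ open_RHP]) (auto simp: RHP_def)

lemma holomorphic_deriv_RHP: "f holomorphic_on RHP \<Longrightarrow> deriv f holomorphic_on RHP"
  by (rule holomorphic_deriv[OF _ open_RHP])

lemma deriv_shift: "deriv (\<lambda>w. f (w + c)) = (\<lambda>z. deriv f (z + c))"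
  unfolding deriv_def DERIV_shift ..

lemma cball_Re_ge: "w \<in> cball z r \<Longrightarrow> Re z - r \<le> Re w"
  using abs_Re_le_cmod[of "z - w"] by (auto simp: dist_norm)

section \<open>Cauchy estimates, maximum principle and Cauchy formula on half-planes\<close>

lemma Cauchy_estimate_half_plane:
  assumes "f holomorphic_on RHP" "0 < r" "r < Re z"
    and "\<And>w. Re z - r \<le> Re w \<Longrightarrow> cmod (f w) \<le> K"
  shows "cmod (deriv f z) \<le> K / r"
proof -
  have sub: "cball z r \<subseteq> RHP"
    using cball_Re_ge[of _ z r] assms by (force simp: RHP_def)
  have "cmod ((deriv ^^ 1) f z) \<le> fact 1 * K / r ^ 1"
  proof (rule Cauchy_inequality)
    show "f holomorphic_on ball z r"
      using assms(1) sub by (meson ball_subset_cball holomorphic_on_subset)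
    show "continuous_on (cball z r) f"
      using assms(1) sub by (meson holomorphic_on_imp_continuous_on holomorphic_on_subset)
    show "cmod (f w) \<le> K" if "cmod (z - w) = r" for w
      using cball_Re_ge[of w z r] that assms by (auto simp: dist_norm)
  qed (use assms in auto)
  then show ?thesis by simp
qed

text \<open>The factor $1/(1+\delta(w-c))$ makes the function small on large half circles, so the maximum
principle applies on half discs.\<close>

lemma maximum_modulus_half_plane:
  assumes hol: "g holomorphic_on RHP" and c: "0 < c"
    and K: "\<And>w. c \<le> Re w \<Longrightarrow> cmod (g w) \<le> K"
    and m: "\<And>\<beta>. cmod (g (Complex c \<beta>)) \<le> m"
    and z: "c \<le> Re z"
  shows "cmod (g z) \<le> m"
proof -
  have m0: "0 \<le> m" using m[of 0] norm_ge_zero order_trans by blast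
  have K0: "0 \<le> K" using K[OF z] norm_ge_zero order_trans by blast
  \<comment> \<open>The margin \<delta> added to m keeps the radius \<open>R\<close> chosen below
    finite when m = 0.\<close>
  have bound: "cmod (g z) \<le> (m + \<delta>) * cmod (1 + of_real \<delta> * (z - of_real c))" if d: "0 < \<delta>" for \<delta>
  proof -
    define G where "G w = g w / (1 + of_real \<delta> * (w - of_real c))" for w
    \<comment> \<open>On the arc of radius \<open>R\<close> the denominator of \<open>G\<close> is
      at least \<delta> R, and (m + \<delta>) \<delta> R \<ge> K. The second summand puts z inside
      the disc.\<close>
    define R where "R = K / (\<delta> * (m + \<delta>)) + cmod (z - of_real c)"
    define S where "S = cball (of_real c) R \<inter> {w. c \<le> Re w}"
    have R0: "0 \<le> R" unfolding R_def using K0 m0 d by auto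
    have re1: "1 \<le> Re (1 + of_real \<delta> * (w - of_real c))" if "c \<le> Re w" for w
      using that d by simp
    have ge1: "1 \<le> cmod (1 + of_real \<delta> * (w - of_real c))" if "c \<le> Re w" for w
      using re1[OF that] complex_Re_le_cmod order_trans by blast
    \<comment> \<open>After squaring, the imaginary parts agree and the real parts compare as
      \<delta> x against 1 + \<delta> x with x \<ge> 0.\<close>
    have ge2: "\<delta> * cmod (w - of_real c) \<le> cmod (1 + of_real \<delta> * (w - of_real c))" if "c \<le> Re w" for w
    proof -
      have "(\<delta> * cmod (w - of_real c))\<^sup>2 \<le> (cmod (1 + of_real \<delta> * (w - of_real c)))\<^sup>2"
        using that d unfolding power_mult_distrib cmod_power2
        by (simp add: power2_eq_square algebra_simps)
           (smt (verit) mult_left_mono)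
      then show ?thesis by (rule power2_le_imp_le) simp
    qed
    have Scl: "closed S" unfolding S_def by (intro closed_Int closed_cball closed_halfspace_Re_ge)
    have SR: "S \<subseteq> RHP" using c by (auto simp: S_def RHP_def)
    have hG: "G holomorphic_on S"
      unfolding G_def using ge1
      by (intro holomorphic_intros holomorphic_on_subset[OF hol SR]) (force simp: S_def)
    have "cmod (G z) \<le> m + \<delta>"
    proof (rule maximum_modulus_frontier[of G S])
      show "G holomorphic_on interior S"
        using hG interior_subset holomorphic_on_subset by blast
      show "continuous_on (closure S) G"
        using hG Scl by (simp add: holomorphic_on_imp_continuous_on)
      show "bounded S" unfolding S_def by (simp add: bounded_Int)
      show "z \<in> S" unfolding S_def R_def using z K0 m0 d by (auto simp: dist_norm norm_minus_commute)
      fix w assume w: "w \<in> frontier S"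
      have wS: "w \<in> S" using w Scl by (simp add: frontier_def)
      have "w \<notin> ball (of_real c) R \<inter> {w. c < Re w}"
      proof
        assume a: "w \<in> ball (of_real c) R \<inter> {w. c < Re w}"
        have "ball (of_real c) R \<inter> {w. c < Re w} \<subseteq> interior S"
          by (rule interior_maximal)
             (auto simp: S_def intro!: open_Int open_halfspace_Re_gt)
        then show False using a w by (auto simp: frontier_def)
      qed
      then consider "Re w = c" | "cmod (w - of_real c) = R" "c \<le> Re w"
        using wS by (force simp: S_def dist_norm norm_minus_commute)
      then show "cmod (G w) \<le> m + \<delta>"
      proof cases
        case 1
        then have "cmod (g w) \<le> m" using m[of "Im w"] by (simp add: complex_surj flip: 1)
        then show ?thesis using ge1[of w] 1 d m0
          unfolding G_def norm_divide
          by (smt (verit) divide_le_eq_1 divide_right_mono div_by_1 frac_le norm_ge_zero)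
      next
        case 2
        have "K \<le> (m + \<delta>) * (\<delta> * R)"
        proof -
          have "(m + \<delta>) * (\<delta> * R) = K + (m + \<delta>) * \<delta> * cmod (z - of_real c)"
          proof -
            have "m + \<delta> \<noteq> 0" "\<delta> \<noteq> 0" using d m0 by auto
            then have "(m + \<delta>) * (\<delta> * (K / (\<delta> * (m + \<delta>)))) = K" by (simp del: distrib_left_numeral)
            then show ?thesis unfolding R_def by (simp only: distrib_left mult.assoc)
          qed
          then show ?thesis using d m0 by simp
        qed
        also have "\<dots> \<le> (m + \<delta>) * cmod (1 + of_real \<delta> * (w - of_real c))"
          using ge2[of w] 2 d m0 by (intro mult_left_mono) auto
        finally have "cmod (g w) \<le> (m + \<delta>) * cmod (1 + of_real \<delta> * (w - of_real c))"
          using K[of w] 2 by linarith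
        moreover have "0 < cmod (1 + of_real \<delta> * (w - of_real c))"
          using ge1[of w] 2 by linarith
        ultimately show ?thesis unfolding G_def norm_divide by (simp add: divide_le_eq)
      qed
    qed
    moreover have "0 < cmod (1 + of_real \<delta> * (z - of_real c))" using ge1[OF z] by linarith
    ultimately show ?thesis unfolding G_def norm_divide by (simp add: divide_le_eq)
  qed
  have "((\<lambda>\<delta>. (m + \<delta>) * cmod (1 + of_real \<delta> * (z - of_real c))) \<longlongrightarrow>
        (m + 0) * cmod (1 + of_real 0 * (z - of_real c))) (at_right 0)"
    by (intro tendsto_intros)
  then have "cmod (g z) \<le> (m + 0) * cmod (1 + of_real 0 * (z - of_real c))"
    by (rule tendsto_lowerbound) (auto simp: eventually_at_filter bound)
  then show ?thesis by simp
qed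

text \<open>The line segment is completed to a rectangle, whose other three sides contribute $O(1/N)$.\<close>

lemma Cauchy_formula_deriv_half_plane:
  fixes g :: "complex \<Rightarrow> complex" and w0 :: complex and c :: real
  assumes hol: "g holomorphic_on RHP" and c: "0 < c"
    and K: "\<And>w. c \<le> Re w \<Longrightarrow> cmod (g w) \<le> K"
    and w0: "c < Re w0"
  shows "((\<lambda>N. integral {-N..N} (\<lambda>\<beta>. g (Complex c \<beta>) / (w0 - Complex c \<beta>)\<^sup>2))
           \<longlongrightarrow> - (2 * pi) * deriv g w0) at_top"
proof -
  have K0: "0 \<le> K" using K[of w0] w0 norm_ge_zero order_trans by (metis less_imp_le)
  define F where "F w = g w / (w - w0)\<^sup>2" for w
  \<comment> \<open>For N \<ge> N0 both |Im w0| and Re w0 are at most N/2, so the three far sides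
    stay at distance at least N/2 from w0.\<close>
  define N0 where "N0 = 2 * cmod w0 + 2 * c + 1"
  have est: "cmod (integral {-N..N} (\<lambda>\<beta>. g (Complex c \<beta>) / (w0 - Complex c \<beta>)\<^sup>2) - (- (2 * pi) * deriv g w0))
     \<le> 16 * K / N" if N: "N0 \<le> N" for N
  proof -
    have N1: "2 * cmod w0 + 2 * c + 1 \<le> N" using N N0_def by simp
    have Npos: "0 < N" using N1 c norm_ge_zero[of w0] by linarith
    define a1 a2 a3 a4 where "a1 = Complex c (-N)" and "a2 = Complex N (-N)"
      and "a3 = Complex N N" and "a4 = Complex c N"
    note adefs = a1_def a2_def a3_def a4_def
    have cN: "c \<le> N" using N1 c norm_ge_zero[of w0] by linarith
    have im: "\<bar>Im w0\<bar> \<le> N/2" "Re w0 \<le> N/2"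
      using abs_Im_le_cmod[of w0] complex_Re_le_cmod[of w0] N1 c by linarith+
    have box: "w0 \<in> box a1 a3"
      using w0 im Npos by (auto simp: in_box_complex_iff adefs)
    have rect: "path_image (rectpath a1 a3) = cbox a1 a3 - box a1 a3"
      by (rule path_image_rectpath_cbox_minus_box) (use cN Npos in \<open>auto simp: adefs\<close>)
    have cbR: "cbox a1 a3 \<subseteq> RHP"
      using c by (auto simp: in_cbox_complex_iff adefs RHP_def)
    have holF: "F holomorphic_on RHP - {w0}"
      unfolding F_def using hol by (intro holomorphic_intros holomorphic_on_subset[OF hol]) auto
    have pisub: "path_image (rectpath a1 a3) \<subseteq> RHP - {w0}"
      using rect cbR box by auto
    have "contour_integral (rectpath a1 a3) F =
          2 * pi * \<i> * (\<Sum>p\<in>{w0}. winding_number (rectpath a1 a3) p * residue F p)"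
    proof (rule Residue_theorem[of RHP])
      show "connected RHP" unfolding RHP_def by (intro convex_connected convex_halfspace_Re_gt)
      show "\<forall>z. z \<notin> RHP \<longrightarrow> winding_number (rectpath a1 a3) z = 0"
        using cbR cN Npos by (auto intro!: winding_number_rectpath_outside simp: adefs)
    qed (use open_RHP holF pisub in auto)
    also have "\<dots> = 2 * pi * \<i> * deriv g w0"
    proof -
      have "residue F w0 = (deriv ^^ 1) g w0 / fact 1"
        unfolding F_def using residue_holomorphic_over_power[of RHP w0 g 1] open_RHP hol w0 c
        by (simp add: RHP_def numeral_2_eq_2)
      then show ?thesis using winding_number_rectpath[OF box] by simp
    qed
    finally have 1: "contour_integral (rectpath a1 a3) F = 2 * pi * \<i> * deriv g w0" .
    have contF: "continuous_on (closed_segment u v) F" if "closed_segment u v \<subseteq> path_image (rectpath a1 a3)" for u v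
      using holomorphic_on_imp_continuous_on[OF holF] continuous_on_subset that pisub by blast
    have segs: "path_image (rectpath a1 a3) =
      closed_segment a1 a2 \<union> closed_segment a2 a3 \<union> closed_segment a4 a3 \<union> closed_segment a1 a4"
      by (auto simp: rectpath_def Let_def path_image_join adefs closed_segment_commute)
    have ci: "F contour_integrable_on linepath a1 a2" "F contour_integrable_on linepath a2 a3"
        "F contour_integrable_on linepath a3 a4" "F contour_integrable_on linepath a4 a1"
      by (intro contour_integrable_continuous_linepath contF; auto simp: segs closed_segment_commute)+
    have "contour_integral (rectpath a1 a3) F = contour_integral (linepath a1 a2) F +
       contour_integral (linepath a2 a3) F + contour_integral (linepath a3 a4) F + contour_integral (linepath a4 a1) F"
    proof -
      have r: "rectpath a1 a3 = linepath a1 a2 +++ linepath a2 a3 +++ linepath a3 a4 +++ linepath a4 a1"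
        by (simp add: rectpath_def Let_def adefs)
      show ?thesis unfolding r using ci by (simp add: contour_integrable_joinI valid_path_join)
    qed
    \<comment> \<open>The side on Re w = c is traversed downwards; reversing it produces the minus
      sign in the limit.\<close>
    moreover have "contour_integral (linepath a4 a1) F = - contour_integral (linepath a1 a4) F"
      by (metis contour_integral_reversepath reversepath_linepath valid_path_linepath)
    moreover have "contour_integral (linepath a1 a4) F = \<i> * integral {-N..N} (\<lambda>\<beta>. F (Complex c \<beta>))"
      by (rule contour_integral_linepath_same_Re) (use Npos in \<open>auto simp: adefs\<close>)
    moreover have "(\<lambda>\<beta>. F (Complex c \<beta>)) = (\<lambda>\<beta>. g (Complex c \<beta>) / (w0 - Complex c \<beta>)\<^sup>2)"
      unfolding F_def by (simp add: power2_commute)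
    ultimately have eq: "\<i> * (integral {-N..N} (\<lambda>\<beta>. g (Complex c \<beta>) / (w0 - Complex c \<beta>)\<^sup>2)
         - (- (2 * pi) * deriv g w0)) =
        contour_integral (linepath a1 a2) F +
       contour_integral (linepath a2 a3) F + contour_integral (linepath a3 a4) F"
      using 1 by (simp add: algebra_simps)
    have bd: "cmod (contour_integral (linepath u v) F) \<le> 4 * K / N\<^sup>2 * cmod (v - u)"
      if i: "F contour_integrable_on linepath u v"
       and s: "\<And>w. w \<in> closed_segment u v \<Longrightarrow> c \<le> Re w \<and> (N/2 \<le> \<bar>Im w - Im w0\<bar> \<or> N/2 \<le> \<bar>Re w - Re w0\<bar>)" for u v
    proof (rule has_contour_integral_bound_linepath[OF has_contour_integral_integral[OF i]])
      show "0 \<le> 4 * K / N\<^sup>2" using K0 by simp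
      fix w assume "w \<in> closed_segment u v"
      note s = s[OF this]
      have "N / 2 \<le> cmod (w - w0)"
        using s abs_Im_le_cmod[of "w - w0"] abs_Re_le_cmod[of "w - w0"] by auto
      then have "(N/2)\<^sup>2 \<le> (cmod (w - w0))\<^sup>2" using Npos by (intro power_mono) auto
      then show "cmod (F w) \<le> 4 * K / N\<^sup>2"
        unfolding F_def norm_divide norm_power using K[of w] s Npos K0
          frac_le[of K "cmod (g w)" "(N/2)\<^sup>2" "(cmod (w - w0))\<^sup>2"] by (simp add: power_divide mult.commute)
    qed
    have s1: "Re w \<in> {c..N}" "Im w = - N" if "w \<in> closed_segment a1 a2" for w
      using that cN by (auto simp: adefs closed_segment_same_Im closed_segment_eq_real_ivl split: if_splits)
    have s2: "Im w \<in> {-N..N}" "Re w = N" if "w \<in> closed_segment a2 a3" for w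
      using that Npos by (auto simp: adefs closed_segment_same_Re closed_segment_eq_real_ivl)
    have s3: "Re w \<in> {c..N}" "Im w = N" if "w \<in> closed_segment a3 a4" for w
      using that cN by (auto simp: adefs closed_segment_same_Im closed_segment_eq_real_ivl split: if_splits)
    have "cmod (contour_integral (linepath a1 a2) F) \<le> 4 * K / N\<^sup>2 * cmod (a2 - a1)"
      using s1 im by (intro bd ci) force+
    moreover have "cmod (a2 - a1) \<le> N" using cN c by (simp add: adefs cmod_def)
    moreover have "cmod (contour_integral (linepath a2 a3) F) \<le> 4 * K / N\<^sup>2 * cmod (a3 - a2)"
      using s2 im cN by (intro bd ci) force+
    moreover have "cmod (a3 - a2) \<le> 2 * N" using Npos cmod_le[of "a3 - a2"] by (simp add: adefs)
    moreover have "cmod (contour_integral (linepath a3 a4) F) \<le> 4 * K / N\<^sup>2 * cmod (a4 - a3)"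
      using s3 im by (intro bd ci) force+
    moreover have "cmod (a4 - a3) \<le> N" using cN c by (simp add: adefs cmod_def)
    moreover have "0 \<le> 4 * K / N\<^sup>2" using K0 by simp
    ultimately have "cmod (contour_integral (linepath a1 a2) F +
       contour_integral (linepath a2 a3) F + contour_integral (linepath a3 a4) F)
       \<le> 4 * K / N\<^sup>2 * N + 4 * K / N\<^sup>2 * (2 * N) + 4 * K / N\<^sup>2 * N"
      by (meson add_mono mult_left_mono norm_triangle_le order_trans)
    also have "\<dots> = 16 * K / N" using Npos by (simp add: field_simps power2_eq_square)
    finally show ?thesis unfolding eq[symmetric] norm_mult by simp
  qed
  have "((\<lambda>N. 16 * K / N) \<longlongrightarrow> 0) at_top"
    by (intro tendsto_divide_0[OF tendsto_const] filterlim_at_top_imp_at_infinity filterlim_ident)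
  then have "((\<lambda>N. integral {-N..N} (\<lambda>\<beta>. g (Complex c \<beta>) / (w0 - Complex c \<beta>)\<^sup>2) - (- (2 * pi) * deriv g w0))
      \<longlongrightarrow> 0) at_top"
    by (rule Lim_null_comparison[rotated]) (rule eventually_mono[OF eventually_ge_at_top[of N0] est])
  then show ?thesis by (simp only: Lim_null[symmetric])
qed

subsection \<open>The algebra of bounded holomorphic functions with integrable derivative\<close>

text \<open>The vertical supremum as a real number, so that monotonicity and real-valued integrals
  are available. For \<alpha> > 0 Cauchy's estimate makes it a supremum of a bounded set; other
  \<alpha> are cut off by indicators.\<close>

definition deriv_sup :: "(complex \<Rightarrow> complex) \<Rightarrow> real \<Rightarrow> real" where
  "deriv_sup f \<alpha> = (SUP \<beta>. cmod (deriv f (Complex \<alpha> \<beta>)))"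

lemma Balg_holomorphic: "f \<in> Balg \<Longrightarrow> f holomorphic_on RHP"
  by (simp add: Balg_def)

lemma Balg_bdd_above: "f \<in> Balg \<Longrightarrow> bdd_above ((\<lambda>z. cmod (f z)) ` RHP)"
  by (fastforce simp: Balg_def bounded_iff bdd_above_def)

lemma cmod_le_Sup_RHP:
  assumes "f \<in> Balg" "0 < Re z"
  shows "cmod (f z) \<le> Sup ((\<lambda>z. cmod (f z)) ` RHP)"
  using assms by (intro cSUP_upper Balg_bdd_above) (auto simp: RHP_def)

lemma RHP_nonempty: "RHP \<noteq> {}"
  by (auto simp: RHP_def intro: exI[of _ 1])

lemma Sup_RHP_nonneg: "f \<in> Balg \<Longrightarrow> 0 \<le> Sup ((\<lambda>z. cmod (f z)) ` RHP)"
  by (rule order_trans[OF norm_ge_zero cmod_le_Sup_RHP[of f 1]]) auto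

lemma Bnorm_nonneg: "f \<in> Balg \<Longrightarrow> 0 \<le> Bnorm f"
  unfolding Bnorm_def using Sup_RHP_nonneg by simp

lemma cmod_le_Bnorm:
  assumes "f \<in> Balg" "0 < Re z"
  shows "cmod (f z) \<le> Bnorm f"
  using cmod_le_Sup_RHP[OF assms] by (simp add: Bnorm_def add_increasing2)

lemma cmod_deriv_le:
  assumes "f \<in> Balg" "0 < Re z"
  shows "cmod (deriv f z) \<le> 2 * Sup ((\<lambda>z. cmod (f z)) ` RHP) / Re z"
proof -
  have "cmod (deriv f z) \<le> Sup ((\<lambda>z. cmod (f z)) ` RHP) / (Re z / 2)"
    using assms by (intro Cauchy_estimate_half_plane Balg_holomorphic cmod_le_Sup_RHP) auto
  then show ?thesis by (simp add: mult.commute)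
qed

lemma bdd_above_deriv:
  assumes "f \<in> Balg" "0 < \<alpha>"
  shows "bdd_above (range (\<lambda>\<beta>. cmod (deriv f (Complex \<alpha> \<beta>))))"
  using cmod_deriv_le[of f "Complex \<alpha> \<beta>" for \<beta>] assms by (auto intro!: bdd_aboveI2)

lemma deriv_sup_nonneg:
  assumes "f \<in> Balg" "0 < \<alpha>"
  shows "0 \<le> deriv_sup f \<alpha>"
  unfolding deriv_sup_def using bdd_above_deriv[OF assms]
  by (intro cSUP_upper2[of _ _ 0]) auto

lemma deriv_sup_le:
  assumes "f \<in> Balg" "0 < \<alpha>"
  shows "deriv_sup f \<alpha> \<le> 2 * Sup ((\<lambda>z. cmod (f z)) ` RHP) / \<alpha>"
  unfolding deriv_sup_def using cmod_deriv_le[of f "Complex \<alpha> \<beta>" for \<beta>] assms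
  by (intro cSUP_least) auto

text \<open>The maximum principle for f' turns the supremum over one vertical line into a bound on
  the whole half-plane to its right. Monotonicity of \<open>deriv_sup\<close> and most norm
  estimates below come from this.\<close>

lemma cmod_deriv_le_deriv_sup:
  assumes f: "f \<in> Balg" and a: "0 < a" "a \<le> Re z"
  shows "cmod (deriv f z) \<le> deriv_sup f a"
proof (rule maximum_modulus_half_plane[where g = "deriv f" and c = a
      and K = "2 * Sup ((\<lambda>z. cmod (f z)) ` RHP) / a"])
  show "deriv f holomorphic_on RHP" using f by (intro holomorphic_deriv_RHP Balg_holomorphic)
  show "cmod (deriv f (Complex a \<beta>)) \<le> deriv_sup f a" for \<beta>
    unfolding deriv_sup_def using bdd_above_deriv[OF f a(1)] by (intro cSUP_upper) auto
  \<comment> \<open>The maximum principle on an unbounded region needs some a priori bound; the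
    Cauchy bound decreases in Re w and supplies one.\<close>
  show "cmod (deriv f w) \<le> 2 * Sup ((\<lambda>z. cmod (f z)) ` RHP) / a" if "a \<le> Re w" for w
  proof -
    have "cmod (deriv f w) \<le> 2 * Sup ((\<lambda>z. cmod (f z)) ` RHP) / Re w"
      using that a by (intro cmod_deriv_le f) auto
    also have "\<dots> \<le> 2 * Sup ((\<lambda>z. cmod (f z)) ` RHP) / a"
      using that a Sup_RHP_nonneg[OF f] by (intro divide_left_mono) auto
    finally show ?thesis .
  qed
qed (use a in auto)

lemma deriv_sup_antimono:
  assumes "f \<in> Balg" "0 < a" "a \<le> b"
  shows "deriv_sup f b \<le> deriv_sup f a"
  using assms unfolding deriv_sup_def[of f b] by (intro cSUP_least cmod_deriv_le_deriv_sup) auto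

text \<open>Gives measurability of \<open>deriv_sup\<close>, a supremum over uncountably many
  \<beta>, through its monotonicity in \<alpha>.\<close>

lemma borel_measurable_antimono_Ioi:
  fixes m :: "real \<Rightarrow> real"
  assumes "\<And>a b. 0 < a \<Longrightarrow> a \<le> b \<Longrightarrow> m b \<le> m a"
  shows "set_borel_measurable lborel {0<..} m"
proof -
  have "(\<lambda>x. - m x) \<in> borel_measurable (restrict_space borel {0<..})"
    using assms by (intro borel_measurable_mono_on_fnc) (auto simp: mono_on_def)
  then have "m \<in> borel_measurable (restrict_space borel {0<..})"
    by simp
  then show ?thesis
    by (simp add: set_borel_measurable_def borel_measurable_restrict_space_iff)
qed

lemma B0norm_enn_eq_deriv_sup:
  assumes "f \<in> Balg"
  shows "B0norm_enn f = (\<integral>\<^sup>+\<alpha>. ennreal (indicator {0<..} \<alpha> *\<^sub>R deriv_sup f \<alpha>) \<partial>lborel)"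
  unfolding B0norm_enn_def
proof (intro nn_integral_cong)
  fix \<alpha> :: real
  show "indicator {0<..} \<alpha> * (SUP \<beta>. ennreal (cmod (deriv f (Complex \<alpha> \<beta>)))) =
        ennreal (indicator {0<..} \<alpha> *\<^sub>R deriv_sup f \<alpha>)"
  proof (cases "0 < \<alpha>")
    case True
    have "ennreal (SUP \<beta>. cmod (deriv f (Complex \<alpha> \<beta>))) = (SUP \<beta>. ennreal (cmod (deriv f (Complex \<alpha> \<beta>))))"
      (is "ennreal ?r = ?S")
    proof (rule antisym)
      show "?S \<le> ennreal ?r"
        using bdd_above_deriv[OF assms True] by (intro SUP_least ennreal_leI cSUP_upper) auto
      then obtain q where q: "?S = ennreal q" "0 \<le> q"
        by (metis ennreal_cases ennreal_neq_top neq_top_trans)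
      have "cmod (deriv f (Complex \<alpha> \<beta>)) \<le> q" for \<beta>
      proof -
        have "ennreal (cmod (deriv f (Complex \<alpha> \<beta>))) \<le> ?S" by (rule SUP_upper) simp
        then show ?thesis using q by simp
      qed
      then have "?r \<le> q" by (intro cSUP_least) auto
      then show "ennreal ?r \<le> ?S" using q by (simp add: ennreal_leI)
    qed
    then show ?thesis using True by (simp add: deriv_sup_def)
  qed simp
qed

lemma set_integrable_deriv_sup:
  assumes "f \<in> Balg"
  shows "set_integrable lborel {0<..} (deriv_sup f)"
  unfolding set_integrable_def
proof (rule integrableI_nonneg)
  show "(\<lambda>\<alpha>. indicator {0<..} \<alpha> *\<^sub>R deriv_sup f \<alpha>) \<in> borel_measurable lborel"
    using borel_measurable_antimono_Ioi[of "deriv_sup f"] deriv_sup_antimono[OF assms]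
    by (simp add: set_borel_measurable_def)
  show "AE \<alpha> in lborel. 0 \<le> indicator {0<..} \<alpha> *\<^sub>R deriv_sup f \<alpha>"
    using deriv_sup_nonneg[OF assms] by (auto simp: indicator_def)
  show "(\<integral>\<^sup>+\<alpha>. ennreal (indicator {0<..} \<alpha> *\<^sub>R deriv_sup f \<alpha>) \<partial>lborel) < \<infinity>"
    using assms B0norm_enn_eq_deriv_sup[OF assms] by (simp add: Balg_def)
qed

lemma enn2real_B0norm:
  assumes "f \<in> Balg"
  shows "enn2real (B0norm_enn f) = (LINT \<alpha>:{0<..}|lborel. deriv_sup f \<alpha>)"
proof -
  have "B0norm_enn f = ennreal (LINT \<alpha>:{0<..}|lborel. deriv_sup f \<alpha>)"
    unfolding B0norm_enn_eq_deriv_sup[OF assms] set_lebesgue_integral_def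
    using set_integrable_deriv_sup[OF assms] deriv_sup_nonneg[OF assms]
    by (intro nn_integral_eq_integral) (auto simp: set_integrable_def indicator_def)
  moreover have "0 \<le> (LINT \<alpha>:{0<..}|lborel. deriv_sup f \<alpha>)"
    unfolding set_lebesgue_integral_def using deriv_sup_nonneg[OF assms]
    by (intro integral_nonneg_AE) (auto simp: indicator_def)
  ultimately show ?thesis by simp
qed

text \<open>Membership and norm are always established by an integrable majorant of |f'| depending
  on Re z alone. The comparison uses \<open>nn_integral\<close>, whose monotonicity holds for
  arbitrary integrands, so the vertical suprema of f' may enter before their measurability is
  known.\<close>

lemma Balg_boundI:
  assumes hol: "f holomorphic_on RHP"
    and K: "\<And>z. 0 < Re z \<Longrightarrow> cmod (f z) \<le> K"
    and m: "\<And>z. 0 < Re z \<Longrightarrow> cmod (deriv f z) \<le> m (Re z)"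
    and int: "set_integrable lborel {0<..} m"
  shows "f \<in> Balg" "enn2real (B0norm_enn f) \<le> (LINT \<alpha>:{0<..}|lborel. m \<alpha>)"
    "Bnorm f \<le> K + (LINT \<alpha>:{0<..}|lborel. m \<alpha>)"
proof -
  have m0: "0 \<le> m \<alpha>" if "0 < \<alpha>" for \<alpha>
    using m[of "Complex \<alpha> 0"] that norm_ge_zero order_trans by (metis complex.sel(1))
  have "B0norm_enn f \<le> (\<integral>\<^sup>+\<alpha>. ennreal (indicator {0<..} \<alpha> *\<^sub>R m \<alpha>) \<partial>lborel)"
    unfolding B0norm_enn_def
  proof (intro nn_integral_mono)
    fix \<alpha> :: real
    show "indicator {0<..} \<alpha> * (SUP \<beta>. ennreal (cmod (deriv f (Complex \<alpha> \<beta>)))) \<le>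
        ennreal (indicator {0<..} \<alpha> *\<^sub>R m \<alpha>)"
      using m[of "Complex \<alpha> \<beta>" for \<beta>]
      by (cases "0 < \<alpha>") (auto intro!: SUP_least ennreal_leI)
  qed
  also have "\<dots> = ennreal (LINT \<alpha>:{0<..}|lborel. m \<alpha>)"
    unfolding set_lebesgue_integral_def using int m0
    by (intro nn_integral_eq_integral) (auto simp: set_integrable_def indicator_def)
  finally have le: "B0norm_enn f \<le> ennreal (LINT \<alpha>:{0<..}|lborel. m \<alpha>)" .
  then have "B0norm_enn f < \<infinity>"
    using ennreal_less_top le_less_trans unfolding infinity_ennreal_def by blast
  then show B: "f \<in> Balg"
    using hol K by (auto simp: Balg_def bounded_iff RHP_def intro!: exI[of _ K])
  have "0 \<le> (LINT \<alpha>:{0<..}|lborel. m \<alpha>)"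
    unfolding set_lebesgue_integral_def using m0
    by (intro integral_nonneg_AE) (auto simp: indicator_def)
  with le show 2: "enn2real (B0norm_enn f) \<le> (LINT \<alpha>:{0<..}|lborel. m \<alpha>)"
    by (metis enn2real_leI)
  have "Sup ((\<lambda>z. cmod (f z)) ` RHP) \<le> K"
    using RHP_nonempty K by (intro cSUP_least) (auto simp: RHP_def)
  with 2 show "Bnorm f \<le> K + (LINT \<alpha>:{0<..}|lborel. m \<alpha>)"
    by (simp add: Bnorm_def)
qed

lemma Balg_Bnorm_boundI:
  assumes "f holomorphic_on RHP"
    and "\<And>z. 0 < Re z \<Longrightarrow> cmod (f z) \<le> K"
    and "\<And>z. 0 < Re z \<Longrightarrow> cmod (deriv f z) \<le> m (Re z)"
    and "set_integrable lborel {0<..} m"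
  shows "f \<in> Balg \<and> Bnorm f \<le> K + (LINT \<alpha>:{0<..}|lborel. m \<alpha>)"
  using Balg_boundI[OF assms] by blast

section \<open>Closure under algebra operations, shifts and differentiation\<close>

lemma Balg_const: "(\<lambda>z. c) \<in> Balg"
  by (rule Balg_boundI[where K = "cmod c" and m = "\<lambda>_. 0"]) (auto simp: set_integrable_def)

lemma Balg_add:
  assumes "f \<in> Balg" "g \<in> Balg"
  shows "(\<lambda>z. f z + g z) \<in> Balg"
proof (rule Balg_boundI)
  show "(\<lambda>z. f z + g z) holomorphic_on RHP"
    using assms by (intro holomorphic_intros Balg_holomorphic)
  fix z assume z: "0 < Re z"
  show "cmod (f z + g z) \<le> Bnorm f + Bnorm g"
    using cmod_le_Bnorm[OF assms(1) z] cmod_le_Bnorm[OF assms(2) z] by (intro norm_triangle_le) simp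
  have "deriv (\<lambda>z. f z + g z) z = deriv f z + deriv g z"
    using DERIV_RHP[OF Balg_holomorphic z] assms by (intro DERIV_imp_deriv derivative_intros) auto
  then show "cmod (deriv (\<lambda>z. f z + g z) z) \<le> deriv_sup f (Re z) + deriv_sup g (Re z)"
    using cmod_deriv_le_deriv_sup[OF assms(1) z order_refl] cmod_deriv_le_deriv_sup[OF assms(2) z order_refl]
    by (auto intro!: norm_triangle_le)
qed (intro set_integral_add set_integrable_deriv_sup assms)

lemma Balg_cmult:
  assumes "f \<in> Balg"
  shows "(\<lambda>z. c * f z) \<in> Balg"
proof (rule Balg_boundI)
  show "(\<lambda>z. c * f z) holomorphic_on RHP"
    using assms by (intro holomorphic_intros Balg_holomorphic)
  fix z assume z: "0 < Re z"
  show "cmod (c * f z) \<le> cmod c * Bnorm f"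
    using cmod_le_Bnorm[OF assms z] by (simp add: norm_mult mult_left_mono)
  have "deriv (\<lambda>z. c * f z) z = c * deriv f z"
    using DERIV_RHP[OF Balg_holomorphic z] assms by (intro DERIV_imp_deriv DERIV_cmult) auto
  then show "cmod (deriv (\<lambda>z. c * f z) z) \<le> cmod c * deriv_sup f (Re z)"
    using cmod_deriv_le_deriv_sup[OF assms z order_refl] by (simp add: norm_mult mult_left_mono)
qed (intro set_integrable_mult_right set_integrable_deriv_sup assms)

lemma Balg_diff:
  assumes "f \<in> Balg" "g \<in> Balg"
  shows "(\<lambda>z. f z - g z) \<in> Balg"
  using Balg_add[OF assms(1) Balg_cmult[OF assms(2), of "-1"]] by simp

lemma Balg_mult:
  assumes "f \<in> Balg" "g \<in> Balg"
  shows "(\<lambda>z. f z * g z) \<in> Balg"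
proof (rule Balg_boundI)
  show "(\<lambda>z. f z * g z) holomorphic_on RHP"
    using assms by (intro holomorphic_intros Balg_holomorphic)
  fix z assume z: "0 < Re z"
  note b = cmod_le_Bnorm[OF assms(1) z] cmod_le_Bnorm[OF assms(2) z] 
  note d = cmod_deriv_le_deriv_sup[OF assms(1) z order_refl] cmod_deriv_le_deriv_sup[OF assms(2) z order_refl]
  show "cmod (f z * g z) \<le> Bnorm f * Bnorm g"
    using b Bnorm_nonneg[OF assms(1)] by (simp add: norm_mult mult_mono)
  have "deriv (\<lambda>z. f z * g z) z = f z * deriv g z + deriv f z * g z"
    using DERIV_RHP[OF Balg_holomorphic z] assms by (intro DERIV_imp_deriv) (auto intro!: derivative_eq_intros)
  also have "cmod \<dots> \<le> Bnorm f * deriv_sup g (Re z) + deriv_sup f (Re z) * Bnorm g"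
    using b d Bnorm_nonneg[OF assms(1)] deriv_sup_nonneg[OF assms(1) z]
    by (intro norm_triangle_le add_mono) (auto simp: norm_mult intro!: mult_mono)
  finally show "cmod (deriv (\<lambda>z. f z * g z) z) \<le> Bnorm f * deriv_sup g (Re z) + deriv_sup f (Re z) * Bnorm g" .
qed (intro set_integral_add set_integrable_mult_right set_integrable_mult_left set_integrable_deriv_sup assms)

text \<open>A shift to the right can only lower the supremum of |f| and, by the maximum principle,
  the vertical suprema of |f'|.\<close>

lemma Balg_shift:
  assumes f: "f \<in> Balg" and s: "0 \<le> s"
  shows "(\<lambda>z. f (z + of_real s)) \<in> Balg" "Bnorm (\<lambda>z. f (z + of_real s)) \<le> Bnorm f"
proof -
  have "(\<lambda>z. f (z + of_real s)) \<in> Balg \<and> Bnorm (\<lambda>z. f (z + of_real s)) \<le> Sup ((\<lambda>z. cmod (f z)) ` RHP) + (LINT \<alpha>:{0<..}|lborel. deriv_sup f \<alpha>)"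
  proof (rule Balg_Bnorm_boundI)
    show "(\<lambda>z. f (z + of_real s)) holomorphic_on RHP"
      by (intro holomorphic_on_shift_RHP Balg_holomorphic f s)
    show "cmod (f (z + of_real s)) \<le> Sup ((\<lambda>z. cmod (f z)) ` RHP)" if "0 < Re z" for z
      using that s by (intro cmod_le_Sup_RHP f) auto
    show "cmod (deriv (\<lambda>z. f (z + of_real s)) z) \<le> deriv_sup f (Re z)" if "0 < Re z" for z
      using that s cmod_deriv_le_deriv_sup[OF f, of "Re z" "z + of_real s"]
      by (simp add: deriv_shift)
  qed (use set_integrable_deriv_sup[OF f] in auto)
  then show "(\<lambda>z. f (z + of_real s)) \<in> Balg" "Bnorm (\<lambda>z. f (z + of_real s)) \<le> Bnorm f"
    by (auto simp: Bnorm_def[of f] enn2real_B0norm[OF f])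
qed

text \<open>Cauchy's estimate controls f' by sup |f| and f'' by the vertical suprema of f': the disc
  of radius s/2 about z + s stays to the right of Re z. This is the smoothing that makes the shifts
  an analytic semigroup.\<close>

lemma Balg_deriv_shift:
  assumes f: "f \<in> Balg" and s: "0 < s"
  shows "(\<lambda>z. deriv f (z + of_real s)) \<in> Balg" "Bnorm (\<lambda>z. deriv f (z + of_real s)) \<le> 2 / s * Bnorm f"
proof -
  have hd: "deriv f holomorphic_on RHP" by (intro holomorphic_deriv_RHP Balg_holomorphic f)
  have "(\<lambda>z. deriv f (z + of_real s)) \<in> Balg \<and> Bnorm (\<lambda>z. deriv f (z + of_real s)) \<le>
     2 / s * Sup ((\<lambda>z. cmod (f z)) ` RHP) + (LINT \<alpha>:{0<..}|lborel. 2 / s * deriv_sup f \<alpha>)"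
  proof (rule Balg_Bnorm_boundI)
    show "(\<lambda>z. deriv f (z + of_real s)) holomorphic_on RHP"
      using s by (intro holomorphic_on_shift_RHP hd) auto
    fix z assume z: "0 < Re z"
    show "cmod (deriv f (z + of_real s)) \<le> 2 / s * Sup ((\<lambda>z. cmod (f z)) ` RHP)"
    proof -
      have "cmod (deriv f (z + of_real s)) \<le> 2 * Sup ((\<lambda>z. cmod (f z)) ` RHP) / Re (z + of_real s)"
        using z s by (intro cmod_deriv_le f) auto
      also have "\<dots> \<le> 2 * Sup ((\<lambda>z. cmod (f z)) ` RHP) / s"
        using z s Sup_RHP_nonneg[OF f] by (intro divide_left_mono) auto
      finally show ?thesis by simp
    qed
    have "cmod (deriv (deriv f) (z + of_real s)) \<le> deriv_sup f (Re z) / (s / 2)"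
      using z s by (intro Cauchy_estimate_half_plane hd cmod_deriv_le_deriv_sup f) auto
    then show "cmod (deriv (\<lambda>z. deriv f (z + of_real s)) z) \<le> 2 / s * deriv_sup f (Re z)"
      using z s by (simp add: deriv_shift mult.commute)
  qed (use set_integrable_deriv_sup[OF f] in auto)
  then show "(\<lambda>z. deriv f (z + of_real s)) \<in> Balg" "Bnorm (\<lambda>z. deriv f (z + of_real s)) \<le> 2 / s * Bnorm f"
    by (auto simp: Bnorm_def[of f] enn2real_B0norm[OF f] algebra_simps)
qed

text \<open>Cauchy's estimate on the disc of radius half the real part turns decay K/Re z into |g'|
  \<le> 4K/(Re z)^2, integrable at infinity; the shift by b removes the singularity at 0. The
  supremum contributes K/b and the derivative 4K/b, hence the 5.\<close>

lemma Balg_decay: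
  assumes hol: "g holomorphic_on RHP" and b: "0 < b"
    and K: "\<And>z. 0 < Re z \<Longrightarrow> cmod (g z) \<le> K / Re z"
  shows "(\<lambda>z. g (z + of_real b)) \<in> Balg" "Bnorm (\<lambda>z. g (z + of_real b)) \<le> 5 * K / b"
proof -
  have K0: "0 \<le> K" using order_trans[OF norm_ge_zero K[of 1]] by simp
  have nn: "(\<integral>\<^sup>+\<alpha>. ennreal (4 * K / (\<alpha> + b)\<^sup>2) * indicator {0..} \<alpha> \<partial>lborel) = ennreal (0 - (- 4 * K / (0 + b)))"
  proof (rule nn_integral_FTC_atLeast)
    show "(\<lambda>\<alpha>. 4 * K / (\<alpha> + b)\<^sup>2) \<in> borel_measurable borel" by measurable
    have "filterlim (\<lambda>\<alpha>. \<alpha> + b) at_top at_top"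
      using filterlim_tendsto_add_at_top[OF tendsto_const[of b] filterlim_ident] by (simp add: add.commute)
    then show "((\<lambda>\<alpha>. - 4 * K / (\<alpha> + b)) \<longlongrightarrow> 0) at_top"
      by (intro tendsto_divide_0[OF tendsto_const] filterlim_at_top_imp_at_infinity)
  qed (use K0 b in \<open>auto intro!: derivative_eq_intros simp: power2_eq_square\<close>)
  have nn': "(\<integral>\<^sup>+\<alpha>. ennreal (indicator {0<..} \<alpha> *\<^sub>R (4 * K / (\<alpha> + b)\<^sup>2)) \<partial>lborel) \<le> ennreal (4 * K / b)"
  proof -
    have "(\<integral>\<^sup>+\<alpha>. ennreal (indicator {0<..} \<alpha> *\<^sub>R (4 * K / (\<alpha> + b)\<^sup>2)) \<partial>lborel)
      \<le> (\<integral>\<^sup>+\<alpha>. ennreal (4 * K / (\<alpha> + b)\<^sup>2) * indicator {0..} \<alpha> \<partial>lborel)"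
      by (intro nn_integral_mono) (auto simp: indicator_def)
    then show ?thesis unfolding nn by simp
  qed
  have int: "set_integrable lborel {0<..} (\<lambda>\<alpha>. 4 * K / (\<alpha> + b)\<^sup>2)"
    unfolding set_integrable_def
  proof (rule integrableI_nonneg)
    show "(\<integral>\<^sup>+\<alpha>. ennreal (indicator {0<..} \<alpha> *\<^sub>R (4 * K / (\<alpha> + b)\<^sup>2)) \<partial>lborel) < \<infinity>"
      using le_less_trans[OF nn' ennreal_less_top] by simp
    show "AE \<alpha> in lborel. 0 \<le> indicator {0<..} \<alpha> *\<^sub>R (4 * K / (\<alpha> + b)\<^sup>2)"
      using K0 by (intro AE_I2) simp
  qed measurable
  have le: "(LINT \<alpha>:{0<..}|lborel. 4 * K / (\<alpha> + b)\<^sup>2) \<le> 4 * K / b"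
  proof -
    have "ennreal (LINT \<alpha>:{0<..}|lborel. 4 * K / (\<alpha> + b)\<^sup>2) = (\<integral>\<^sup>+\<alpha>. ennreal (indicator {0<..} \<alpha> *\<^sub>R (4 * K / (\<alpha> + b)\<^sup>2)) \<partial>lborel)"
      unfolding set_lebesgue_integral_def using int K0
      by (intro nn_integral_eq_integral[symmetric]) (auto simp: set_integrable_def)
    with nn' have "ennreal (LINT \<alpha>:{0<..}|lborel. 4 * K / (\<alpha> + b)\<^sup>2) \<le> ennreal (4 * K / b)" by simp
    then show ?thesis using K0 b by (subst (asm) ennreal_le_iff) auto
  qed
  have A: "(\<lambda>z. g (z + of_real b)) \<in> Balg \<and> Bnorm (\<lambda>z. g (z + of_real b)) \<le> K / b + (LINT \<alpha>:{0<..}|lborel. 4 * K / (\<alpha> + b)\<^sup>2)"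
  proof (rule Balg_Bnorm_boundI)
    show "(\<lambda>z. g (z + of_real b)) holomorphic_on RHP"
      using b by (intro holomorphic_on_shift_RHP hol) auto
    fix z assume z: "0 < Re z"
    show "cmod (g (z + of_real b)) \<le> K / b"
    proof -
      have "cmod (g (z + of_real b)) \<le> K / Re (z + of_real b)" using z b by (intro K) auto
      also have "\<dots> \<le> K / b" using z b K0 by (intro divide_left_mono) auto
      finally show ?thesis .
    qed
    have "cmod (deriv g (z + of_real b)) \<le> (K / (Re (z + of_real b) / 2)) / (Re (z + of_real b) / 2)"
    proof (rule Cauchy_estimate_half_plane[OF hol])
      fix w assume w: "Re (z + of_real b) - Re (z + of_real b) / 2 \<le> Re w"
      then have hw: "Re (z + of_real b) / 2 \<le> Re w" by linarith
      moreover have rb: "0 < Re (z + of_real b) / 2" using z b by simp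
      ultimately have "cmod (g w) \<le> K / Re w" by (intro K) linarith
      also have "\<dots> \<le> K / (Re (z + of_real b) / 2)" using hw rb K0 by (intro divide_left_mono mult_pos_pos) linarith+
      finally show "cmod (g w) \<le> K / (Re (z + of_real b) / 2)" .
    qed (use z b in auto)
    then show "cmod (deriv (\<lambda>z. g (z + of_real b)) z) \<le> 4 * K / (Re z + b)\<^sup>2"
      using z b by (simp add: deriv_shift power2_eq_square mult.commute)
  qed (use int in auto)
  then show "(\<lambda>z. g (z + of_real b)) \<in> Balg" by simp
  have "K / b + 4 * K / b = 5 * K / b" by (simp add: add_divide_distrib[symmetric])
  then show "Bnorm (\<lambda>z. g (z + of_real b)) \<le> 5 * K / b" using A le by linarith
qed

section \<open>Limits at infinity and norm continuity of the shifts\<close>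

lemma deriv_sup_shift:
  assumes "f \<in> Balg" "0 < \<alpha>" "0 \<le> s"
  shows "deriv_sup (\<lambda>z. f (z + of_real s)) \<alpha> = deriv_sup f (\<alpha> + s)"
proof -
  have "Complex \<alpha> \<beta> + of_real s = Complex (\<alpha> + s) \<beta>" for \<beta>
    by (simp add: complex_eq_iff)
  then show ?thesis
    unfolding deriv_sup_def using assms by (simp add: deriv_shift)
qed

text \<open>Integrate f' along the horizontal segment: z + \<tau> lies to the right of the line Re w
  = \<tau>, so |f'| there is at most \<open>deriv_sup f \<tau>\<close>. The bound is uniform in z
  and t.\<close>

lemma cmod_diff_shift_le:
  assumes f: "f \<in> Balg" and z: "0 < Re z" and t: "0 \<le> t"
  shows "cmod (f (z + of_real t) - f z) \<le> (LINT \<alpha>:{0<..}|lborel. deriv_sup f \<alpha>)"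
proof -
  define g where "g = (\<lambda>\<alpha>. indicator {0<..} \<alpha> *\<^sub>R deriv_sup f \<alpha>)"
  have gi: "integrable lborel g"
    using set_integrable_deriv_sup[OF f] by (simp add: set_integrable_def g_def)
  have gh: "(g has_integral integral\<^sup>L lborel g) UNIV"
    using has_integral_integral_lborel[OF gi] by simp
  have g0: "0 \<le> g x" for x using deriv_sup_nonneg[OF f, of x] by (simp add: g_def indicator_def)
  have gt: "g integrable_on {0..t}"
    using gh integrable_on_subinterval[of g UNIV 0 t] by (auto simp: has_integral_iff)
  \<comment> \<open>The value at \<tau> = 0 is replaced by 0 because the majorant \<open>g\<close>
    vanishes there; the fundamental theorem is applied on the open interval and does not see
    it.\<close>
  define h where "h = (\<lambda>\<tau>::real. if \<tau> = 0 then 0 else deriv f (z + of_real \<tau>))"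
  have hi: "(h has_integral f (z + of_real t) - f (z + of_real 0)) {0..t}"
  proof (rule fundamental_theorem_of_calculus_interior[OF t])
    have d: "((\<lambda>x. f (z + of_real x)) has_vector_derivative deriv f (z + of_real x)) (at x)" if "0 \<le> x" for x
    proof -
      have "(f has_field_derivative deriv f (z + of_real x)) (at (z + of_real x))"
        using z that by (intro DERIV_RHP Balg_holomorphic f) auto
      then have "((f \<circ> (\<lambda>x. z + of_real x)) has_vector_derivative 1 * deriv f (z + of_real x)) (at x)"
        by (intro field_vector_diff_chain_at derivative_eq_intros) (auto intro!: derivative_eq_intros)
      then show ?thesis by (simp add: o_def)
    qed
    show "continuous_on {0..t} (\<lambda>x. f (z + of_real x))"
      using d by (intro continuous_at_imp_continuous_on) (auto intro: has_vector_derivative_continuous[OF d])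
    show "((\<lambda>x. f (z + of_real x)) has_vector_derivative h x) (at x)" if "x \<in> {0<..<t}" for x
      using d[of x] that by (simp add: h_def)
  qed
  have "norm (integral {0..t} h) \<le> integral {0..t} g"
  proof (rule integral_norm_bound_integral)
    show "h integrable_on {0..t}" using hi by blast
    show "cmod (h \<tau>) \<le> g \<tau>" if "\<tau> \<in> {0..t}" for \<tau>
      using that cmod_deriv_le_deriv_sup[OF f, of \<tau> "z + of_real \<tau>"] z by (auto simp: h_def g_def)
  qed (use gt in auto)
  also have "\<dots> \<le> integral UNIV g"
    using gt gh g0 by (intro integral_subset_le) (auto simp: has_integral_iff)
  also have "\<dots> = (LINT \<alpha>:{0<..}|lborel. deriv_sup f \<alpha>)"
    using gh by (simp add: has_integral_iff set_lebesgue_integral_def g_def)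
  finally show ?thesis using hi by (simp add: has_integral_iff)
qed

lemma tendsto_LINT_deriv_sup_shift:
  assumes f: "f \<in> Balg"
  shows "((\<lambda>s. LINT \<alpha>:{0<..}|lborel. deriv_sup (\<lambda>z. f (z + of_real s)) \<alpha>) \<longlongrightarrow> 0) at_top"
proof -
  \<comment> \<open>Writing \<open>max 0 s\<close> keeps the shifted argument positive for every s,
    so monotonicity gives measurability for all s and not just eventually.\<close>
  have "((\<lambda>s. LINT \<alpha>|lborel. indicator {0<..} \<alpha> *\<^sub>R deriv_sup f (\<alpha> + max 0 s)) \<longlongrightarrow> integral\<^sup>L (lborel :: real measure) (\<lambda>_. 0 :: real)) at_top"
  proof (rule integral_dominated_convergence_at_top)
    show "(\<lambda>\<alpha>. indicator {0<..} \<alpha> *\<^sub>R deriv_sup f (\<alpha> + max 0 s)) \<in> borel_measurable lborel" for s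
      using borel_measurable_antimono_Ioi[of "\<lambda>\<alpha>. deriv_sup f (\<alpha> + max 0 s)"] deriv_sup_antimono[OF f]
      by (simp add: set_borel_measurable_def)
    show "integrable lborel (\<lambda>\<alpha>. indicator {0<..} \<alpha> *\<^sub>R deriv_sup f \<alpha>)"
      using set_integrable_deriv_sup[OF f] by (simp add: set_integrable_def)
    show "\<forall>\<^sub>F s in at_top. AE \<alpha> in lborel. norm (indicator {0<..} \<alpha> *\<^sub>R deriv_sup f (\<alpha> + max 0 s))
            \<le> indicator {0<..} \<alpha> *\<^sub>R deriv_sup f \<alpha>"
      using deriv_sup_nonneg[OF f] deriv_sup_antimono[OF f]
      by (intro always_eventually allI AE_I2) (auto simp: indicator_def)
    have "((\<lambda>s. deriv_sup f (\<alpha> + max 0 s)) \<longlongrightarrow> 0) at_top" if "0 < \<alpha>" for \<alpha>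
    proof (rule tendsto_sandwich)
      show "\<forall>\<^sub>F s in at_top. 0 \<le> deriv_sup f (\<alpha> + max 0 s)"
        using that by (intro always_eventually allI deriv_sup_nonneg f) auto
      show "\<forall>\<^sub>F s in at_top. deriv_sup f (\<alpha> + max 0 s) \<le> 2 * Sup ((\<lambda>z. cmod (f z)) ` RHP) / s"
      proof (rule eventually_mono[OF eventually_gt_at_top[of 0]])
        fix s :: real assume "0 < s"
        then show "deriv_sup f (\<alpha> + max 0 s) \<le> 2 * Sup ((\<lambda>z. cmod (f z)) ` RHP) / s"
          using deriv_sup_antimono[OF f, of s "\<alpha> + max 0 s"] deriv_sup_le[OF f, of s] that by auto
      qed
      show "((\<lambda>s. 2 * Sup ((\<lambda>z. cmod (f z)) ` RHP) / s) \<longlongrightarrow> 0) at_top"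
        by (intro tendsto_divide_0[OF tendsto_const] filterlim_at_top_imp_at_infinity filterlim_ident)
    qed simp
    then show "AE \<alpha> in lborel. ((\<lambda>s. indicator {0<..} \<alpha> *\<^sub>R deriv_sup f (\<alpha> + max 0 s)) \<longlongrightarrow> 0) at_top"
      by (intro AE_I2) (auto simp: indicator_def)
  qed simp
  then have lim: "((\<lambda>s. LINT \<alpha>:{0<..}|lborel. deriv_sup f (\<alpha> + max 0 s)) \<longlongrightarrow> 0) at_top"
    by (simp add: set_lebesgue_integral_def)
  show ?thesis
  proof (rule Lim_transform_eventually[OF lim])
    show "\<forall>\<^sub>F s in at_top. (LINT \<alpha>:{0<..}|lborel. deriv_sup f (\<alpha> + max 0 s)) =
      (LINT \<alpha>:{0<..}|lborel. deriv_sup (\<lambda>z. f (z + of_real s)) \<alpha>)"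
      by (rule eventually_mono[OF eventually_ge_at_top[of 0]])
         (auto intro!: set_lebesgue_integral_cong simp: deriv_sup_shift[OF f])
  qed
qed

text \<open>Also proves that the limit behind \<open>f_infty\<close> exists. Oscillation along
  horizontal rays beyond real part a is at most the tail \<open>T a\<close>, and vertical
  oscillation dies out because |f'| = O(1/Re z). Both bounds are uniform enough for the filter Re z
  -> infinity.\<close>

lemma cmod_diff_f_infty_shift_le:
  assumes f: "f \<in> Balg" and z: "0 < Re z" and s: "0 \<le> s"
  shows "cmod (f (z + of_real s) - f_infty f) \<le> (LINT \<alpha>:{0<..}|lborel. deriv_sup (\<lambda>z. f (z + of_real s)) \<alpha>)"
proof -
  define T where "T s = (LINT \<alpha>:{0<..}|lborel. deriv_sup (\<lambda>z. f (z + of_real s)) \<alpha>)" for s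
  have T0: "(T \<longlongrightarrow> 0) at_top" unfolding T_def by (rule tendsto_LINT_deriv_sup_shift[OF f])
  have Tn: "(\<lambda>n. T (real n)) \<longlonglongrightarrow> 0"
    by (rule filterlim_compose[OF T0 filterlim_real_sequentially])
  have Tle: "cmod (f (w + of_real t) - f w) \<le> T a" if "0 \<le> a" "a < Re w" "0 \<le> t" for w t a
    using cmod_diff_shift_le[OF Balg_shift(1)[OF f that(1)], of "w - of_real a" t] that
    by (simp add: T_def algebra_simps)
  define X where "X n = f (of_real (real n) + 1)" for n
  have XT: "cmod (X m - X n) \<le> T (real n)" if "n \<le> m" for m n
    using Tle[of "real n" "of_real (real n) + 1" "real m - real n"] that by (simp add: X_def add_ac)
  have "Cauchy X"
  proof (rule metric_CauchyI)
    fix e :: real assume "0 < e"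
    then obtain N where N: "T (real N) < e / 2"
      using order_tendstoD(2)[OF Tn, of "e/2"] by (force simp: eventually_sequentially)
    show "\<exists>M. \<forall>m\<ge>M. \<forall>n\<ge>M. dist (X m) (X n) < e"
    proof (intro exI[of _ N] allI impI)
      fix m n assume "N \<le> m" "N \<le> n"
      then have "cmod (X m - X N) < e/2" "cmod (X n - X N) < e/2"
        using XT[of N m] XT[of N n] N by auto
      then show "dist (X m) (X n) < e"
        unfolding dist_norm[symmetric] by (rule dist_triangle_half_l)
    qed
  qed
  then obtain L where L: "X \<longlonglongrightarrow> L" using Cauchy_convergent_iff convergent_def by blast
  define S where "S = Sup ((\<lambda>z. cmod (f z)) ` RHP)"
  \<comment> \<open>On Re u \<ge> n the derivative is O(1/n), so starting from w instead of 1
    changes the values by a null sequence.\<close>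
  have lim: "(\<lambda>n. f (w + of_real (real n))) \<longlonglongrightarrow> L" if w: "0 < Re w" for w
  proof -
    have bd: "cmod (f (w + of_real (real n)) - X n) \<le> 2 * S / real n * cmod (w - 1)" if n: "0 < n" for n
    proof -
      have "cmod (f (w + of_real (real n)) - f (of_real (real n) + 1)) \<le> 2 * S / real n * cmod (w + of_real (real n) - (of_real (real n) + 1))"
      proof (rule field_differentiable_bound[where S = "{u. real n \<le> Re u}" and f' = "deriv f"])
        show "convex {u. real n \<le> Re u}" by (rule convex_halfspace_Re_ge)
        fix u assume u: "u \<in> {u. real n \<le> Re u}"
        show "(f has_field_derivative deriv f u) (at u within {u. real n \<le> Re u})"
          using u n by (intro has_field_derivative_at_within[OF DERIV_RHP] Balg_holomorphic f) auto
        have "cmod (deriv f u) \<le> 2 * S / Re u"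
          unfolding S_def using u n by (intro cmod_deriv_le f) auto
        also have "\<dots> \<le> 2 * S / real n"
          using u n Sup_RHP_nonneg[OF f] by (intro divide_left_mono) (auto simp: S_def)
        finally show "cmod (deriv f u) \<le> 2 * S / real n" .
      qed (use w in auto)
      then show ?thesis by (simp add: X_def)
    qed
    have l0: "(\<lambda>n. 2 * S / real n * cmod (w - 1)) \<longlonglongrightarrow> 0"
      by (intro tendsto_mult_left_zero tendsto_divide_0[OF tendsto_const]
          filterlim_at_top_imp_at_infinity filterlim_real_sequentially)
    have "(\<lambda>n. f (w + of_real (real n)) - X n) \<longlonglongrightarrow> 0"
      by (rule Lim_null_comparison[OF eventually_mono[OF eventually_gt_at_top[of 0] bd] l0])
    from tendsto_add[OF this L] show ?thesis by simp
  qed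
  have main: "cmod (f w - L) \<le> T a" if "0 \<le> a" "a < Re w" for w a
  proof (rule tendsto_upperbound)
    show "(\<lambda>n. cmod (f w - f (w + of_real (real n)))) \<longlonglongrightarrow> cmod (f w - L)"
      using that by (intro tendsto_intros lim) auto
    show "\<forall>\<^sub>F n in sequentially. cmod (f w - f (w + of_real (real n))) \<le> T a"
      using Tle[OF that, of "real n" for n] by (simp add: norm_minus_commute)
  qed simp
  have "f_infty f = L"
    unfolding f_infty_def
  proof (rule tendsto_Lim)
    \<comment> \<open>\<open>Lim\<close> is a definite description; uniqueness of the limit requires
      a nontrivial filter.\<close>
    have "surj Re" by (rule surjI[of Re complex_of_real]) simp
    then have "filtercomap Re at_top \<noteq> bot"
      by (intro filtercomap_neq_bot_surj) auto
    then show "\<not> trivial_limit (filtercomap Re at_top)" by (simp add: trivial_limit_def)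
    show "(f \<longlongrightarrow> L) (filtercomap Re at_top)"
    proof (rule tendstoI)
      fix e :: real assume "0 < e"
      then obtain a where a: "T a < e" "0 \<le> a"
        using eventually_conj[OF order_tendstoD(2)[OF T0, of e] eventually_ge_at_top[of 0]]
        by (auto simp: eventually_at_top_linorder)
      have "\<forall>\<^sub>F z in filtercomap Re at_top. a < Re z"
        by (intro eventually_filtercomapI eventually_gt_at_top)
      then show "\<forall>\<^sub>F z in filtercomap Re at_top. dist (f z) L < e"
        by (rule eventually_mono) (use main[OF a(2)] a(1) in \<open>auto simp: dist_norm intro: le_less_trans\<close>)
    qed
  qed
  then show ?thesis using main[of s "z + of_real s"] z s by (simp add: T_def)
qed

lemma tendsto_f_infty:
  assumes f: "f \<in> Balg" and z: "0 < Re z"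
  shows "((\<lambda>t. f (z + of_real t)) \<longlongrightarrow> f_infty f) at_top"
proof -
  have "((\<lambda>t. f (z + of_real t) - f_infty f) \<longlongrightarrow> 0) at_top"
    by (rule Lim_null_comparison[OF eventually_mono[OF eventually_ge_at_top[of 0]] tendsto_LINT_deriv_sup_shift[OF f]])
       (rule cmod_diff_f_infty_shift_le[OF f z])
  then show ?thesis by (simp only: Lim_null[symmetric])
qed

lemma cmod_le_LINT_deriv_sup:
  assumes f: "f \<in> Balg" and z: "0 < Re z" and lim: "((\<lambda>t. f (z + of_real t)) \<longlongrightarrow> 0) at_top"
  shows "cmod (f z) \<le> (LINT \<alpha>:{0<..}|lborel. deriv_sup f \<alpha>)"
proof -
  have "f_infty f = 0"
    using tendsto_unique[OF _ tendsto_f_infty[OF f z] lim] by simp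
  then show ?thesis using cmod_diff_f_infty_shift_le[OF f z, of 0] by simp
qed

text \<open>With limit 0 at infinity, |f(z)| is recovered by integrating f' along a ray, so the
  derivative part of the norm dominates the supremum part. Norm convergence can then be checked on
  derivatives.\<close>

lemma Bnorm_le_if_vanishing:
  assumes f: "f \<in> Balg" and lim: "\<And>z. 0 < Re z \<Longrightarrow> ((\<lambda>t. f (z + of_real t)) \<longlongrightarrow> 0) at_top"
  shows "Bnorm f \<le> 2 * (LINT \<alpha>:{0<..}|lborel. deriv_sup f \<alpha>)"
proof -
  have "Sup ((\<lambda>z. cmod (f z)) ` RHP) \<le> (LINT \<alpha>:{0<..}|lborel. deriv_sup f \<alpha>)"
    using cmod_le_LINT_deriv_sup[OF f _ lim] RHP_nonempty by (intro cSUP_least) (auto simp: RHP_def)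
  then show ?thesis by (simp add: Bnorm_def enn2real_B0norm[OF f])
qed

text \<open>Both parts of the norm are at most the integral of \<open>deriv_sup\<close> for the
  shifted function, which tends to 0.\<close>

lemma tendsto_Bnorm_shift_at_top:
  assumes f: "f \<in> Balg"
  shows "((\<lambda>s. Bnorm (\<lambda>z. f (z + of_real s) - f_infty f)) \<longlongrightarrow> 0) at_top"
proof (rule Lim_null_comparison)
  let ?T = "\<lambda>s. LINT \<alpha>:{0<..}|lborel. deriv_sup (\<lambda>z. f (z + of_real s)) \<alpha>"
  show "((\<lambda>s. ?T s + ?T s) \<longlongrightarrow> 0) at_top"
    using tendsto_add[OF tendsto_LINT_deriv_sup_shift[OF f] tendsto_LINT_deriv_sup_shift[OF f]] by simp
  show "\<forall>\<^sub>F s in at_top. norm (Bnorm (\<lambda>z. f (z + of_real s) - f_infty f)) \<le> ?T s + ?T s"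
  proof (rule eventually_mono[OF eventually_ge_at_top[of 0]])
    fix s :: real assume s: "0 \<le> s"
    note fs = Balg_shift(1)[OF f s]
    have "(\<lambda>z. f (z + of_real s) - f_infty f) \<in> Balg \<and> Bnorm (\<lambda>z. f (z + of_real s) - f_infty f) \<le> ?T s + ?T s"
    proof (rule Balg_Bnorm_boundI)
      show "(\<lambda>z. f (z + of_real s) - f_infty f) holomorphic_on RHP"
        by (intro holomorphic_intros Balg_holomorphic fs)
      fix z assume z: "0 < Re z"
      show "cmod (f (z + of_real s) - f_infty f) \<le> ?T s"
        by (rule cmod_diff_f_infty_shift_le[OF f z s])
      have "deriv (\<lambda>z. f (z + of_real s) - f_infty f) z = deriv (\<lambda>z. f (z + of_real s)) z - 0"
        by (intro DERIV_imp_deriv derivative_intros DERIV_RHP[OF Balg_holomorphic[OF fs] z])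
      then show "cmod (deriv (\<lambda>z. f (z + of_real s) - f_infty f) z) \<le> deriv_sup (\<lambda>z. f (z + of_real s)) (Re z)"
        using cmod_deriv_le_deriv_sup[OF fs z order_refl] by simp
    qed (rule set_integrable_deriv_sup[OF fs])
    then show "norm (Bnorm (\<lambda>z. f (z + of_real s) - f_infty f)) \<le> ?T s + ?T s"
      using Bnorm_nonneg[of "\<lambda>z. f (z + of_real s) - f_infty f"] by simp
  qed
qed

text \<open>The difference f'(z + s) - f'(z) has two bounds: twice the vertical supremum, which is
  integrable, and a mean value bound that tends to 0 with s at each \<alpha>. Their minimum is
  suited to dominated convergence.\<close>

lemma tendsto_Bnorm_shift_at_0:
  assumes f: "f \<in> Balg"
  shows "((\<lambda>s. Bnorm (\<lambda>z. f (z + of_real s) - f z)) \<longlongrightarrow> 0) (at_right 0)"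
  \<comment> \<open>Substitutes s = 1/t, since the dominated convergence used here is along t ->
    infinity.\<close>
  unfolding filterlim_at_right_to_top
proof (rule Lim_null_comparison)
  define g where "g = (\<lambda>\<alpha>. indicator {0<..} \<alpha> *\<^sub>R deriv_sup f \<alpha>)"
  \<comment> \<open>The second entry uses |f''| \<le> \<open>deriv_sup f (\<alpha>/2)\<close> /
    (\<alpha>/2) on Re u \<ge> \<alpha>, from Cauchy's estimate with radius \<alpha>/2, times the
    distance s = 1/t.\<close>
  define m where "m = (\<lambda>t \<alpha>. min (2 * g \<alpha>) (2 * inverse t / \<alpha> * g (\<alpha> / 2)))"
  have gi: "integrable lborel g"
    using set_integrable_deriv_sup[OF f] by (simp add: set_integrable_def g_def)
  have [measurable]: "g \<in> borel_measurable borel"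
    using borel_measurable_integrable[OF gi] by simp
  have g0: "0 \<le> g x" for x using deriv_sup_nonneg[OF f, of x] by (simp add: g_def indicator_def)
  have gpos: "\<alpha> \<le> 0 \<Longrightarrow> g \<alpha> = 0" "0 < \<alpha> \<Longrightarrow> g \<alpha> = deriv_sup f \<alpha>" for \<alpha> by (auto simp: g_def)
  have m0: "0 \<le> m t \<alpha>" if "0 < t" for t \<alpha>
    using g0[of \<alpha>] g0[of "\<alpha>/2"] gpos(1)[of \<alpha>] gpos(1)[of "\<alpha>/2"] that
    by (cases "\<alpha> \<le> 0") (auto simp: m_def)
  have mle: "\<bar>m t \<alpha>\<bar> \<le> 2 * g \<alpha>" if "0 < t" for t \<alpha>
    using m0[OF that, of \<alpha>] by (auto simp: m_def)
  have mi: "integrable lborel (m t)" if "0 < t" for t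
    using gi mle[OF that] by (intro Bochner_Integration.integrable_bound[of lborel "\<lambda>\<alpha>. 2 * g \<alpha>" "m t"]) (auto simp: m_def g0)
  have "((\<lambda>t. LINT \<alpha>|lborel. m t \<alpha>) \<longlongrightarrow> integral\<^sup>L (lborel :: real measure) (\<lambda>_. 0 :: real)) at_top"
  proof (rule integral_dominated_convergence_at_top)
    show "integrable lborel (\<lambda>\<alpha>. 2 * g \<alpha>)" using gi by simp
    show "\<forall>\<^sub>F t in at_top. AE \<alpha> in lborel. norm (m t \<alpha>) \<le> 2 * g \<alpha>"
      by (rule eventually_mono[OF eventually_gt_at_top[of 0]]) (auto simp: mle)
    have "((\<lambda>t. m t \<alpha>) \<longlongrightarrow> min (2 * g \<alpha>) (2 * 0 / \<alpha> * g (\<alpha> / 2))) at_top" for \<alpha>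
      unfolding m_def divide_inverse[of _ \<alpha>] by (intro tendsto_intros tendsto_inverse_0_at_top filterlim_ident)
    then show "AE \<alpha> in lborel. ((\<lambda>t. m t \<alpha>) \<longlongrightarrow> 0) at_top"
      using g0 by (intro AE_I2) (simp add: min_absorb2)
  qed (auto simp: m_def)
  then show "((\<lambda>t. 2 * (LINT \<alpha>|lborel. m t \<alpha>)) \<longlongrightarrow> 0) at_top"
    by (auto intro!: tendsto_eq_intros)
  show "\<forall>\<^sub>F t in at_top. norm (Bnorm (\<lambda>z. f (z + of_real (inverse t)) - f z)) \<le> 2 * (LINT \<alpha>|lborel. m t \<alpha>)"
  proof (rule eventually_mono[OF eventually_gt_at_top[of 0]])
    fix t :: real assume t: "0 < t"
    define s where "s = inverse t"
    have s: "0 < s" using t by (simp add: s_def)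
    define E where "E = (\<lambda>z. f (z + of_real s) - f z)"
    have fs: "(\<lambda>z. f (z + of_real s)) \<in> Balg" using s by (intro Balg_shift f) auto
    have EB: "E \<in> Balg" unfolding E_def by (intro Balg_diff fs f)
    have hd: "deriv f holomorphic_on RHP" by (intro holomorphic_deriv_RHP Balg_holomorphic f)
    have mset: "indicator {0<..} \<alpha> *\<^sub>R m t \<alpha> = m t \<alpha>" for \<alpha>
      using gpos(1)[of \<alpha>] gpos(1)[of "\<alpha>/2"] by (auto simp: indicator_def m_def)
    have "enn2real (B0norm_enn E) \<le> (LINT \<alpha>:{0<..}|lborel. m t \<alpha>)"
    proof (rule Balg_boundI)
      show "E holomorphic_on RHP" by (rule Balg_holomorphic[OF EB])
      fix z assume z: "0 < Re z"
      show "cmod (E z) \<le> Bnorm E" by (rule cmod_le_Bnorm[OF EB z])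
      have dE: "deriv E z = deriv f (z + of_real s) - deriv f z"
        unfolding E_def deriv_shift[THEN fun_cong, symmetric]
        by (intro DERIV_imp_deriv derivative_intros DERIV_RHP Balg_holomorphic fs f z)
      have 1: "cmod (deriv E z) \<le> 2 * deriv_sup f (Re z)"
        unfolding dE using cmod_deriv_le_deriv_sup[OF f z, of z] cmod_deriv_le_deriv_sup[OF f z, of "z + of_real s"] s
          norm_triangle_ineq4[of "deriv f (z + of_real s)" "deriv f z"] by simp
      have "cmod (deriv f (z + of_real s) - deriv f z) \<le> (deriv_sup f (Re z / 2) / (Re z / 2)) * cmod (z + of_real s - z)"
      proof (rule field_differentiable_bound[where S = "{u. Re z \<le> Re u}" and f' = "deriv (deriv f)"])
        show "convex {u. Re z \<le> Re u}" by (rule convex_halfspace_Re_ge)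
        fix u assume u: "u \<in> {u. Re z \<le> Re u}"
        show "(deriv f has_field_derivative deriv (deriv f) u) (at u within {u. Re z \<le> Re u})"
          using u z by (intro has_field_derivative_at_within[OF DERIV_RHP] hd) auto
        show "cmod (deriv (deriv f) u) \<le> deriv_sup f (Re z / 2) / (Re z / 2)"
          using u z by (intro Cauchy_estimate_half_plane[OF hd] cmod_deriv_le_deriv_sup f) auto
      qed (use s in auto)
      then have 2: "cmod (deriv E z) \<le> 2 * s / Re z * deriv_sup f (Re z / 2)"
        using s unfolding dE by (simp add: mult_ac)
      show "cmod (deriv E z) \<le> m t (Re z)"
        using 1 2 z by (simp add: m_def s_def gpos(2))
    qed (unfold set_integrable_def mset, rule mi[OF t])
    then have "(LINT \<alpha>:{0<..}|lborel. deriv_sup E \<alpha>) \<le> (LINT \<alpha>|lborel. m t \<alpha>)"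
      unfolding set_lebesgue_integral_def mset enn2real_B0norm[OF EB] .
    moreover have "Bnorm E \<le> 2 * (LINT \<alpha>:{0<..}|lborel. deriv_sup E \<alpha>)"
    proof (rule Bnorm_le_if_vanishing[OF EB])
      fix z assume z: "0 < Re z"
      \<comment> \<open>A function and its shift have the same limit at infinity, so
        \<open>E\<close> vanishes there.\<close>
      have "((\<lambda>t. f (z + of_real s + of_real t) - f (z + of_real t)) \<longlongrightarrow> f_infty f - f_infty f) at_top"
        using z s by (intro tendsto_intros tendsto_f_infty f) auto
      then show "((\<lambda>t. E (z + of_real t)) \<longlongrightarrow> 0) at_top" by (simp add: E_def add_ac)
    qed
    ultimately show "norm (Bnorm (\<lambda>z. f (z + of_real (inverse t)) - f z)) \<le> 2 * (LINT \<alpha>|lborel. m t \<alpha>)"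
      using Bnorm_nonneg[OF EB] unfolding E_def s_def by simp
  qed
qed

lemma has_vector_derivativeI_bound:
  fixes p :: "real \<Rightarrow> 'b::real_normed_vector"
  assumes "\<And>e. 0 < e \<Longrightarrow> \<exists>d>0. \<forall>h. \<bar>h\<bar> < d \<longrightarrow> norm (p (s + h) - p s - h *\<^sub>R D) \<le> e * \<bar>h\<bar>"
  shows "(p has_vector_derivative D) (at s)"
  unfolding has_vector_derivative_def has_derivative_at_alt
proof (intro conjI allI impI)
  show "bounded_linear (\<lambda>x. x *\<^sub>R D)" by (rule bounded_linear_scaleR_left)
  fix e :: real assume "0 < e"
  from assms[OF this] obtain d where d: "0 < d"
    and b: "\<And>h. \<bar>h\<bar> < d \<Longrightarrow> norm (p (s + h) - p s - h *\<^sub>R D) \<le> e * \<bar>h\<bar>" by blast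
  show "\<exists>d>0. \<forall>y. norm (y - s) < d \<longrightarrow> norm (p y - p s - (y - s) *\<^sub>R D) \<le> e * norm (y - s)"
    using d b[of "y - s" for y] by (intro exI[of _ d]) simp
qed

lemma Taylor_half_plane:
  assumes hol: "g holomorphic_on RHP" and c: "0 < c"
    and B: "\<And>w. c \<le> Re w \<Longrightarrow> cmod (deriv (deriv g) w) \<le> B"
    and w: "c \<le> Re w" "c \<le> Re (w + h)"
  shows "cmod (g (w + h) - g w - h * deriv g w) \<le> B * (cmod h)\<^sup>2"
proof -
  have "cmod ((deriv ^^ 0) g (w + h) - (\<Sum>i\<le>1. (deriv ^^ i) g w * (w + h - w) ^ i / fact i))
        \<le> B * cmod (w + h - w) ^ Suc 1 / fact 1"
  proof (rule complex_Taylor[where S = "{u. c \<le> Re u}"])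
    show "convex {u. c \<le> Re u}" by (rule convex_halfspace_Re_ge)
    fix i :: nat and u assume u: "u \<in> {u. c \<le> Re u}"
    have "(deriv ^^ i) g holomorphic_on RHP"
      by (rule holomorphic_higher_deriv[OF hol open_RHP])
    then show "((deriv ^^ i) g has_field_derivative (deriv ^^ Suc i) g u) (at u within {u. c \<le> Re u})"
      using DERIV_RHP[of "(deriv ^^ i) g" u] u c by (auto intro: has_field_derivative_at_within)
  qed (use B w in \<open>auto simp: eval_nat_numeral\<close>)
  then show ?thesis by (simp add: algebra_simps power2_eq_square)
qed

subsection \<open>Bounded functionals along the shift semigroup\<close>

text \<open>Covers both f -> \<Phi>(f)x and its scalar pairings. The target is a real Banach space,
  so only real scalars leave \<psi>; complex factors are kept inside its argument.\<close>

locale Balg_functional =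
  fixes \<psi> :: "(complex \<Rightarrow> complex) \<Rightarrow> 'b::banach" and C :: real
  assumes psi_add: "f \<in> Balg \<Longrightarrow> g \<in> Balg \<Longrightarrow> \<psi> (\<lambda>z. f z + g z) = \<psi> f + \<psi> g"
    and psi_scale: "f \<in> Balg \<Longrightarrow> \<psi> (\<lambda>z. of_real c * f z) = c *\<^sub>R \<psi> f"
    and psi_bound: "f \<in> Balg \<Longrightarrow> norm (\<psi> f) \<le> C * Bnorm f"
    and C_nonneg: "0 \<le> C"
begin

lemma psi_diff:
  assumes "f \<in> Balg" "g \<in> Balg"
  shows "\<psi> (\<lambda>z. f z - g z) = \<psi> f - \<psi> g"
  using psi_add[OF assms(1) Balg_cmult[OF assms(2), of "of_real (-1)"]] psi_scale[OF assms(2), of "-1"]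
  by simp

text \<open>The difference has seminorm 0: function and derivative vanish on the open half-plane,
  whatever the values outside it.\<close>

lemma psi_cong:
  assumes f: "f \<in> Balg" and g: "g \<in> Balg" and eq: "\<And>z. 0 < Re z \<Longrightarrow> f z = g z"
  shows "\<psi> f = \<psi> g"
proof -
  have fg: "(\<lambda>z. f z - g z) \<in> Balg" by (rule Balg_diff[OF f g])
  have "(\<lambda>z. f z - g z) \<in> Balg \<and> Bnorm (\<lambda>z. f z - g z) \<le> 0 + set_lebesgue_integral lborel {0::real<..} (\<lambda>_. 0)"
  proof (rule Balg_Bnorm_boundI)
    show "(\<lambda>z. f z - g z) holomorphic_on RHP" by (rule Balg_holomorphic[OF fg])
    fix z :: complex assume z: "0 < Re z"
    show "cmod (f z - g z) \<le> 0" using eq[OF z] by simp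
    have "((\<lambda>z. f z - g z) has_field_derivative 0) (at z)"
      by (rule has_field_derivative_transform_within_open[OF DERIV_const[of 0] open_RHP])
         (use z eq in \<open>auto simp: RHP_def\<close>)
    then show "cmod (deriv (\<lambda>z. f z - g z) z) \<le> 0" by (simp add: DERIV_imp_deriv)
  qed (simp add: set_integrable_def)
  then have "Bnorm (\<lambda>z. f z - g z) = 0" using Bnorm_nonneg[OF fg] by simp
  then show ?thesis using psi_bound[OF fg] psi_diff[OF f g] by simp
qed

text \<open>The difference quotient converges in the norm of the algebra: Taylor's formula for f and
  for f' bounds the remainder by h^2 times the norm of f''(. + s/2).\<close>

lemma has_vector_derivative_shift_Balg:
  assumes f: "f \<in> Balg" and s: "0 < s"
  shows "((\<lambda>s. \<psi> (\<lambda>z. f (z + of_real s))) has_vector_derivative \<psi> (\<lambda>z. deriv f (z + of_real s))) (at s)"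
proof (rule has_vector_derivativeI_bound)
  \<comment> \<open>Each differentiation costs a positive shift. Two quarters of s are spent on f'',
    and the remaining s/2 leaves room for |h| < s/2.\<close>
  define f1 where "f1 = (\<lambda>z. deriv f (z + of_real (s / 4)))"
  define f2 where "f2 = (\<lambda>z. deriv f1 (z + of_real (s / 4)))"
  have f1: "f1 \<in> Balg" unfolding f1_def using s by (intro Balg_deriv_shift f) auto
  have f2: "f2 \<in> Balg" unfolding f2_def using s by (intro Balg_deriv_shift f1) auto
  have f2_eq: "f2 = (\<lambda>z. deriv (deriv f) (z + of_real (s / 2)))"
    unfolding f2_def f1_def deriv_shift by (simp add: add.assoc flip: of_real_add)
  have hol: "f holomorphic_on RHP" by (rule Balg_holomorphic[OF f])
  have hold: "deriv f holomorphic_on RHP" by (rule holomorphic_deriv_RHP[OF hol])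
  have b2: "cmod (deriv (deriv f) w) \<le> Sup ((\<lambda>z. cmod (f2 z)) ` RHP)" if "s / 2 < Re w" for w
    using cmod_le_Sup_RHP[OF f2, of "w - of_real (s/2)"] that by (simp add: f2_eq)
  have b3: "cmod (deriv (deriv (deriv f)) w) \<le> deriv_sup f2 a" if "0 < a" "a + s / 2 \<le> Re w" for w a
    using cmod_deriv_le_deriv_sup[OF f2 that(1), of "w - of_real (s/2)"] that by (simp add: f2_eq deriv_shift)
  have est: "norm (\<psi> (\<lambda>z. f (z + of_real (s + h))) - \<psi> (\<lambda>z. f (z + of_real s))
        - h *\<^sub>R \<psi> (\<lambda>z. deriv f (z + of_real s))) \<le> C * (h\<^sup>2 * Bnorm f2)" if h: "\<bar>h\<bar> < s / 2" for h
  proof -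
    define E where "E = (\<lambda>z. f (z + of_real (s + h)) - f (z + of_real s) - of_real h * deriv f (z + of_real s))"
    have B1: "(\<lambda>z. f (z + of_real (s + h))) \<in> Balg" using h by (intro Balg_shift f) auto
    have B2: "(\<lambda>z. f (z + of_real s)) \<in> Balg" using s by (intro Balg_shift f) auto
    have B3: "(\<lambda>z. deriv f (z + of_real s)) \<in> Balg" using s by (intro Balg_deriv_shift f) auto
    have EB: "E \<in> Balg" unfolding E_def by (intro Balg_diff Balg_cmult B1 B2 B3)
    have psiE: "\<psi> E = \<psi> (\<lambda>z. f (z + of_real (s + h))) - \<psi> (\<lambda>z. f (z + of_real s))
        - h *\<^sub>R \<psi> (\<lambda>z. deriv f (z + of_real s))"
      unfolding E_def using B1 B2 B3 by (simp add: psi_diff psi_scale Balg_diff Balg_cmult del: of_real_add)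
    have "E \<in> Balg \<and> Bnorm E \<le> h\<^sup>2 * Sup ((\<lambda>z. cmod (f2 z)) ` RHP) + (LINT \<alpha>:{0<..}|lborel. h\<^sup>2 * deriv_sup f2 \<alpha>)"
    proof (rule Balg_Bnorm_boundI)
      show "E holomorphic_on RHP" by (rule Balg_holomorphic[OF EB])
      fix z :: complex assume z: "0 < Re z"
      have "cmod (f (z + of_real s + of_real h) - f (z + of_real s) - of_real h * deriv f (z + of_real s))
          \<le> Sup ((\<lambda>z. cmod (f2 z)) ` RHP) * (cmod (of_real h))\<^sup>2"
        using z h s by (intro Taylor_half_plane[OF hol, of "Re z + s / 2"] b2) auto
      then show "cmod (E z) \<le> h\<^sup>2 * Sup ((\<lambda>z. cmod (f2 z)) ` RHP)"
        unfolding E_def by (simp add: algebra_simps)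
      have "deriv E z = deriv (\<lambda>z. f (z + of_real (s + h))) z - deriv (\<lambda>z. f (z + of_real s)) z
            - of_real h * deriv (\<lambda>z. deriv f (z + of_real s)) z"
        unfolding E_def
        by (intro DERIV_imp_deriv DERIV_diff DERIV_cmult DERIV_RHP[OF Balg_holomorphic[OF B1] z]
            DERIV_RHP[OF Balg_holomorphic[OF B2] z] DERIV_RHP[OF Balg_holomorphic[OF B3] z])
      also have "\<dots> = deriv f (z + of_real s + of_real h) - deriv f (z + of_real s)
            - of_real h * deriv (deriv f) (z + of_real s)"
        by (simp add: deriv_shift add.assoc)
      also have "cmod \<dots> \<le> deriv_sup f2 (Re z) * (cmod (of_real h))\<^sup>2"
        using z h s by (intro Taylor_half_plane[OF hold, of "Re z + s / 2"] b3) auto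
      finally show "cmod (deriv E z) \<le> h\<^sup>2 * deriv_sup f2 (Re z)" by (simp add: mult.commute)
    qed (intro set_integrable_mult_right set_integrable_deriv_sup f2)
    then have "Bnorm E \<le> h\<^sup>2 * Bnorm f2"
      by (simp add: Bnorm_def[of f2] enn2real_B0norm[OF f2] distrib_left)
    then have "C * Bnorm E \<le> C * (h\<^sup>2 * Bnorm f2)" using C_nonneg by (rule mult_left_mono)
    then show ?thesis using psi_bound[OF EB] unfolding psiE by linarith
  qed
  fix e :: real assume e: "0 < e"
  \<comment> \<open>The summand 1 avoids division by zero when \<open>C * Bnorm f2\<close>
    vanishes.\<close>
  define d where "d = min (s / 2) (e / (C * Bnorm f2 + 1))"
  have K: "0 \<le> C * Bnorm f2" using C_nonneg Bnorm_nonneg[OF f2] by simp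
  show "\<exists>d>0. \<forall>h. \<bar>h\<bar> < d \<longrightarrow> norm (\<psi> (\<lambda>z. f (z + of_real (s + h))) - \<psi> (\<lambda>z. f (z + of_real s))
        - h *\<^sub>R \<psi> (\<lambda>z. deriv f (z + of_real s))) \<le> e * \<bar>h\<bar>"
  proof (intro exI[of _ d] conjI allI impI)
    show "0 < d" using e s K by (simp add: d_def)
    fix h :: real assume h: "\<bar>h\<bar> < d"
    have "\<bar>h\<bar> * (C * Bnorm f2 + 1) \<le> e" using h K by (simp add: d_def field_simps)
    then have "\<bar>h\<bar> * (C * Bnorm f2) \<le> e" by (simp add: algebra_simps)
    then have "\<bar>h\<bar> * (C * Bnorm f2) * \<bar>h\<bar> \<le> e * \<bar>h\<bar>" by (rule mult_right_mono) simp
    moreover have "C * (h\<^sup>2 * Bnorm f2) = \<bar>h\<bar> * (C * Bnorm f2) * \<bar>h\<bar>"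
    proof -
      have "h\<^sup>2 = \<bar>h\<bar> * \<bar>h\<bar>" by (simp add: power2_eq_square)
      then show ?thesis by (simp only: mult_ac)
    qed
    ultimately show "norm (\<psi> (\<lambda>z. f (z + of_real (s + h))) - \<psi> (\<lambda>z. f (z + of_real s))
        - h *\<^sub>R \<psi> (\<lambda>z. deriv f (z + of_real s))) \<le> e * \<bar>h\<bar>"
      using est[of h] h unfolding d_def by linarith
  qed
qed

text \<open>Only the shifts of g need to lie in the algebra, and the first conclusion passes this to
  g'. The lemma thus iterates and yields p', p'' and the continuity of p''.\<close>

lemma has_vector_derivative_shift:
  assumes g: "\<And>s. 0 < s \<Longrightarrow> (\<lambda>z. g (z + of_real s)) \<in> Balg" and s: "0 < s"
  shows "(\<lambda>z. deriv g (z + of_real s)) \<in> Balg"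
    "((\<lambda>s. \<psi> (\<lambda>z. g (z + of_real s))) has_vector_derivative \<psi> (\<lambda>z. deriv g (z + of_real s))) (at s)"
proof -
  define f where "f = (\<lambda>z. g (z + of_real (s / 2)))"
  have f: "f \<in> Balg" unfolding f_def using s by (intro g) auto
  have df: "(\<lambda>z. deriv f (z + of_real (s/2))) = (\<lambda>z. deriv g (z + of_real s))"
    unfolding f_def deriv_shift by (simp add: add.assoc flip: of_real_add)
  show "(\<lambda>z. deriv g (z + of_real s)) \<in> Balg"
    using Balg_deriv_shift(1)[OF f, of "s/2"] s unfolding df by simp
  have "((\<lambda>s. \<psi> (\<lambda>z. f (z + of_real s))) \<circ> (\<lambda>t. t - s / 2) has_vector_derivative
      1 *\<^sub>R \<psi> (\<lambda>z. deriv f (z + of_real (s / 2)))) (at s)"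
  proof (rule vector_diff_chain_at)
    show "((\<lambda>t. t - s / 2) has_vector_derivative 1) (at s)" by (auto intro!: derivative_eq_intros)
    show "((\<lambda>s. \<psi> (\<lambda>z. f (z + of_real s))) has_vector_derivative \<psi> (\<lambda>z. deriv f (z + of_real (s / 2)))) (at (s - s / 2))"
      using has_vector_derivative_shift_Balg[OF f, of "s/2"] s by simp
  qed
  moreover have "((\<lambda>s. \<psi> (\<lambda>z. f (z + of_real s))) \<circ> (\<lambda>t. t - s / 2)) = (\<lambda>s. \<psi> (\<lambda>z. g (z + of_real s)))"
    by (auto simp: f_def o_def add.assoc simp flip: of_real_add)
  ultimately show "((\<lambda>s. \<psi> (\<lambda>z. g (z + of_real s))) has_vector_derivative \<psi> (\<lambda>z. deriv g (z + of_real s))) (at s)"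
    unfolding df by simp
qed

lemma tendsto_psi_shift_at_0:
  assumes f: "f \<in> Balg"
  shows "((\<lambda>s. \<psi> (\<lambda>z. f (z + of_real s))) \<longlongrightarrow> \<psi> f) (at_right 0)"
proof -
  have "((\<lambda>s. \<psi> (\<lambda>z. f (z + of_real s)) - \<psi> f) \<longlongrightarrow> 0) (at_right 0)"
  proof (rule Lim_null_comparison[where g = "\<lambda>s. C * Bnorm (\<lambda>z. f (z + of_real s) - f z)"])
    show "\<forall>\<^sub>F s in at_right 0. norm (\<psi> (\<lambda>z. f (z + of_real s)) - \<psi> f) \<le> C * Bnorm (\<lambda>z. f (z + of_real s) - f z)"
      unfolding eventually_at_filter
    proof (intro always_eventually allI impI)
      fix s :: real assume "s \<in> {0<..}"
      then have B: "(\<lambda>z. f (z + of_real s)) \<in> Balg" by (intro Balg_shift f) auto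
      show "norm (\<psi> (\<lambda>z. f (z + of_real s)) - \<psi> f) \<le> C * Bnorm (\<lambda>z. f (z + of_real s) - f z)"
        using psi_bound[OF Balg_diff[OF B f]] psi_diff[OF B f] by simp
    qed
    show "((\<lambda>s. C * Bnorm (\<lambda>z. f (z + of_real s) - f z)) \<longlongrightarrow> 0) (at_right 0)"
      by (rule tendsto_mult_right_zero[OF tendsto_Bnorm_shift_at_0[OF f]])
  qed
  then show ?thesis by (simp only: Lim_null[symmetric])
qed

lemma tendsto_psi_shift_at_top:
  assumes f: "f \<in> Balg"
  shows "((\<lambda>s. \<psi> (\<lambda>z. f (z + of_real s))) \<longlongrightarrow> \<psi> (\<lambda>_. f_infty f)) at_top"
proof -
  have "((\<lambda>s. \<psi> (\<lambda>z. f (z + of_real s)) - \<psi> (\<lambda>_. f_infty f)) \<longlongrightarrow> 0) at_top"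
  proof (rule Lim_null_comparison[where g = "\<lambda>s. C * Bnorm (\<lambda>z. f (z + of_real s) - f_infty f)"])
    show "\<forall>\<^sub>F s in at_top. norm (\<psi> (\<lambda>z. f (z + of_real s)) - \<psi> (\<lambda>_. f_infty f)) \<le> C * Bnorm (\<lambda>z. f (z + of_real s) - f_infty f)"
    proof (rule eventually_mono[OF eventually_ge_at_top[of 0]])
      fix s :: real assume "0 \<le> s"
      then have B: "(\<lambda>z. f (z + of_real s)) \<in> Balg" by (intro Balg_shift f) auto
      show "norm (\<psi> (\<lambda>z. f (z + of_real s)) - \<psi> (\<lambda>_. f_infty f)) \<le> C * Bnorm (\<lambda>z. f (z + of_real s) - f_infty f)"
        using psi_bound[OF Balg_diff[OF B Balg_const]] psi_diff[OF B Balg_const] by simp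
    qed
    show "((\<lambda>s. C * Bnorm (\<lambda>z. f (z + of_real s) - f_infty f)) \<longlongrightarrow> 0) at_top"
      by (rule tendsto_mult_right_zero[OF tendsto_Bnorm_shift_at_top[OF f]])
  qed
  then show ?thesis by (simp only: Lim_null[symmetric])
qed

text \<open>With h = f(. + s/2) - f(\<infinity>), the derivative f'(. + s) is h'(. + s/2), of norm
  at most (4/s) times that of h. The factor s cancels and the norm of h tends to 0.\<close>

lemma tendsto_psi_deriv_shift_at_top:
  assumes f: "f \<in> Balg"
  shows "((\<lambda>s. s *\<^sub>R \<psi> (\<lambda>z. deriv f (z + of_real s))) \<longlongrightarrow> 0) at_top"
proof (rule Lim_null_comparison[where g = "\<lambda>s. 4 * C * Bnorm (\<lambda>z. f (z + of_real (s / 2)) - f_infty f)"])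
  show "((\<lambda>s. 4 * C * Bnorm (\<lambda>z. f (z + of_real (s / 2)) - f_infty f)) \<longlongrightarrow> 0) at_top"
  proof (rule tendsto_mult_right_zero)
    have "filterlim (\<lambda>s::real. s / 2) at_top at_top"
      using filterlim_tendsto_pos_mult_at_top[OF tendsto_const[of "1/2::real"] _ filterlim_ident] by simp
    from filterlim_compose[OF tendsto_Bnorm_shift_at_top[OF f] this]
    show "((\<lambda>s. Bnorm (\<lambda>z. f (z + of_real (s / 2)) - f_infty f)) \<longlongrightarrow> 0) at_top" .
  qed
  show "\<forall>\<^sub>F s in at_top. norm (s *\<^sub>R \<psi> (\<lambda>z. deriv f (z + of_real s))) \<le> 4 * C * Bnorm (\<lambda>z. f (z + of_real (s / 2)) - f_infty f)"
  proof (rule eventually_mono[OF eventually_gt_at_top[of 0]])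
    fix s :: real assume s: "0 < s"
    define h where "h = (\<lambda>z. f (z + of_real (s / 2)) - f_infty f)"
    have B: "(\<lambda>z. f (z + of_real (s / 2))) \<in> Balg" using s by (intro Balg_shift f) auto
    have h: "h \<in> Balg" unfolding h_def by (intro Balg_diff B Balg_const)
    have dh: "(\<lambda>z. deriv h (z + of_real (s / 2))) \<in> Balg" using s by (intro Balg_deriv_shift h) auto
    have "\<psi> (\<lambda>z. deriv f (z + of_real s)) = \<psi> (\<lambda>z. deriv h (z + of_real (s / 2)))"
    proof (rule psi_cong[OF _ dh])
      show "(\<lambda>z. deriv f (z + of_real s)) \<in> Balg" using s by (intro Balg_deriv_shift f) auto
      fix z :: complex assume z: "0 < Re z"
      have "deriv h (z + of_real (s/2)) = deriv (\<lambda>z. f (z + of_real (s / 2))) (z + of_real (s/2)) - 0"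
        unfolding h_def using z s
        by (intro DERIV_imp_deriv derivative_intros DERIV_RHP[OF Balg_holomorphic[OF B]]) auto
      then show "deriv f (z + of_real s) = deriv h (z + of_real (s/2))"
        by (simp add: deriv_shift add.assoc flip: of_real_add)
    qed
    then have "norm (\<psi> (\<lambda>z. deriv f (z + of_real s))) \<le> C * (2 / (s/2) * Bnorm h)"
      using psi_bound[OF dh] mult_left_mono[OF Balg_deriv_shift(2)[OF h, of "s/2"] C_nonneg] s by simp
    then have "s * norm (\<psi> (\<lambda>z. deriv f (z + of_real s))) \<le> s * (C * (2 / (s/2) * Bnorm h))"
      using s by (intro mult_left_mono) auto
    also have "\<dots> = 4 * C * Bnorm h" using s by simp
    finally show "norm (s *\<^sub>R \<psi> (\<lambda>z. deriv f (z + of_real s))) \<le> 4 * C * Bnorm (\<lambda>z. f (z + of_real (s / 2)) - f_infty f)"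
      using s by (simp add: h_def)
  qed
qed

text \<open>The bound s |p'(s)| \<le> const alone is not enough. Split f'(. + s) = f'(. + s + t) -
  g'(. + s) with g = f(. + t) - f: the first term stays bounded for fixed t, and s times the second
  is at most 2 C times the norm of g, small by the choice of t.\<close>

lemma tendsto_psi_deriv_shift_at_0:
  assumes f: "f \<in> Balg"
  shows "((\<lambda>s. s *\<^sub>R \<psi> (\<lambda>z. deriv f (z + of_real s))) \<longlongrightarrow> 0) (at_right 0)"
proof (rule tendstoI)
  fix e :: real assume e: "0 < e"
  have "((\<lambda>t. 2 * C * Bnorm (\<lambda>z. f (z + of_real t) - f z)) \<longlongrightarrow> 0) (at_right 0)"
    by (rule tendsto_mult_right_zero[OF tendsto_Bnorm_shift_at_0[OF f]])
  from order_tendstoD(2)[OF this, of "e/2"] e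
  have "\<forall>\<^sub>F t in at_right 0. 2 * C * Bnorm (\<lambda>z. f (z + of_real t) - f z) < e / 2 \<and> 0 < t"
    by (intro eventually_conj eventually_at_right_less) auto
  then obtain t where t: "0 < t" and te: "2 * C * Bnorm (\<lambda>z. f (z + of_real t) - f z) < e / 2"
    using eventually_happens'[OF trivial_limit_at_right_real] by blast
  define g where "g = (\<lambda>z. f (z + of_real t) - f z)"
  have B: "(\<lambda>z. f (z + of_real t)) \<in> Balg" using t by (intro Balg_shift f) auto
  have g: "g \<in> Balg" unfolding g_def by (intro Balg_diff B f)
  have est: "norm (s *\<^sub>R \<psi> (\<lambda>z. deriv f (z + of_real s))) \<le> s * (C * (2 / t * Bnorm f)) + 2 * C * Bnorm g" if s: "0 < s" for s
  proof -
    have B1: "(\<lambda>z. deriv f (z + of_real (s + t))) \<in> Balg" using s t by (intro Balg_deriv_shift f) auto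
    have B2: "(\<lambda>z. deriv g (z + of_real s)) \<in> Balg" using s by (intro Balg_deriv_shift g) auto
    have "\<psi> (\<lambda>z. deriv f (z + of_real s)) = \<psi> (\<lambda>z. deriv f (z + of_real (s + t)) - deriv g (z + of_real s))"
    proof (rule psi_cong[OF _ Balg_diff[OF B1 B2]])
      show "(\<lambda>z. deriv f (z + of_real s)) \<in> Balg" using s by (intro Balg_deriv_shift f) auto
      fix z :: complex assume z: "0 < Re z"
      have "deriv g (z + of_real s) = deriv (\<lambda>z. f (z + of_real t)) (z + of_real s) - deriv f (z + of_real s)"
        unfolding g_def using z s
        by (intro DERIV_imp_deriv DERIV_diff DERIV_RHP[OF Balg_holomorphic[OF B]] DERIV_RHP[OF Balg_holomorphic[OF f]]) auto
      then show "deriv f (z + of_real s) = deriv f (z + of_real (s + t)) - deriv g (z + of_real s)"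
        by (simp add: deriv_shift add.assoc)
    qed
    also have "\<dots> = \<psi> (\<lambda>z. deriv f (z + of_real (s + t))) - \<psi> (\<lambda>z. deriv g (z + of_real s))"
      by (rule psi_diff[OF B1 B2])
    also have "norm \<dots> \<le> C * Bnorm (\<lambda>z. deriv f (z + of_real (s + t))) + C * Bnorm (\<lambda>z. deriv g (z + of_real s))"
      by (rule order_trans[OF norm_triangle_ineq4 add_mono[OF psi_bound[OF B1] psi_bound[OF B2]]])
    also have "\<dots> \<le> C * (2 / t * Bnorm f) + C * (2 / s * Bnorm g)"
    proof (intro add_mono mult_left_mono C_nonneg)
      have "Bnorm (\<lambda>z. deriv f (z + of_real (s + t))) \<le> 2 / (s + t) * Bnorm f"
        using s t by (intro Balg_deriv_shift f) auto
      also have "\<dots> \<le> 2 / t * Bnorm f"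
        using s t Bnorm_nonneg[OF f] by (intro mult_right_mono divide_left_mono) auto
      finally show "Bnorm (\<lambda>z. deriv f (z + of_real (s + t))) \<le> 2 / t * Bnorm f" .
      show "Bnorm (\<lambda>z. deriv g (z + of_real s)) \<le> 2 / s * Bnorm g"
        using s by (intro Balg_deriv_shift g)
    qed
    finally have "s * norm (\<psi> (\<lambda>z. deriv f (z + of_real s))) \<le> s * (C * (2 / t * Bnorm f) + C * (2 / s * Bnorm g))"
      using s by (intro mult_left_mono) auto
    also have "\<dots> = s * (C * (2 / t * Bnorm f)) + 2 * C * Bnorm g" using s by (simp add: distrib_left)
    finally show ?thesis using s by simp
  qed
  have "((\<lambda>s. s * (C * (2 / t * Bnorm f))) \<longlongrightarrow> 0 * (C * (2 / t * Bnorm f))) (at_right 0)"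
    by (intro tendsto_intros)
  then have "\<forall>\<^sub>F s in at_right 0. s * (C * (2 / t * Bnorm f)) < e / 2 \<and> 0 < s"
    using e by (intro eventually_conj eventually_at_right_less order_tendstoD(2)) auto
  then show "\<forall>\<^sub>F s in at_right 0. dist (s *\<^sub>R \<psi> (\<lambda>z. deriv f (z + of_real s))) 0 < e"
  proof (rule eventually_mono)
    fix s assume "s * (C * (2 / t * Bnorm f)) < e / 2 \<and> 0 < s"
    then show "dist (s *\<^sub>R \<psi> (\<lambda>z. deriv f (z + of_real s))) 0 < e"
      using est[of s] te unfolding g_def by (simp add: dist_norm)
  qed
qed

end

subsection \<open>Cauchy kernels\<close>

text \<open>Half of the shift trades one power of decay for a factor 1/b with b = a/2; then
  \<open>Balg_decay\<close> applies with the other half, and 5 (K/b)/b = 20 K/a^2.\<close>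

lemma Balg_decay_square:
  assumes hol: "g holomorphic_on RHP" and a: "0 < a"
    and K: "\<And>z. 0 < Re z \<Longrightarrow> cmod (g z) \<le> K / (Re z)\<^sup>2"
  shows "(\<lambda>z. g (z + of_real a)) \<in> Balg" "Bnorm (\<lambda>z. g (z + of_real a)) \<le> 20 * K / a\<^sup>2"
proof -
  define b where "b = a / 2"
  have b: "0 < b" using a by (simp add: b_def)
  have K0: "0 \<le> K" using order_trans[OF norm_ge_zero K[of 1]] by simp
  have h: "(\<lambda>z. g (z + of_real b)) holomorphic_on RHP"
    using b by (intro holomorphic_on_shift_RHP hol) auto
  have le: "cmod (g (z + of_real b)) \<le> K / b / Re z" if z: "0 < Re z" for z
  proof -
    have "cmod (g (z + of_real b)) \<le> K / (Re (z + of_real b))\<^sup>2" using z b by (intro K) auto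
    also have "\<dots> \<le> K / (b * Re z)"
    proof (intro divide_left_mono K0 mult_pos_pos)
      show "b * Re z \<le> (Re (z + of_real b))\<^sup>2"
        unfolding power2_eq_square using z b by (intro mult_mono) auto
    qed (use z b in auto)
    finally show ?thesis by simp
  qed
  have eq: "(\<lambda>z. g (z + of_real b + of_real b)) = (\<lambda>z. g (z + of_real a))"
    by (simp add: b_def add.assoc flip: of_real_add)
  show "(\<lambda>z. g (z + of_real a)) \<in> Balg"
    using Balg_decay(1)[OF h b le] unfolding eq .
  have "5 * (K / b) / b = 20 * K / a\<^sup>2" using a by (simp add: b_def field_simps power2_eq_square)
  then show "Bnorm (\<lambda>z. g (z + of_real a)) \<le> 20 * K / a\<^sup>2"
    using Balg_decay(2)[OF h b le] unfolding eq by simp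
qed

text \<open>At w = z + a this is the square of r_{a-it} at z; it is also the kernel (w0 - (c +
  it))^{-2} of the differentiated Cauchy formula at w0 = w + c. The two readings link Cauchy's
  formula to the resolvent.\<close>

definition kern :: "real \<Rightarrow> complex \<Rightarrow> complex" where
  "kern t w = inverse ((w - Complex 0 t)\<^sup>2)"

lemma cmod_kern: "cmod (kern t w) = 1 / ((Re w)\<^sup>2 + (Im w - t)\<^sup>2)"
  unfolding kern_def norm_inverse norm_power cmod_power2 by (simp add: inverse_eq_divide)

lemma cmod_kern_le: "0 < Re w \<Longrightarrow> cmod (kern t w) \<le> 1 / (Re w)\<^sup>2"
  unfolding cmod_kern by (intro divide_left_mono mult_pos_pos add_pos_nonneg) auto

lemma holomorphic_kern: "kern t holomorphic_on RHP"
  unfolding kern_def by (intro holomorphic_intros) (auto simp: RHP_def)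

lemma Balg_kern: "0 < a \<Longrightarrow> (\<lambda>z. kern t (z + of_real a)) \<in> Balg"
  using holomorphic_kern cmod_kern_le by (intro Balg_decay_square[where K = 1]) auto

text \<open>The resolvent identity A - B = (it - iu) A B, combined with A^2 - B^2 = (A - B)(A +
  B).\<close>

lemma cmod_kern_diff_le:
  assumes w: "0 < Re w"
  shows "cmod (kern t w - kern u w) \<le> 2 * \<bar>t - u\<bar> / (Re w) ^ 3"
proof -
  have nz: "w - Complex 0 t \<noteq> 0" "w - Complex 0 u \<noteq> 0" using w by (auto simp: complex_eq_iff)
  define A B where "A = inverse (w - Complex 0 t)" and "B = inverse (w - Complex 0 u)"
  have AB: "cmod A \<le> 1 / Re w" "cmod B \<le> 1 / Re w"
    unfolding A_def B_def norm_inverse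
    using w complex_Re_le_cmod[of "w - Complex 0 t"] complex_Re_le_cmod[of "w - Complex 0 u"]
    by (auto simp flip: inverse_eq_divide intro!: le_imp_inverse_le)
  have "A - B = A * B * (Complex 0 t - Complex 0 u)"
    unfolding A_def B_def using nz by (simp add: field_simps)
  then have "kern t w - kern u w = A * B * (Complex 0 t - Complex 0 u) * (A + B)"
    unfolding kern_def power_inverse[symmetric] A_def[symmetric] B_def[symmetric]
    by (metis power2_eq_square square_diff_square_factored mult.commute)
  also have "cmod \<dots> = cmod A * cmod B * \<bar>t - u\<bar> * cmod (A + B)"
  proof -
    have "cmod (Complex 0 t - Complex 0 u) = \<bar>t - u\<bar>" by (simp add: cmod_def)
    then show ?thesis by (simp add: norm_mult)
  qed
  also have "\<dots> \<le> (1 / Re w) * (1 / Re w) * \<bar>t - u\<bar> * (2 / Re w)"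
    using AB w norm_triangle_ineq[of A B] by (intro mult_mono) auto
  also have "\<dots> = 2 * \<bar>t - u\<bar> / (Re w) ^ 3" by (simp add: power3_eq_cube)
  finally show ?thesis .
qed

lemma continuous_on_kern: "0 < Re w \<Longrightarrow> continuous_on S (\<lambda>t. kern t w)"
  unfolding kern_def Complex_eq
  by (intro continuous_intros) auto

lemma holomorphic_integral_kern:
  assumes "continuous_on {c..e} \<phi>"
  shows "(\<lambda>w. integral {c..e} (\<lambda>t. \<phi> t * kern t w)) holomorphic_on RHP"
proof -
  have nz: "w \<noteq> Complex 0 t" if "w \<in> RHP" for w t using that by (auto simp: RHP_def)
  have "(\<lambda>w. integral (cbox c e) (\<lambda>t. \<phi> t * kern t w)) holomorphic_on RHP"
  proof (rule leibniz_rule_holomorphic)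
    show "((\<lambda>w. \<phi> t * kern t w) has_field_derivative \<phi> t * (-2 * inverse ((w - Complex 0 t) ^ 3))) (at w within RHP)"
      if "w \<in> RHP" for w t
    proof -
      have n: "w - Complex 0 t \<noteq> 0" using nz[OF that, of t] by simp
      have "((\<lambda>x. inverse (x\<^sup>2)) has_field_derivative -2 * inverse (x ^ 3)) (at x)" if "x \<noteq> 0" for x :: complex
        using that by (auto intro!: derivative_eq_intros simp: field_simps power2_eq_square power3_eq_cube)
      from DERIV_chain2[where f = "\<lambda>x. inverse (x\<^sup>2)" and g = "\<lambda>w. w - Complex 0 t" and x = w and s = UNIV,
          OF this[OF n] DERIV_diff[OF DERIV_ident DERIV_const]]
      have "(kern t has_field_derivative -2 * inverse ((w - Complex 0 t) ^ 3)) (at w)"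
        by (simp add: kern_def[abs_def])
      then show ?thesis by (rule DERIV_cmult[OF has_field_derivative_at_within])
    qed
    show "(\<lambda>t. \<phi> t * kern t w) integrable_on cbox c e" if "w \<in> RHP" for w
      using that assms by (auto intro!: integrable_continuous_real continuous_intros continuous_on_kern simp: RHP_def)
    have "continuous_on (RHP \<times> cbox c e) (\<lambda>x. \<phi> (snd x) * (-2 * inverse ((fst x - \<i> * of_real (snd x)) ^ 3)))"
      using nz assms
      by (intro continuous_intros continuous_on_compose2[OF assms]) (auto simp: Complex_eq)
    then show "continuous_on (RHP \<times> cbox c e) (\<lambda>(w, t). \<phi> t * (-2 * inverse ((w - Complex 0 t) ^ 3)))"
      by (simp add: case_prod_unfold Complex_eq)
    show "convex RHP" unfolding RHP_def by (rule convex_halfspace_Re_gt)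
  qed
  then show ?thesis by simp
qed

text \<open>|kern| is pi/Re w times the Poisson kernel, with an arctangent as primitive. The bound
  does not depend on the interval and is the source of the O(1/a) behaviour.\<close>

lemma integral_cmod_kern_le:
  assumes w: "0 < Re w" and ce: "c \<le> e"
  shows "integral {c..e} (\<lambda>t. cmod (kern t w)) \<le> pi / Re w"
proof -
  have "((\<lambda>t. cmod (kern t w)) has_integral
      arctan ((e - Im w) / Re w) / Re w - arctan ((c - Im w) / Re w) / Re w) {c..e}"
  proof (rule fundamental_theorem_of_calculus[OF ce])
    fix t
    have "((\<lambda>t. arctan ((t - Im w) / Re w) / Re w) has_real_derivative cmod (kern t w)) (at t within {c..e})"
    proof -
      have "(1 + (t - Im w) * (t - Im w) / (Re w * Re w)) * (Re w * Re w) = Re w * Re w + (Im w - t) * (Im w - t)"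
        using w by (simp add: field_simps)
      then show ?thesis
        unfolding cmod_kern using w
        by (auto intro!: derivative_eq_intros simp: inverse_eq_divide power2_eq_square mult.assoc)
    qed
    then show "((\<lambda>t. arctan ((t - Im w) / Re w) / Re w) has_vector_derivative cmod (kern t w)) (at t within {c..e})"
      by (simp add: has_real_derivative_iff_has_vector_derivative)
  qed
  then have "integral {c..e} (\<lambda>t. cmod (kern t w)) = (arctan ((e - Im w) / Re w) - arctan ((c - Im w) / Re w)) / Re w"
    by (simp add: integral_unique diff_divide_distrib)
  also have "\<dots> \<le> pi / Re w"
    using w arctan_bounded[of "(e - Im w) / Re w"] arctan_bounded[of "(c - Im w) / Re w"]
    by (intro divide_right_mono) auto
  finally show ?thesis .
qed

text \<open>A difference quotient estimate with explicit error: \<open>B\<close> may depend on a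
  parameter, so that pointwise estimates in w can be turned into norm estimates.\<close>

lemma norm_integral_increment_le:
  fixes F :: "real \<Rightarrow> complex"
  assumes cont: "continuous_on {c..e} F" and x: "x \<in> {c..e}" and y: "y \<in> {c..e}"
    and B: "\<And>t. \<bar>t - x\<bar> \<le> \<bar>y - x\<bar> \<Longrightarrow> norm (F t - F x) \<le> B"
  shows "norm (integral {c..y} F - integral {c..x} F - (y - x) *\<^sub>R F x) \<le> B * \<bar>y - x\<bar>"
proof -
  have int: "F integrable_on {u..v}" if "c \<le> u" "v \<le> e" for u v
    using that by (intro integrable_continuous_real continuous_on_subset[OF cont]) auto
  have main: "norm (integral {u..v} F - (v - u) *\<^sub>R F x) \<le> B * (v - u)"
    if "c \<le> u" "u \<le> v" "v \<le> e" and "\<And>t. t \<in> {u..v} \<Longrightarrow> norm (F t - F x) \<le> B" for u v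
  proof -
    have "integral {u..v} (\<lambda>t. F t - F x) = integral {u..v} F - (v - u) *\<^sub>R F x"
      using that int[of u v] by (subst integral_diff) auto
    moreover have "norm (integral {u..v} (\<lambda>t. F t - F x)) \<le> B * (v - u)"
      using that by (intro integral_bound continuous_intros continuous_on_subset[OF cont]) auto
    ultimately show ?thesis by simp
  qed
  show ?thesis
  proof (cases "x \<le> y")
    case True
    have "integral {c..x} F + integral {x..y} F = integral {c..y} F"
      using True x y int[of c y] by (intro Henstock_Kurzweil_Integration.integral_combine) auto
    then have "integral {c..y} F - integral {c..x} F - (y - x) *\<^sub>R F x = integral {x..y} F - (y - x) *\<^sub>R F x"
      by (simp add: algebra_simps)
    then show ?thesis using main[of x y] True x y B by simp
  next
    case False
    have "integral {c..y} F + integral {y..x} F = integral {c..x} F"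
      using False x y int[of c x] by (intro Henstock_Kurzweil_Integration.integral_combine) auto
    then have "integral {c..y} F - integral {c..x} F - (y - x) *\<^sub>R F x = - (integral {y..x} F - (x - y) *\<^sub>R F x)"
      by (simp add: algebra_simps)
    then show ?thesis using main[of y x] False x y B
      by (simp del: minus_diff_eq) (simp add: algebra_simps)
  qed
qed

context Balg_functional
begin

text \<open>The map is Lipschitz: of the three powers in the kernel difference, half of the shift
  absorbs two as 1/b^2, and the third is the decay that \<open>Balg_decay\<close> requires.\<close>

lemma continuous_on_psi_kern:
  assumes a: "0 < a"
  shows "continuous_on UNIV (\<lambda>t. \<psi> (\<lambda>z. kern t (z + of_real a)))"
proof -
  define b where "b = a / 2"
  have b: "0 < b" using a by (simp add: b_def)
  have lip: "norm (\<psi> (\<lambda>z. kern t (z + of_real a)) - \<psi> (\<lambda>z. kern u (z + of_real a))) \<le> C * (5 * (2 / b\<^sup>2) / b) * \<bar>t - u\<bar>" for t u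
  proof -
    define E where "E = (\<lambda>z. kern t (z + of_real b) - kern u (z + of_real b))"
    have hE: "E holomorphic_on RHP" unfolding E_def using b
      by (intro holomorphic_intros holomorphic_on_shift_RHP holomorphic_kern) auto
    have bE: "cmod (E z) \<le> (2 * \<bar>t - u\<bar> / b\<^sup>2) / Re z" if z: "0 < Re z" for z
    proof -
      have "cmod (E z) \<le> 2 * \<bar>t - u\<bar> / (Re (z + of_real b)) ^ 3"
        unfolding E_def using z b by (intro cmod_kern_diff_le) auto
      also have "\<dots> \<le> 2 * \<bar>t - u\<bar> / (b\<^sup>2 * Re z)"
      proof (intro divide_left_mono mult_pos_pos)
        have "b\<^sup>2 * Re z \<le> (Re z + b)\<^sup>2 * (Re z + b)"
          using z b by (intro mult_mono power_mono) auto
        then show "b\<^sup>2 * Re z \<le> (Re (z + of_real b)) ^ 3" by (simp add: power2_eq_square power3_eq_cube)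
      qed (use z b in auto)
      finally show ?thesis by simp
    qed
    have eq: "(\<lambda>z. E (z + of_real b)) = (\<lambda>z. kern t (z + of_real a) - kern u (z + of_real a))"
      by (simp add: E_def b_def add.assoc flip: of_real_add)
    have "norm (\<psi> (\<lambda>z. kern t (z + of_real a) - kern u (z + of_real a))) \<le> C * (5 * (2 * \<bar>t - u\<bar> / b\<^sup>2) / b)"
      using order_trans[OF psi_bound[OF Balg_decay(1)[OF hE b bE]] mult_left_mono[OF Balg_decay(2)[OF hE b bE] C_nonneg]]
      unfolding eq .
    then show ?thesis using psi_diff[OF Balg_kern[OF a] Balg_kern[OF a]] by (simp add: field_simps)
  qed
  have "(C * (5 * (2 / b\<^sup>2) / b))-lipschitz_on UNIV (\<lambda>t. \<psi> (\<lambda>z. kern t (z + of_real a)))"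
    using lip C_nonneg b by (intro lipschitz_onI) (auto simp: dist_norm)
  then show ?thesis by (rule lipschitz_on_continuous_on)
qed

text \<open>The right-hand side is differentiable in the upper end point, by an estimate in the norm of
the algebra; so $\psi$ may be moved under the integral without Bochner integration.\<close>

lemma has_integral_psi_kern:
  fixes \<phi> :: "real \<Rightarrow> complex"
  assumes a: "0 < a" and ce: "c \<le> e" and phi: "continuous_on UNIV \<phi>"
  shows "((\<lambda>t. \<psi> (\<lambda>z. \<phi> t * kern t (z + of_real a))) has_integral
          \<psi> (\<lambda>z. integral {c..e} (\<lambda>t. \<phi> t * kern t (z + of_real a)))) {c..e}"
proof -
  define b where "b = a / 2"
  have b: "0 < b" using a by (simp add: b_def)
  define V where "V y w = integral {c..y} (\<lambda>t. \<phi> t * kern t w)" for y w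
  have holV: "V y holomorphic_on RHP" for y
    unfolding V_def by (intro holomorphic_integral_kern continuous_on_subset[OF phi]) auto
  have ab: "z + of_real a = z + of_real b + of_real b" for z :: complex
    by (simp add: b_def add.assoc flip: of_real_add)
  have contF: "continuous_on S (\<lambda>t. \<phi> t * kern t w)" if "0 < Re w" for w S
    using that by (intro continuous_intros continuous_on_kern continuous_on_subset[OF phi]) auto
  have VB: "(\<lambda>z. V y (z + of_real a)) \<in> Balg" for y
  proof -
    have "bounded (\<phi> ` {c..y})"
      by (intro compact_imp_bounded compact_continuous_image continuous_on_subset[OF phi]) auto
    then obtain P where P: "\<And>t. t \<in> {c..y} \<Longrightarrow> cmod (\<phi> t) \<le> P" by (force simp: bounded_iff)
    show ?thesis
    proof (rule Balg_decay_square[OF holV a])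
      fix w :: complex assume w: "0 < Re w"
      show "cmod (V y w) \<le> (\<bar>P\<bar> * \<bar>y - c\<bar>) / (Re w)\<^sup>2"
      proof (cases "c \<le> y")
        case True
        have "cmod (V y w) \<le> (\<bar>P\<bar> * (1 / (Re w)\<^sup>2)) * (y - c)"
          unfolding V_def
        proof (rule integral_bound[OF True contF[OF w]])
          fix t assume "t \<in> {c..y}"
          from P[OF this] show "cmod (\<phi> t * kern t w) \<le> \<bar>P\<bar> * (1 / (Re w)\<^sup>2)"
            unfolding norm_mult by (intro mult_mono cmod_kern_le w) auto
        qed
        then show ?thesis using True by simp
      qed (simp add: V_def)
    qed
  qed
  have FB: "(\<lambda>z. \<phi> t * kern t (z + of_real a)) \<in> Balg" for t
    by (intro Balg_cmult Balg_kern a)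
  have "((\<lambda>t. \<psi> (\<lambda>z. \<phi> t * kern t (z + of_real a))) has_integral
      \<psi> (\<lambda>z. V e (z + of_real a)) - \<psi> (\<lambda>z. V c (z + of_real a))) {c..e}"
  proof (rule fundamental_theorem_of_calculus[OF ce])
    fix x assume x: "x \<in> {c..e}"
    show "((\<lambda>y. \<psi> (\<lambda>z. V y (z + of_real a))) has_vector_derivative \<psi> (\<lambda>z. \<phi> x * kern x (z + of_real a))) (at x within {c..e})"
      unfolding has_vector_derivative_def has_derivative_within_alt
    proof (intro conjI allI impI)
      show "bounded_linear (\<lambda>h. h *\<^sub>R \<psi> (\<lambda>z. \<phi> x * kern x (z + of_real a)))"
        by (rule bounded_linear_scaleR_left)
      fix r :: real assume r: "0 < r"
      \<comment> \<open>Chosen so that C * 5 * q / b^2 \<le> r, the loss caused by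
        \<open>Balg_decay\<close> and \<psi>; the extra 5 in the denominator allows C = 0.\<close>
      define q where "q = r * b\<^sup>2 / (5 * C + 5)"
      have q: "0 < q" using r b C_nonneg by (simp add: q_def)
      have "isCont \<phi> x" using phi by (simp add: continuous_on_eq_continuous_at)
      then obtain d1 where d1: "0 < d1" "\<And>t. \<bar>t - x\<bar> < d1 \<Longrightarrow> cmod (\<phi> t - \<phi> x) \<le> q / 2"
        using q unfolding continuous_at_eps_delta dist_norm
        by (metis half_gt_zero less_imp_le real_norm_def)
      \<comment> \<open>The second bound makes |\<phi>(x)| * 2|t - x|/b \<le> q/2, so the variation
        of the kernel costs no more than that of \<phi>.\<close>
      define d where "d = min d1 (q * b / (4 * cmod (\<phi> x) + 4))"
      have d: "0 < d" using d1 q b by (simp add: d_def add_nonneg_pos)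
      show "\<exists>d>0. \<forall>y\<in>{c..e}. norm (y - x) < d \<longrightarrow>
            norm (\<psi> (\<lambda>z. V y (z + of_real a)) - \<psi> (\<lambda>z. V x (z + of_real a))
              - (y - x) *\<^sub>R \<psi> (\<lambda>z. \<phi> x * kern x (z + of_real a))) \<le> r * norm (y - x)"
      proof (intro exI[of _ d] conjI ballI impI d)
        fix y assume y: "y \<in> {c..e}" and yx: "norm (y - x) < d"
        define E where "E = (\<lambda>w. V y (w + of_real b) - V x (w + of_real b) - of_real (y - x) * (\<phi> x * kern x (w + of_real b)))"
        have hE: "E holomorphic_on RHP"
          unfolding E_def using b
          by (intro holomorphic_intros holomorphic_on_shift_RHP holV holomorphic_kern) auto
        have bE: "cmod (E w) \<le> (q / b * \<bar>y - x\<bar>) / Re w" if w: "0 < Re w" for w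
        proof -
          define u where "u = w + of_real b"
          have u: "0 < Re u" "b \<le> Re u" "Re w \<le> Re u" using w b by (auto simp: u_def)
          have "cmod (V y u - V x u - (y - x) *\<^sub>R (\<phi> x * kern x u)) \<le> (q / b / Re w) * \<bar>y - x\<bar>"
            unfolding V_def
          proof (rule norm_integral_increment_le[OF contF[OF u(1)] x y])
            fix t assume t: "\<bar>t - x\<bar> \<le> \<bar>y - x\<bar>"
            have td: "\<bar>t - x\<bar> < d" using t yx by simp
            \<comment> \<open>Variation of \<phi> and of the kernel are estimated separately; each
              estimate keeps a factor 1/Re w, the decay needed for the norm bound.\<close>
            have "\<phi> t * kern t u - \<phi> x * kern x u = (\<phi> t - \<phi> x) * kern t u + \<phi> x * (kern t u - kern x u)"
              by (simp add: algebra_simps)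
            also have "cmod \<dots> \<le> cmod (\<phi> t - \<phi> x) * cmod (kern t u) + cmod (\<phi> x) * cmod (kern t u - kern x u)"
              using norm_triangle_ineq by (metis norm_mult)
            also have "\<dots> \<le> q / 2 * (1 / (b * Re w)) + q / 2 * (1 / (b * Re w))"
            proof (rule add_mono)
              have bw: "1 / (Re u)\<^sup>2 \<le> 1 / (b * Re w)"
                unfolding power2_eq_square using u w b by (intro divide_left_mono mult_mono mult_pos_pos) auto
              then show "cmod (\<phi> t - \<phi> x) * cmod (kern t u) \<le> q / 2 * (1 / (b * Re w))"
                using d1(2)[of t] td q cmod_kern_le[OF u(1), of t] unfolding d_def
                by (intro mult_mono) auto
              have "2 * \<bar>t - x\<bar> / (Re u) ^ 3 = 2 * \<bar>t - x\<bar> / Re u * (1 / (Re u)\<^sup>2)"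
                by (simp add: power2_eq_square power3_eq_cube)
              also have "\<dots> \<le> 2 * \<bar>t - x\<bar> / b * (1 / (b * Re w))"
                using u b w by (intro mult_mono[OF divide_left_mono bw] mult_pos_pos) auto
              finally have k: "cmod (kern t u - kern x u) \<le> 2 * \<bar>t - x\<bar> / b * (1 / (b * Re w))"
                using cmod_kern_diff_le[OF u(1), of t x] by linarith
              have "\<bar>t - x\<bar> * (4 * cmod (\<phi> x) + 4) \<le> q * b"
              proof -
                have "0 < 4 * cmod (\<phi> x) + 4" by (simp add: add_nonneg_pos)
                moreover have "\<bar>t - x\<bar> < q * b / (4 * cmod (\<phi> x) + 4)" using td by (simp add: d_def)
                ultimately show ?thesis by (simp only: pos_less_divide_eq less_imp_le)
              qed
              moreover have "cmod (\<phi> x) * (4 * \<bar>t - x\<bar>) \<le> \<bar>t - x\<bar> * (4 * cmod (\<phi> x) + 4)"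
                by (simp add: distrib_left mult_ac)
              ultimately have "cmod (\<phi> x) * (4 * \<bar>t - x\<bar>) \<le> q * b" by (rule order_trans[rotated])
              then have k2: "cmod (\<phi> x) * (2 * \<bar>t - x\<bar> / b) \<le> q / 2" using b by (simp add: field_simps)
              have "cmod (\<phi> x) * cmod (kern t u - kern x u) \<le> cmod (\<phi> x) * (2 * \<bar>t - x\<bar> / b * (1 / (b * Re w)))"
                using k by (intro mult_left_mono) auto
              also have "\<dots> = cmod (\<phi> x) * (2 * \<bar>t - x\<bar> / b) * (1 / (b * Re w))" by (simp only: mult.assoc)
              also have "\<dots> \<le> q / 2 * (1 / (b * Re w))" using k2 b w by (intro mult_right_mono) auto
              finally show "cmod (\<phi> x) * cmod (kern t u - kern x u) \<le> q / 2 * (1 / (b * Re w))" .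
            qed
            also have "\<dots> = q / b / Re w" by simp
            finally show "cmod (\<phi> t * kern t u - \<phi> x * kern x u) \<le> q / b / Re w" .
          qed
          then show ?thesis by (simp add: E_def u_def scaleR_conv_of_real)
        qed
        have eq: "(\<lambda>z. E (z + of_real b)) = (\<lambda>z. V y (z + of_real a) - V x (z + of_real a) - of_real (y - x) * (\<phi> x * kern x (z + of_real a)))"
          by (simp add: E_def ab)
        have "norm (\<psi> (\<lambda>z. E (z + of_real b))) \<le> C * (5 * (q / b * \<bar>y - x\<bar>) / b)"
          by (rule order_trans[OF psi_bound[OF Balg_decay(1)[OF hE b bE]] mult_left_mono[OF Balg_decay(2)[OF hE b bE] C_nonneg]])
        moreover have "\<psi> (\<lambda>z. E (z + of_real b)) = \<psi> (\<lambda>z. V y (z + of_real a)) - \<psi> (\<lambda>z. V x (z + of_real a))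
              - (y - x) *\<^sub>R \<psi> (\<lambda>z. \<phi> x * kern x (z + of_real a))"
          unfolding eq using VB FB by (simp add: psi_diff psi_scale Balg_diff Balg_cmult del: of_real_diff)
        moreover have "C * (5 * (q / b * \<bar>y - x\<bar>) / b) \<le> r * \<bar>y - x\<bar>"
        proof -
          have "C * (5 * (q / b) / b) = r * (5 * C / (5 * C + 5))"
            using b unfolding q_def by (simp add: power2_eq_square)
          also have "\<dots> \<le> r * 1" using r C_nonneg by (intro mult_left_mono) auto
          finally have "C * (5 * (q / b) / b) * \<bar>y - x\<bar> \<le> r * \<bar>y - x\<bar>" by (intro mult_right_mono) auto
          then show ?thesis by simp
        qed
        ultimately show "norm (\<psi> (\<lambda>z. V y (z + of_real a)) - \<psi> (\<lambda>z. V x (z + of_real a))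
              - (y - x) *\<^sub>R \<psi> (\<lambda>z. \<phi> x * kern x (z + of_real a))) \<le> r * norm (y - x)"
          by simp
      qed
    qed
  qed
  moreover have "\<psi> (\<lambda>z. V c (z + of_real a)) = 0"
    using psi_scale[OF Balg_const[of 0], of 0] by (simp add: V_def)
  ultimately show ?thesis by (simp add: V_def)
qed

end

text \<open>Kernel bounded by (Re w)^{-2}, weight integrated through the primitive -L/t. The form of
  the bound is correct on both sides of 0, so it serves both tails.\<close>

lemma cmod_integral_kern_le:
  fixes \<phi> :: "real \<Rightarrow> complex"
  assumes phi: "continuous_on UNIV \<phi>" and w: "0 < Re w" and uv: "u \<le> v" "0 \<notin> {u..v}"
    and decay: "\<And>t. t \<noteq> 0 \<Longrightarrow> cmod (\<phi> t) \<le> L / t\<^sup>2"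
  shows "cmod (integral {u..v} (\<lambda>t. \<phi> t * kern t w)) \<le> (L / u - L / v) / (Re w)\<^sup>2"
proof -
  have hi: "((\<lambda>t. L / t\<^sup>2 * (1 / (Re w)\<^sup>2)) has_integral (- L / v - - L / u) * (1 / (Re w)\<^sup>2)) {u..v}"
  proof (intro has_integral_mult_left fundamental_theorem_of_calculus uv(1))
    fix t assume "t \<in> {u..v}"
    then have "t \<noteq> 0" using uv(2) by auto
    then have "((\<lambda>t. - L / t) has_real_derivative L / t\<^sup>2) (at t within {u..v})"
      by (auto intro!: derivative_eq_intros simp: power2_eq_square)
    then show "((\<lambda>t. - L / t) has_vector_derivative L / t\<^sup>2) (at t within {u..v})"
      by (simp add: has_real_derivative_iff_has_vector_derivative)
  qed
  have "cmod (integral {u..v} (\<lambda>t. \<phi> t * kern t w)) \<le> integral {u..v} (\<lambda>t. L / t\<^sup>2 * (1 / (Re w)\<^sup>2))"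
  proof (rule integral_norm_bound_integral)
    show "(\<lambda>t. \<phi> t * kern t w) integrable_on {u..v}"
      using w by (intro integrable_continuous_real continuous_intros continuous_on_kern continuous_on_subset[OF phi]) auto
    show "(\<lambda>t. L / t\<^sup>2 * (1 / (Re w)\<^sup>2)) integrable_on {u..v}" using hi by blast
    fix t assume t: "t \<in> {u..v}"
    show "cmod (\<phi> t * kern t w) \<le> L / t\<^sup>2 * (1 / (Re w)\<^sup>2)"
    proof -
      have "t \<noteq> 0" using t uv(2) by auto
      note d = decay[OF this]
      show ?thesis unfolding norm_mult
        using order_trans[OF norm_ge_zero d] by (intro mult_mono d cmod_kern_le w) auto
    qed
  qed
  also have "\<dots> = (L / u - L / v) / (Re w)\<^sup>2"
    unfolding integral_unique[OF hi] by simp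
  finally show ?thesis .
qed

context Balg_functional
begin

text \<open>Quadratic decay of g on the line makes the truncated Cauchy integrals converge in the
  norm of the algebra: the error is at most (2L/N)/(Re w)^2, so its shift by c has norm
  O(1/N).\<close>

lemma tendsto_psi_integral_kern:
  assumes hol: "g holomorphic_on RHP" and c: "0 < c"
    and K: "\<And>w. c \<le> Re w \<Longrightarrow> cmod (g w) \<le> K"
    and decay: "\<And>t. t \<noteq> 0 \<Longrightarrow> cmod (g (Complex c t)) \<le> L / t\<^sup>2"
    and dB: "(\<lambda>z. deriv g (z + of_real (2 * c))) \<in> Balg"
  shows "((\<lambda>N. \<psi> (\<lambda>z. integral {-N..N} (\<lambda>t. g (Complex c t) * kern t (z + of_real c)))) \<longlongrightarrow>
           (- (2 * pi)) *\<^sub>R \<psi> (\<lambda>z. deriv g (z + of_real (2 * c)))) at_top"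
proof -
  define \<phi> where "\<phi> = (\<lambda>t. g (Complex c t))"
  have phi: "continuous_on UNIV \<phi>"
    unfolding \<phi>_def
    by (rule continuous_on_compose2[OF holomorphic_on_imp_continuous_on[OF hol]])
       (use c in \<open>auto simp: Complex_eq RHP_def intro!: continuous_intros\<close>)
  have L0: "0 \<le> L" using order_trans[OF norm_ge_zero decay[of 1]] by simp
  define V where "V N w = integral {-N..N} (\<lambda>t. \<phi> t * kern t w)" for N w
  have holV: "V N holomorphic_on RHP" for N
    unfolding V_def by (intro holomorphic_integral_kern continuous_on_subset[OF phi]) auto
  define E where "E N w = of_real (- (2 * pi)) * deriv g (w + of_real c) - V N w" for N w
  have cc: "z + of_real c + of_real c = z + of_real (2 * c)" for z :: complex by simp
  have Vlim: "((\<lambda>N. V N w) \<longlongrightarrow> of_real (- (2 * pi)) * deriv g (w + of_real c)) at_top" if w: "0 < Re w" for w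
  proof -
    have eq: "w + of_real c - Complex c t = w - Complex 0 t" for t by (simp add: complex_eq_iff)
    have lt: "c < Re (w + of_real c)" using w by simp
    show ?thesis
      using Cauchy_formula_deriv_half_plane[OF hol c K lt]
      unfolding eq V_def \<phi>_def kern_def divide_inverse by simp
  qed
  \<comment> \<open>The error is the limit of \<open>V M - V N\<close> as M grows; each of the two
    tails contributes at most L/N.\<close>
  have bE: "cmod (E N w) \<le> (2 * L / N) / (Re w)\<^sup>2" if w: "0 < Re w" and N: "0 < N" for N w
  proof (rule tendsto_upperbound)
    show "((\<lambda>M. cmod (V M w - V N w)) \<longlongrightarrow> cmod (E N w)) at_top"
      unfolding E_def by (intro tendsto_intros Vlim w)
    show "\<forall>\<^sub>F M in at_top. cmod (V M w - V N w) \<le> (2 * L / N) / (Re w)\<^sup>2"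
    proof (rule eventually_mono[OF eventually_ge_at_top[of N]])
      fix M assume M: "N \<le> M"
      have int: "(\<lambda>t. \<phi> t * kern t w) integrable_on {u..v}" for u v
        using w by (intro integrable_continuous_real continuous_intros continuous_on_kern continuous_on_subset[OF phi]) auto
      have e1: "integral {-M..-N} (\<lambda>t. \<phi> t * kern t w) + integral {-N..M} (\<lambda>t. \<phi> t * kern t w) = V M w"
        unfolding V_def using M N by (intro Henstock_Kurzweil_Integration.integral_combine int) auto
      have e2: "V N w + integral {N..M} (\<lambda>t. \<phi> t * kern t w) = integral {-N..M} (\<lambda>t. \<phi> t * kern t w)"
        unfolding V_def using M N by (intro Henstock_Kurzweil_Integration.integral_combine int) auto
      have "V M w - V N w = integral {-M..-N} (\<lambda>t. \<phi> t * kern t w) + integral {N..M} (\<lambda>t. \<phi> t * kern t w)"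
        by (simp add: e1[symmetric] e2[symmetric])
      also have "cmod \<dots> \<le> (L / (-M) - L / (-N)) / (Re w)\<^sup>2 + (L / N - L / M) / (Re w)\<^sup>2"
        using M N decay unfolding \<phi>_def[symmetric]
        by (intro norm_triangle_le add_mono cmod_integral_kern_le[OF phi w]) (auto simp: \<phi>_def)
      also have "\<dots> = (2 * L / N - 2 * L / M) / (Re w)\<^sup>2"
        by (simp add: add_divide_distrib[symmetric])
      also have "\<dots> \<le> (2 * L / N) / (Re w)\<^sup>2"
        using L0 M N by (intro divide_right_mono) auto
      finally show "cmod (V M w - V N w) \<le> (2 * L / N) / (Re w)\<^sup>2" .
    qed
  qed simp
  have holE: "E N holomorphic_on RHP" for N
    unfolding E_def
    by (intro holomorphic_on_diff holomorphic_on_mult holomorphic_on_const holV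
        holomorphic_on_shift_RHP[OF holomorphic_deriv_RHP[OF hol] less_imp_le[OF c]])
  have "((\<lambda>N. \<psi> (\<lambda>z. V N (z + of_real c)) - (- (2 * pi)) *\<^sub>R \<psi> (\<lambda>z. deriv g (z + of_real (2 * c)))) \<longlongrightarrow> 0) at_top"
  proof (rule Lim_null_comparison)
    show "\<forall>\<^sub>F N in at_top. norm (\<psi> (\<lambda>z. V N (z + of_real c)) - (- (2 * pi)) *\<^sub>R \<psi> (\<lambda>z. deriv g (z + of_real (2 * c))))
        \<le> C * (20 * (2 * L) / c\<^sup>2) / N"
    proof (rule eventually_mono[OF eventually_gt_at_top[of 0]])
      fix N :: real assume N: "0 < N"
      have EB: "(\<lambda>z. E N (z + of_real c)) \<in> Balg" and En: "Bnorm (\<lambda>z. E N (z + of_real c)) \<le> 20 * (2 * L / N) / c\<^sup>2"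
        using Balg_decay_square[OF holE c bE[OF _ N]] by auto
      define G where "G = (\<lambda>z. of_real (- (2 * pi)) * deriv g (z + of_real (2 * c)))"
      have GB: "G \<in> Balg" unfolding G_def by (rule Balg_cmult[OF dB])
      have eq: "(\<lambda>z. V N (z + of_real c)) = (\<lambda>z. G z - E N (z + of_real c))"
        by (simp add: E_def G_def cc[symmetric] del: of_real_mult)
      have "\<psi> (\<lambda>z. V N (z + of_real c)) = (- (2 * pi)) *\<^sub>R \<psi> (\<lambda>z. deriv g (z + of_real (2 * c))) - \<psi> (\<lambda>z. E N (z + of_real c))"
        unfolding eq psi_diff[OF GB EB] unfolding G_def psi_scale[OF dB] ..
      then have "norm (\<psi> (\<lambda>z. V N (z + of_real c)) - (- (2 * pi)) *\<^sub>R \<psi> (\<lambda>z. deriv g (z + of_real (2 * c))))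
          \<le> C * (20 * (2 * L / N) / c\<^sup>2)"
        using order_trans[OF psi_bound[OF EB] mult_left_mono[OF En C_nonneg]] by simp
      then show "norm (\<psi> (\<lambda>z. V N (z + of_real c)) - (- (2 * pi)) *\<^sub>R \<psi> (\<lambda>z. deriv g (z + of_real (2 * c))))
        \<le> C * (20 * (2 * L) / c\<^sup>2) / N" by (simp add: mult.commute)
    qed
    show "((\<lambda>N. C * (20 * (2 * L) / c\<^sup>2) / N) \<longlongrightarrow> 0) at_top"
      by (intro tendsto_divide_0[OF tendsto_const] filterlim_at_top_imp_at_infinity filterlim_ident)
  qed
  then show ?thesis unfolding V_def \<phi>_def by (simp only: Lim_null[symmetric])
qed

end

section \<open>Lebesgue integrability of the squared resolvents\<close>

lemma tendsto_integral_symmetric_interval: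
  fixes F :: "real \<Rightarrow> complex"
  assumes F: "integrable lborel F"
  shows "((\<lambda>N. integral {-N..N} F) \<longlongrightarrow> (LINT t|lborel. F t)) at_top"
proof -
  have "((\<lambda>N. LINT t|lborel. indicator {-N..N} t *\<^sub>R F t) \<longlongrightarrow> (LINT t|lborel. F t)) at_top"
  proof (rule integral_dominated_convergence_at_top)
    show "integrable lborel (\<lambda>t. norm (F t))" using F by simp
    show "\<forall>\<^sub>F N in at_top. AE t in lborel. norm (indicator {-N..N} t *\<^sub>R F t) \<le> norm (F t)"
      by (auto simp: indicator_def)
    have "((\<lambda>N. indicator {-N..N} t *\<^sub>R F t) \<longlongrightarrow> F t) at_top" for t
      by (rule tendsto_eventually[OF eventually_mono[OF eventually_ge_at_top[of "\<bar>t\<bar>"]]]) (auto simp: indicator_def)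
    then show "AE t in lborel. ((\<lambda>N. indicator {-N..N} t *\<^sub>R F t) \<longlongrightarrow> F t) at_top" by simp
  qed (use F in auto)
  moreover have "(LINT t|lborel. indicator {-N..N} t *\<^sub>R F t) = integral {-N..N} F" for N
    using set_borel_integral_eq_integral(2)[of "{-N..N}" F] integrable_mult_indicator[OF _ F, of "{-N..N}"]
    by (simp add: set_lebesgue_integral_def set_integrable_def)
  ultimately show ?thesis by simp
qed

lemma integrable_of_bounded_integrals:
  fixes F :: "real \<Rightarrow> complex"
  assumes cont: "continuous_on UNIV F" and B: "\<And>N. 0 \<le> N \<Longrightarrow> integral {-N..N} (\<lambda>t. norm (F t)) \<le> B"
  shows "integrable lborel F" "(LINT t|lborel. norm (F t)) \<le> B"
proof -
  have [measurable]: "F \<in> borel_measurable borel" by (rule borel_measurable_continuous_onI[OF cont])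
  define f where "f n t = indicator {- real n..real n} t *\<^sub>R norm (F t)" for n :: nat and t
  have si: "set_integrable lborel {- real n..real n} (\<lambda>t. norm (F t))" for n
    by (intro borel_integrable_atLeastAtMost' continuous_intros continuous_on_subset[OF cont]) auto
  have fi: "integrable lborel (f n)" for n
    using si[of n] by (simp add: f_def[abs_def] set_integrable_def)
  have fB: "integral\<^sup>L lborel (f n) \<le> B" for n
    using B[of "real n"] set_borel_integral_eq_integral(2)[OF si[of n]]
    by (simp add: f_def[abs_def] set_lebesgue_integral_def)
  have mono: "mono (\<lambda>n. f n t)" for t by (auto simp: f_def mono_def indicator_def)
  have "incseq (\<lambda>n. integral\<^sup>L lborel (f n))"
    using mono by (intro monoI integral_mono fi) (auto dest: monoD)
  then obtain X where X: "(\<lambda>n. integral\<^sup>L lborel (f n)) \<longlonglongrightarrow> X" "\<And>n. integral\<^sup>L lborel (f n) \<le> X"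
    using incseq_convergent[of "\<lambda>n. integral\<^sup>L lborel (f n)" B] fB by blast
  have lim: "(\<lambda>n. f n t) \<longlonglongrightarrow> norm (F t)" for t
  proof (rule tendsto_eventually)
    obtain n0 where "\<bar>t\<bar> \<le> real n0" using real_arch_simple by blast
    then show "\<forall>\<^sub>F n in sequentially. f n t = norm (F t)"
      by (intro eventually_mono[OF eventually_ge_at_top[of n0]]) (auto simp: f_def indicator_def)
  qed
  have "integrable lborel (\<lambda>t. norm (F t))"
    by (rule integrable_monotone_convergence[OF fi _ _ X(1)]) (simp_all add: mono lim)
  then show "integrable lborel F" by (subst (asm) integrable_norm_iff) auto
  have "(LINT t|lborel. norm (F t)) = X"
    by (rule integral_monotone_convergence[OF fi _ _ X(1)]) (simp_all add: mono lim)
  then show "(LINT t|lborel. norm (F t)) \<le> B"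
    using LIMSEQ_le_const2[OF X(1), of B] fB by auto
qed

text \<open>Complex homogeneity lets a test function out, \<psi>(\<phi>(t) kern) = \<phi>(t) h(t),
  so that a phase in \<phi> can turn h into a nonnegative quantity.\<close>

locale Balg_cfunctional = Balg_functional \<psi> C for \<psi> :: "(complex \<Rightarrow> complex) \<Rightarrow> complex" and C +
  assumes psi_cscale: "f \<in> Balg \<Longrightarrow> \<psi> (\<lambda>z. c * f z) = c * \<psi> f"
begin

text \<open>Testing against $\bar h/(|h|+\varepsilon)$, where $h(t)=\psi(r_{a-it}^2)$, recovers the
$L^1$-norm of $h$ in the limit.\<close>

lemma integral_psi_kern_le:
  assumes a: "0 < a" and N: "0 \<le> N"
  shows "integral {-N..N} (\<lambda>t. cmod (\<psi> (\<lambda>z. kern t (z + of_real a)))) \<le> 5 * pi * C / a"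
proof (rule field_le_epsilon)
  fix \<epsilon>' :: real assume \<epsilon>': "0 < \<epsilon>'"
  \<comment> \<open>Over the interval the regularisation costs at most \<epsilon> * 2N, which stays
    below \<epsilon>'.\<close>
  define \<epsilon> where "\<epsilon> = \<epsilon>' / (2 * N + 1)"
  have e: "0 < \<epsilon>" using \<epsilon>' N by (simp add: \<epsilon>_def)
  define h where "h t = \<psi> (\<lambda>z. kern t (z + of_real a))" for t
  have ch: "continuous_on UNIV h" unfolding h_def by (rule continuous_on_psi_kern[OF a])
  define \<phi> where "\<phi> t = cnj (h t) / of_real (cmod (h t) + \<epsilon>)" for t
  have pos: "0 < cmod (h t) + \<epsilon>" for t using e by (simp add: add_nonneg_pos)
  have phi: "continuous_on UNIV \<phi>"
    unfolding \<phi>_def using pos by (intro continuous_intros ch) (auto simp del: of_real_add simp: less_imp_neq[THEN not_sym])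
  have phi1: "cmod (\<phi> t) \<le> 1" for t
    unfolding \<phi>_def norm_divide norm_of_real using pos[of t] e by simp
  define V where "V w = integral {-N..N} (\<lambda>t. \<phi> t * kern t w)" for w
  have holV: "V holomorphic_on RHP"
    unfolding V_def by (intro holomorphic_integral_kern continuous_on_subset[OF phi]) auto
  \<comment> \<open>Since |\<phi>| \<le> 1, the Poisson bound is uniform in \<phi> and N;
    \<open>Balg_decay\<close> then gives norm at most 5 pi/a.\<close>
  have bV: "cmod (V w) \<le> pi / Re w" if w: "0 < Re w" for w
  proof -
    have "cmod (V w) \<le> integral {-N..N} (\<lambda>t. cmod (kern t w))"
      unfolding V_def
    proof (rule integral_norm_bound_integral)
      show "(\<lambda>t. \<phi> t * kern t w) integrable_on {-N..N}"
        using w by (intro integrable_continuous_real continuous_intros continuous_on_kern continuous_on_subset[OF phi]) auto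
      show "(\<lambda>t. cmod (kern t w)) integrable_on {-N..N}"
        using w by (intro integrable_continuous_real continuous_intros continuous_on_kern) auto
      show "cmod (\<phi> t * kern t w) \<le> cmod (kern t w)" for t
        using phi1[of t] by (simp add: norm_mult mult_left_le_one_le)
    qed
    also have "\<dots> \<le> pi / Re w" using N by (intro integral_cmod_kern_le w) auto
    finally show ?thesis .
  qed
  have hi: "((\<lambda>t. \<psi> (\<lambda>z. \<phi> t * kern t (z + of_real a))) has_integral \<psi> (\<lambda>z. V (z + of_real a))) {-N..N}"
    unfolding V_def using N by (intro has_integral_psi_kern a phi) auto
  \<comment> \<open>The pairing \<phi>(t) h(t); it is real and differs from |h| by at most
    \<epsilon>, with no division by zero where h vanishes.\<close>
  define q where "q t = (cmod (h t))\<^sup>2 / (cmod (h t) + \<epsilon>)" for t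
  have "\<psi> (\<lambda>z. \<phi> t * kern t (z + of_real a)) = of_real (q t)" for t
    unfolding psi_cscale[OF Balg_kern[OF a]] h_def[symmetric] \<phi>_def q_def
  proof -
    have "(complex_of_real (cmod (h t)))\<^sup>2 = h t * cnj (h t)"
      by (metis complex_norm_square of_real_power)
    then show "cnj (h t) / of_real (cmod (h t) + \<epsilon>) * h t = of_real ((cmod (h t))\<^sup>2 / (cmod (h t) + \<epsilon>))"
      by (simp add: mult.commute)
  qed
  then have hq: "((\<lambda>t. complex_of_real (q t)) has_integral \<psi> (\<lambda>z. V (z + of_real a))) {-N..N}"
    using hi by simp
  have cq: "continuous_on UNIV q"
    unfolding q_def using pos by (intro continuous_intros ch) (auto simp: less_imp_neq[THEN not_sym])
  have qi: "q integrable_on {-N..N}"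
    by (intro integrable_continuous_real continuous_on_subset[OF cq]) auto
  have "complex_of_real (integral {-N..N} q) = \<psi> (\<lambda>z. V (z + of_real a))"
    using has_integral_unique[OF has_integral_of_real[OF integrable_integral[OF qi]] hq] by simp
  then have "\<bar>integral {-N..N} q\<bar> = cmod (\<psi> (\<lambda>z. V (z + of_real a)))"
    by (metis norm_of_real)
  also have "\<dots> \<le> C * (5 * pi / a)"
    by (rule order_trans[OF psi_bound[OF Balg_decay(1)[OF holV a bV]] mult_left_mono[OF Balg_decay(2)[OF holV a bV] C_nonneg]])
  finally have qle: "integral {-N..N} q \<le> 5 * pi * C / a" by (simp add: mult_ac)
  have "integral {-N..N} (\<lambda>t. cmod (h t)) \<le> integral {-N..N} (\<lambda>t. q t + \<epsilon>)"
  proof (rule integral_le)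
    show "(\<lambda>t. cmod (h t)) integrable_on {-N..N}"
      by (intro integrable_continuous_real continuous_intros continuous_on_subset[OF ch]) auto
    show "(\<lambda>t. q t + \<epsilon>) integrable_on {-N..N}" by (intro integrable_add qi) auto
    show "cmod (h t) \<le> q t + \<epsilon>" for t
    proof -
      have "cmod (h t) * (cmod (h t) + \<epsilon>) \<le> (cmod (h t))\<^sup>2 + \<epsilon> * (cmod (h t) + \<epsilon>)"
        using e by (simp add: power2_eq_square algebra_simps)
      then show ?thesis unfolding q_def using pos[of t] by (simp add: field_simps)
    qed
  qed
  also have "\<dots> = integral {-N..N} q + \<epsilon> * (2 * N)"
    using N by (subst integral_add[OF qi]) (auto simp: mult.commute)
  also have "\<epsilon> * (2 * N) \<le> \<epsilon>'"
    unfolding \<epsilon>_def using \<epsilon>' N by (simp add: field_simps)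
  finally show "integral {-N..N} (\<lambda>t. cmod (\<psi> (\<lambda>z. kern t (z + of_real a)))) \<le> 5 * pi * C / a + \<epsilon>'"
    unfolding h_def using qle by linarith
qed

lemma integrable_psi_kern:
  assumes a: "0 < a"
  shows "integrable lborel (\<lambda>t. \<psi> (\<lambda>z. kern t (z + of_real a)))"
    "(LINT t|lborel. cmod (\<psi> (\<lambda>z. kern t (z + of_real a)))) \<le> 5 * pi * C / a"
  using integrable_of_bounded_integrals[OF continuous_on_psi_kern[OF a] integral_psi_kern_le[OF a]] by auto

end

lemma Balg_cong:
  assumes f: "f \<in> Balg" and eq: "\<And>z. 0 < Re z \<Longrightarrow> g z = f z"
  shows "g \<in> Balg"
proof (rule Balg_boundI[where K = "Bnorm f" and m = "deriv_sup f"])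
  show "g holomorphic_on RHP"
    using holomorphic_cong[of RHP RHP g f] Balg_holomorphic[OF f] eq by (auto simp: RHP_def)
  fix z assume z: "0 < Re z"
  show "cmod (g z) \<le> Bnorm f" using cmod_le_Bnorm[OF f z] eq[OF z] by simp
  have "(g has_field_derivative deriv f z) (at z)"
    by (rule has_field_derivative_transform_within_open[OF DERIV_RHP[OF Balg_holomorphic[OF f] z] open_RHP])
       (use z eq in \<open>auto simp: RHP_def\<close>)
  then show "cmod (deriv g z) \<le> deriv_sup f (Re z)"
    using cmod_deriv_le_deriv_sup[OF f z order_refl] by (simp add: DERIV_imp_deriv)
qed (rule set_integrable_deriv_sup[OF f])

subsection \<open>Resolvents and regularisation\<close>

text \<open>Re z plays the role of the shift in \<open>Balg_decay\<close>, and Im z is left in the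
  function being shifted.\<close>

lemma
  assumes z: "0 < Re z"
  shows Balg_rz: "rz z \<in> Balg" and Bnorm_rz: "Bnorm (rz z) \<le> 5 / Re z"
proof -
  define g where "g w = inverse (w + Complex 0 (Im z))" for w
  have nz: "w + Complex 0 (Im z) \<noteq> 0" if "0 < Re w" for w
    using that by (auto simp: complex_eq_iff)
  have hol: "g holomorphic_on RHP"
    unfolding g_def using nz by (intro holomorphic_intros) (auto simp: RHP_def)
  have b: "cmod (g w) \<le> 1 / Re w" if "0 < Re w" for w
    unfolding g_def norm_inverse using that complex_Re_le_cmod[of "w + Complex 0 (Im z)"]
    by (simp flip: inverse_eq_divide add: le_imp_inverse_le)
  have eq: "(\<lambda>w. g (w + of_real (Re z))) = rz z"
  proof
    fix w
    have "w + of_real (Re z) + Complex 0 (Im z) = z + w" by (simp add: complex_eq_iff)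
    then show "g (w + of_real (Re z)) = rz z w" by (simp add: g_def rz_def)
  qed
  show "rz z \<in> Balg" "Bnorm (rz z) \<le> 5 / Re z"
    using Balg_decay[OF hol z b] unfolding eq by auto
qed

lemma kern_eq_rz: "kern t (z + of_real a) = rz (Complex a (- t)) z * rz (Complex a (- t)) z"
proof -
  have eq: "z + of_real a - Complex 0 t = Complex a (- t) + z" by (simp add: complex_eq_iff)
  show ?thesis unfolding kern_def rz_def eq by (simp add: power2_eq_square)
qed

text \<open>The regularising factor is chosen so that after the shift by $2c$ it becomes $(m r_m)^2$.\<close>

definition regularized_deriv :: "(complex \<Rightarrow> complex) \<Rightarrow> real \<Rightarrow> real \<Rightarrow> complex \<Rightarrow> complex" where
  "regularized_deriv f c m w = deriv f w * (of_real m * inverse (of_real (m - 2 * c) + w))\<^sup>2"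

context
  fixes f :: "complex \<Rightarrow> complex" and c m :: real
  assumes f: "f \<in> Balg" and c: "0 < c" and m: "2 * c < m"
begin

lemma regularizer_nonzero: "0 < Re w \<Longrightarrow> of_real (m - 2 * c) + w \<noteq> 0"
  using m by (auto simp: complex_eq_iff)

lemma holomorphic_regularized_deriv: "regularized_deriv f c m holomorphic_on RHP"
proof -
  have h: "(\<lambda>w. inverse (of_real (m - 2 * c) + w)) holomorphic_on RHP"
    using regularizer_nonzero by (intro holomorphic_intros) (auto simp: RHP_def)
  show ?thesis
    unfolding regularized_deriv_def
    by (intro holomorphic_on_mult holomorphic_on_power holomorphic_on_const h
        holomorphic_deriv_RHP[OF Balg_holomorphic[OF f]])
qed

text \<open>On Re w \<ge> c the denominator has real part at least m - c \<ge> m/2. The bound is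
  uniform in m, as dominated convergence in m requires.\<close>

lemma cmod_regularizer_le:
  assumes "c \<le> Re w"
  shows "cmod (of_real m * inverse (of_real (m - 2 * c) + w)) \<le> 2"
proof -
  have "m / 2 \<le> Re (of_real (m - 2 * c) + w)" using assms m by simp
  also have "\<dots> \<le> cmod (of_real (m - 2 * c) + w)" by (rule complex_Re_le_cmod)
  finally have "m / 2 \<le> cmod (of_real (m - 2 * c) + w)" .
  then show ?thesis
    unfolding norm_mult norm_inverse using m c by (simp add: divide_simps split: if_splits)
qed

lemma cmod_regularized_deriv_le:
  assumes "c \<le> Re w"
  shows "cmod (regularized_deriv f c m w) \<le> deriv_sup f c * 4"
proof -
  have "(cmod (of_real m * inverse (of_real (m - 2 * c) + w)))\<^sup>2 \<le> 2\<^sup>2"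
    by (intro power_mono cmod_regularizer_le assms) simp
  then show ?thesis
    unfolding regularized_deriv_def norm_mult[of "deriv f w"] norm_power
    using assms deriv_sup_nonneg[OF f c] by (intro mult_mono cmod_deriv_le_deriv_sup f c) auto
qed

text \<open>The constant grows like m^2, which is harmless: the limit over truncations is taken at
  fixed m, before m tends to infinity.\<close>

lemma cmod_regularized_deriv_decay:
  assumes t: "t \<noteq> 0"
  shows "cmod (regularized_deriv f c m (Complex c t)) \<le> (deriv_sup f c * m\<^sup>2) / t\<^sup>2"
proof -
  have "\<bar>t\<bar> \<le> cmod (of_real (m - 2 * c) + Complex c t)"
    using abs_Im_le_cmod[of "of_real (m - 2 * c) + Complex c t"] by simp
  then have "cmod (of_real m * inverse (of_real (m - 2 * c) + Complex c t)) \<le> m / \<bar>t\<bar>"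
    unfolding norm_mult norm_inverse norm_of_real divide_inverse using m c t
    by (intro mult_mono le_imp_inverse_le) auto
  then have "(cmod (of_real m * inverse (of_real (m - 2 * c) + Complex c t)))\<^sup>2 \<le> (m / \<bar>t\<bar>)\<^sup>2"
    by (rule power_mono) simp
  also have "\<dots> = m\<^sup>2 / t\<^sup>2" by (simp add: power_divide)
  finally have "cmod (regularized_deriv f c m (Complex c t)) \<le> deriv_sup f c * (m\<^sup>2 / t\<^sup>2)"
    unfolding regularized_deriv_def norm_mult[of "deriv f _"] norm_power
    using deriv_sup_nonneg[OF f c] by (intro mult_mono cmod_deriv_le_deriv_sup f c) auto
  then show ?thesis by simp
qed

text \<open>Written as a sum of products of algebra elements, to which multiplicativity of \<Phi>
  applies. The second term is (-2/m) (m r_m)^3 f', so it disappears as m grows.\<close>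

lemma deriv_regularized_deriv:
  assumes z: "0 < Re z"
  shows "deriv (regularized_deriv f c m) (z + of_real (2 * c)) =
     deriv (deriv f) (z + of_real (2 * c)) * (of_real (m\<^sup>2) * (rz (of_real m) z * rz (of_real m) z))
     + of_real (- 2 * m\<^sup>2) * (deriv f (z + of_real (2 * c)) * (rz (of_real m) z * (rz (of_real m) z * rz (of_real m) z)))"
proof -
  define w where "w = z + of_real (2 * c)"
  have w: "0 < Re w" using z c by (simp add: w_def)
  define r where "r = inverse (of_real (m - 2 * c) + w)"
  have rr: "rz (of_real m) z = r" unfolding r_def rz_def w_def by (simp add: algebra_simps)
  have d: "((\<lambda>w. inverse (of_real (m - 2 * c) + w)) has_field_derivative - (r * r)) (at w)"
    unfolding r_def using regularizer_nonzero[OF w]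
    by (auto intro!: derivative_eq_intros simp del: of_real_diff simp: field_simps)
  have q: "((\<lambda>w. (of_real m * inverse (of_real (m - 2 * c) + w))\<^sup>2) has_field_derivative
      2 * (of_real m * r) * (of_real m * (- (r * r)))) (at w)"
    using DERIV_power[OF DERIV_cmult[OF d, of "of_real m"], of 2] by (simp add: r_def mult_ac)
  have "(regularized_deriv f c m has_field_derivative
      deriv (deriv f) w * (of_real m * r)\<^sup>2 + 2 * (of_real m * r) * (of_real m * (- (r * r))) * deriv f w) (at w)"
    unfolding regularized_deriv_def[abs_def]
    using DERIV_mult[OF DERIV_RHP[OF holomorphic_deriv_RHP[OF Balg_holomorphic[OF f]] w] q]
    by (simp add: r_def)
  then have "deriv (regularized_deriv f c m) w =
      deriv (deriv f) w * (of_real m * r)\<^sup>2 + 2 * (of_real m * r) * (of_real m * (- (r * r))) * deriv f w"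
    by (rule DERIV_imp_deriv)
  then show ?thesis
    unfolding rr w_def[symmetric] by (simp add: power2_eq_square algebra_simps)
qed

lemma Balg_deriv2_shift: "(\<lambda>z. deriv (deriv f) (z + of_real (2 * c))) \<in> Balg"
proof -
  have "(\<lambda>z. deriv (\<lambda>z. deriv f (z + of_real c)) (z + of_real c)) \<in> Balg"
    using c by (intro Balg_deriv_shift f)
  then show ?thesis by (simp add: deriv_shift add.assoc)
qed

lemma Balg_deriv_regularized_deriv:
  "(\<lambda>z. deriv (regularized_deriv f c m) (z + of_real (2 * c))) \<in> Balg"
proof (rule Balg_cong[OF _ deriv_regularized_deriv])
  have r: "rz (of_real m) \<in> Balg" using m c by (intro Balg_rz) simp
  have f1: "(\<lambda>z. deriv f (z + of_real (2 * c))) \<in> Balg" using c by (intro Balg_deriv_shift f) auto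
  show "(\<lambda>z. deriv (deriv f) (z + of_real (2 * c)) * (of_real (m\<^sup>2) * (rz (of_real m) z * rz (of_real m) z))
     + of_real (- 2 * m\<^sup>2) * (deriv f (z + of_real (2 * c)) * (rz (of_real m) z * (rz (of_real m) z * rz (of_real m) z)))) \<in> Balg"
    by (intro Balg_add Balg_mult Balg_cmult r f1 Balg_deriv2_shift)
qed

end

subsection \<open>The calculus\<close>

locale B_calc =
  fixes D :: "'a::cbanach set" and A :: "'a \<Rightarrow> 'a" and \<Phi> :: "(complex \<Rightarrow> complex) \<Rightarrow> 'a \<Rightarrow> 'a"
  assumes calc: "B_calculus D A \<Phi>"
begin

lemma Phi_bounded_linear: "f \<in> Balg \<Longrightarrow> bounded_linear (\<Phi> f)"
  using calc by (auto simp: B_calculus_def bounded_clinear_op_def)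

lemma Phi_scaleR_arg: "f \<in> Balg \<Longrightarrow> \<Phi> f (r *\<^sub>R x) = r *\<^sub>R \<Phi> f x"
  by (simp add: bounded_linear.linear[OF Phi_bounded_linear] linear_scale)

lemma Phi_add: "f \<in> Balg \<Longrightarrow> g \<in> Balg \<Longrightarrow> \<Phi> (\<lambda>z. f z + g z) x = \<Phi> f x + \<Phi> g x"
  using calc by (simp add: B_calculus_def)

lemma Phi_cmult: "f \<in> Balg \<Longrightarrow> \<Phi> (\<lambda>z. c * f z) x = c *\<^sub>C \<Phi> f x"
  using calc by (simp add: B_calculus_def)

lemma Phi_of_real_mult: "f \<in> Balg \<Longrightarrow> \<Phi> (\<lambda>z. of_real r * f z) x = r *\<^sub>R \<Phi> f x"
  by (simp add: Phi_cmult scaleC_of_real)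

lemma Phi_mult: "f \<in> Balg \<Longrightarrow> g \<in> Balg \<Longrightarrow> \<Phi> (\<lambda>z. f z * g z) x = \<Phi> f (\<Phi> g x)"
  using calc by (simp add: B_calculus_def)

lemma Phi_rz: "0 < Re z \<Longrightarrow> \<Phi> (rz z) = resolv D A z"
  using calc by (simp add: B_calculus_def)

lemma Phi_kern:
  assumes a: "0 < a"
  shows "\<Phi> (\<lambda>z. kern t (z + of_real a)) x = (resolv D A (Complex a (- t)) \<circ> resolv D A (Complex a (- t))) x"
proof -
  have "\<Phi> (\<lambda>z. kern t (z + of_real a)) x = \<Phi> (\<lambda>z. rz (Complex a (- t)) z * rz (Complex a (- t)) z) x"
    by (simp only: kern_eq_rz)
  then show ?thesis using a by (simp add: Phi_mult Balg_rz Phi_rz)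
qed

text \<open>The spectrum condition gives a resolvent; applying any other one to z R x + A R x shows
  uniqueness, which justifies the description in \<open>resolv\<close>.\<close>

lemma is_resolvent_resolv:
  assumes z: "0 < Re z"
  shows "is_resolvent D A z (resolv D A z)"
proof -
  have "- z \<notin> spectrum_op D A" using calc z by (force simp: B_calculus_def)
  then obtain R where R: "is_resolvent D A z R" by (auto simp: spectrum_op_def)
  have "S = R" if S: "is_resolvent D A z S" for S
  proof
    fix x
    have eq: "z *\<^sub>C R x + A (R x) = x" and "R x \<in> D" using R by (auto simp: is_resolvent_def)
    then have "S (z *\<^sub>C R x + A (R x)) = R x" using S unfolding is_resolvent_def by blast
    then show "S x = R x" unfolding eq .
  qed
  then have "resolv D A z = R" unfolding resolv_def using R by blast
  then show ?thesis using R by simp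
qed

lemma Phi_norm_bound: "\<exists>C\<ge>0. \<forall>f\<in>Balg. \<forall>x. norm (\<Phi> f x) \<le> C * Bnorm f * norm x"
proof -
  obtain C where C: "\<And>f. f \<in> Balg \<Longrightarrow> onorm (\<Phi> f) \<le> C * Bnorm f"
    using calc unfolding B_calculus_def by blast
  \<comment> \<open>The constant in \<open>B_calculus\<close> carries no sign;
    \<open>max C 0\<close> makes it usable in monotonicity arguments.\<close>
  have "norm (\<Phi> f x) \<le> max C 0 * Bnorm f * norm x" if f: "f \<in> Balg" for f x
  proof -
    have "norm (\<Phi> f x) \<le> onorm (\<Phi> f) * norm x" by (rule onorm[OF Phi_bounded_linear[OF f]])
    also have "\<dots> \<le> max C 0 * Bnorm f * norm x"
      using C[OF f] mult_right_mono[of C "max C 0" "Bnorm f"] Bnorm_nonneg[OF f]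
      by (intro mult_right_mono) auto
    finally show ?thesis .
  qed
  then show ?thesis by (intro exI[of _ "max C 0"]) simp
qed

definition bound :: real where
  "bound = (SOME C. 0 \<le> C \<and> (\<forall>f\<in>Balg. \<forall>x. norm (\<Phi> f x) \<le> C * Bnorm f * norm x))"

lemma bound_nonneg: "0 \<le> bound" and norm_Phi_le: "f \<in> Balg \<Longrightarrow> norm (\<Phi> f x) \<le> bound * Bnorm f * norm x"
  using someI_ex[OF Phi_norm_bound[unfolded Bex_def]] unfolding bound_def by auto

sublocale vec: Balg_functional "\<lambda>f. \<Phi> f x" "bound * norm x" for x
proof
  show "norm (\<Phi> f x) \<le> bound * norm x * Bnorm f" if "f \<in> Balg" for f
    using norm_Phi_le[OF that, of x] by (simp add: mult_ac)
qed (simp_all only: Phi_add Phi_of_real_mult bound_nonneg norm_ge_zero mult_nonneg_nonneg)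

lemma norm_Phi_rz_le:
  assumes "0 < m"
  shows "norm (\<Phi> (rz (of_real m)) x) \<le> 5 * bound / m * norm x"
proof -
  have "norm (\<Phi> (rz (of_real m)) x) \<le> bound * Bnorm (rz (of_real m)) * norm x"
    using assms by (intro norm_Phi_le Balg_rz) simp
  also have "\<dots> \<le> bound * (5 / m) * norm x"
    using Bnorm_rz[of "of_real m"] assms bound_nonneg by (intro mult_right_mono mult_left_mono) auto
  finally show ?thesis by (simp add: mult_ac)
qed

text \<open>The operators m (m + A)^{-1} are bounded by \<open>5 * bound\<close> uniformly in m. For
  y in D, m (m + A)^{-1} y - y = -(m + A)^{-1} A y = O(1/m), and density of D gives all x.\<close>

lemma resolvent_tendsto_identity: "((\<lambda>m. m *\<^sub>R \<Phi> (rz (of_real m)) x) \<longlongrightarrow> x) at_top"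
proof (rule tendstoI)
  fix e :: real assume e: "0 < e"
  define K where "K = 5 * bound + 1"
  have K: "0 < K" using bound_nonneg by (simp add: K_def)
  have "x \<in> closure D" using calc by (simp add: B_calculus_def)
  then obtain y where y: "y \<in> D" "dist y x < e / (2 * K)"
    using e K unfolding closure_approachable by (metis divide_pos_pos mult_pos_pos zero_less_numeral)
  have est: "norm (m *\<^sub>R \<Phi> (rz (of_real m)) x - x) \<le> K * norm (x - y) + 5 * bound * norm (A y) / m" if m: "0 < m" for m
  proof -
    let ?R = "\<Phi> (rz (of_real m))"
    have lin: "linear ?R" using m by (intro bounded_linear.linear Phi_bounded_linear Balg_rz) simp
    have "is_resolvent D A (of_real m) ?R"
      using is_resolvent_resolv[of "of_real m"] Phi_rz[of "of_real m"] m by simp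
    then have "?R (m *\<^sub>R y + A y) = y" using y(1) by (simp add: is_resolvent_def scaleC_of_real)
    then have Ry: "m *\<^sub>R ?R y - y = - ?R (A y)"
      by (simp add: linear_add[OF lin] linear_scale[OF lin] algebra_simps)
    have "m *\<^sub>R ?R x - x = m *\<^sub>R ?R (x - y) + (m *\<^sub>R ?R y - y) - (x - y)"
      by (simp add: linear_diff[OF lin] algebra_simps)
    also have "\<dots> = m *\<^sub>R ?R (x - y) + - ?R (A y) - (x - y)" by (simp only: Ry)
    also have "norm \<dots> \<le> norm (m *\<^sub>R ?R (x - y)) + norm (?R (A y)) + norm (x - y)"
    proof -
      have "norm (a + - b - c) \<le> norm a + norm b + norm c" for a b c :: 'a
        using norm_triangle_ineq4[of "a - b" c] norm_triangle_ineq4[of a b] by simp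
      then show ?thesis .
    qed
    also have "\<dots> \<le> 5 * bound * norm (x - y) + 5 * bound * norm (A y) / m + norm (x - y)"
    proof (intro add_mono order_refl)
      have "m * norm (?R (x - y)) \<le> m * (5 * bound / m * norm (x - y))"
        using m by (intro mult_left_mono norm_Phi_rz_le) auto
      then show "norm (m *\<^sub>R ?R (x - y)) \<le> 5 * bound * norm (x - y)" using m by simp
      show "norm (?R (A y)) \<le> 5 * bound * norm (A y) / m"
        using norm_Phi_rz_le[OF m, of "A y"] by simp
    qed
    finally show ?thesis by (simp add: K_def algebra_simps)
  qed
  have "((\<lambda>m. 5 * bound * norm (A y) / m) \<longlongrightarrow> 0) at_top"
    by (intro tendsto_divide_0[OF tendsto_const] filterlim_at_top_imp_at_infinity filterlim_ident)
  from order_tendstoD(2)[OF this, of "e/2"] e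
  have "\<forall>\<^sub>F m in at_top. 5 * bound * norm (A y) / m < e / 2 \<and> 0 < m"
    by (intro eventually_conj eventually_gt_at_top) simp
  then show "\<forall>\<^sub>F m in at_top. dist (m *\<^sub>R \<Phi> (rz (of_real m)) x) x < e"
  proof (rule eventually_mono)
    fix m assume m: "5 * bound * norm (A y) / m < e / 2 \<and> 0 < m"
    have "K * norm (x - y) < e / 2"
      using y(2) K by (simp add: dist_norm norm_minus_commute field_simps)
    then show "dist (m *\<^sub>R \<Phi> (rz (of_real m)) x) x < e"
      using est[of m] m unfolding dist_norm by linarith
  qed
qed

text \<open>Multiplicativity alone shows that \<Phi>(1) fixes the vectors m (m + A)^{-1} x; these
  converge to x.\<close>

lemma Phi_one: "\<Phi> (\<lambda>_. 1) x = x"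
proof -
  have "\<Phi> (\<lambda>_. 1) (\<Phi> (rz (of_real m)) x) = \<Phi> (rz (of_real m)) x" if "0 < m" for m
    using Phi_mult[OF Balg_const Balg_rz[of "of_real m"], of 1 x] that by simp
  then have "\<Phi> (\<lambda>_. 1) (m *\<^sub>R \<Phi> (rz (of_real m)) x) = m *\<^sub>R \<Phi> (rz (of_real m)) x" if "0 < m" for m
    using that by (simp add: Phi_scaleR_arg Balg_const)
  then have "\<forall>\<^sub>F m in at_top. m *\<^sub>R \<Phi> (rz (of_real m)) x = \<Phi> (\<lambda>_. 1) (m *\<^sub>R \<Phi> (rz (of_real m)) x)"
    by (intro eventually_mono[OF eventually_gt_at_top[of 0]]) simp
  from Lim_transform_eventually[OF resolvent_tendsto_identity this]
  have "((\<lambda>m. \<Phi> (\<lambda>_. 1) (m *\<^sub>R \<Phi> (rz (of_real m)) x)) \<longlongrightarrow> x) at_top" .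
  moreover have "((\<lambda>m. \<Phi> (\<lambda>_. 1) (m *\<^sub>R \<Phi> (rz (of_real m)) x)) \<longlongrightarrow> \<Phi> (\<lambda>_. 1) x) at_top"
    by (intro bounded_linear.tendsto[OF Phi_bounded_linear] Balg_const resolvent_tendsto_identity)
  ultimately show ?thesis using tendsto_unique[OF trivial_limit_at_top_linorder] by blast
qed

lemma Phi_const: "\<Phi> (\<lambda>_. c) x = c *\<^sub>C x"
  using Phi_cmult[OF Balg_const, of c 1 x] by (simp add: Phi_one)

text \<open>Multiplicativity moves the regularising factors onto x, where strong convergence of
  \<open>T m\<close> to the identity suffices; f'' and f' stay outside as fixed bounded
  operators.\<close>

lemma Phi_regularized_deriv_tendsto:
  assumes f: "f \<in> Balg" and c: "0 < c"
  shows "((\<lambda>m. \<Phi> (\<lambda>z. deriv (regularized_deriv f c m) (z + of_real (2 * c))) x) \<longlongrightarrow>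
           \<Phi> (\<lambda>z. deriv (deriv f) (z + of_real (2 * c))) x) at_top"
proof -
  define f1 where "f1 = (\<lambda>z. deriv f (z + of_real (2 * c)))"
  define f2 where "f2 = (\<lambda>z. deriv (deriv f) (z + of_real (2 * c)))"
  have f1: "f1 \<in> Balg" unfolding f1_def using c by (intro Balg_deriv_shift f) auto
  have f2: "f2 \<in> Balg" unfolding f2_def by (rule Balg_deriv2_shift[OF f c, of "2 * c + 1"]) simp
  define T where "T m y = m *\<^sub>R \<Phi> (rz (of_real m)) y" for m y
  have T: "((\<lambda>m. T m x) \<longlongrightarrow> x) at_top" unfolding T_def by (rule resolvent_tendsto_identity)
  have Tle: "norm (T m y) \<le> 5 * bound * norm y" if "0 < m" for m y
    using mult_left_mono[OF norm_Phi_rz_le[OF that, of y], of m] that by (simp add: T_def)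
  have Tdiff: "T m (y - y') = T m y - T m y'" if "0 < m" for m y y'
    using that unfolding T_def
    by (simp add: bounded_linear.linear[OF Phi_bounded_linear] linear_diff Balg_rz scaleR_diff_right)
  \<comment> \<open>Strong limits multiply here because \<open>T m\<close> is bounded uniformly in
    m.\<close>
  have TT: "((\<lambda>m. T m (T m x)) \<longlongrightarrow> x) at_top"
  proof -
    have "((\<lambda>m. T m (T m x) - T m x) \<longlongrightarrow> 0) at_top"
    proof (rule Lim_null_comparison)
      show "\<forall>\<^sub>F m in at_top. norm (T m (T m x) - T m x) \<le> 5 * bound * norm (T m x - x)"
        by (rule eventually_mono[OF eventually_gt_at_top[of 0]]) (use Tle in \<open>simp add: Tdiff[symmetric]\<close>)
      show "((\<lambda>m. 5 * bound * norm (T m x - x)) \<longlongrightarrow> 0) at_top"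
        by (intro tendsto_mult_right_zero tendsto_norm_zero) (use T in \<open>simp add: LIM_zero\<close>)
    qed
    from tendsto_add[OF this T] show ?thesis by simp
  qed
  have TTT: "((\<lambda>m. (- 2 / m) *\<^sub>R T m (T m (T m x))) \<longlongrightarrow> 0) at_top"
  proof (rule Lim_null_comparison)
    show "\<forall>\<^sub>F m in at_top. norm ((- 2 / m) *\<^sub>R T m (T m (T m x))) \<le> 2 * ((5 * bound) * ((5 * bound) * ((5 * bound) * norm x))) / m"
    proof (rule eventually_mono[OF eventually_gt_at_top[of 0]])
      fix m :: real assume m: "0 < m"
      have T3: "norm (T m (T m (T m x))) \<le> (5 * bound) * ((5 * bound) * ((5 * bound) * norm x))"
        using bound_nonneg
        by (intro order_trans[OF Tle[OF m]] mult_left_mono) auto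
      show "norm ((- 2 / m) *\<^sub>R T m (T m (T m x))) \<le> 2 * ((5 * bound) * ((5 * bound) * ((5 * bound) * norm x))) / m"
        using m divide_right_mono[OF mult_left_mono[OF T3, of 2], of m] by simp
    qed
    show "((\<lambda>m. 2 * ((5 * bound) * ((5 * bound) * ((5 * bound) * norm x))) / m) \<longlongrightarrow> 0) at_top"
      by (intro tendsto_divide_0[OF tendsto_const] filterlim_at_top_imp_at_infinity filterlim_ident)
  qed
  have "((\<lambda>m. \<Phi> f2 (T m (T m x)) + \<Phi> f1 ((- 2 / m) *\<^sub>R T m (T m (T m x)))) \<longlongrightarrow> \<Phi> f2 x + \<Phi> f1 0) at_top"
    by (intro tendsto_add bounded_linear.tendsto[OF Phi_bounded_linear] f1 f2 TT TTT)
  then have lim: "((\<lambda>m. \<Phi> f2 (T m (T m x)) + \<Phi> f1 ((- 2 / m) *\<^sub>R T m (T m (T m x)))) \<longlongrightarrow> \<Phi> f2 x) at_top"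
    by (simp add: bounded_linear.linear[OF Phi_bounded_linear[OF f1]] linear_0)
  show ?thesis unfolding f2_def[symmetric]
  proof (rule Lim_transform_eventually[OF lim], rule eventually_mono[OF eventually_gt_at_top[of "2 * c"]])
    fix m assume m: "2 * c < m"
    define r where "r = rz (of_real m)"
    have r: "r \<in> Balg" unfolding r_def using m c by (intro Balg_rz) simp
    have m0: "0 < m" using m c by simp
    define H1 where "H1 = (\<lambda>z. f2 z * (of_real (m\<^sup>2) * (r z * r z)))"
    define H2 where "H2 = (\<lambda>z. of_real (- 2 * m\<^sup>2) * (f1 z * (r z * (r z * r z))))"
    have B1: "H1 \<in> Balg" unfolding H1_def by (intro Balg_mult Balg_cmult f2 r)
    have B2: "H2 \<in> Balg" unfolding H2_def by (intro Balg_mult Balg_cmult f1 r)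
    \<comment> \<open>The formula for the derivative holds on the half-plane only, hence the passage
      through \<open>psi_cong\<close>.\<close>
    have "\<Phi> (\<lambda>z. deriv (regularized_deriv f c m) (z + of_real (2 * c))) x = \<Phi> (\<lambda>z. H1 z + H2 z) x"
      by (rule vec.psi_cong[OF Balg_deriv_regularized_deriv[OF f c m] Balg_add[OF B1 B2]])
         (simp only: deriv_regularized_deriv[OF f c m] H1_def H2_def f1_def f2_def r_def)
    also have "\<dots> = \<Phi> H1 x + \<Phi> H2 x" by (rule Phi_add[OF B1 B2])
    also have "\<Phi> H1 x = \<Phi> f2 (T m (T m x))"
      unfolding H1_def T_def r_def[symmetric]
      using f2 r by (simp add: Phi_mult Phi_of_real_mult Balg_mult Balg_cmult Phi_scaleR_arg power2_eq_square
          del: of_real_power of_real_mult)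
    also have "\<Phi> H2 x = \<Phi> f1 ((- 2 / m) *\<^sub>R T m (T m (T m x)))"
      unfolding H2_def T_def r_def[symmetric]
      using f1 r m0 by (simp add: Phi_mult Phi_of_real_mult Balg_mult Balg_cmult Phi_scaleR_arg power2_eq_square
          linear_neg[OF bounded_linear.linear[OF Phi_bounded_linear[OF f1]]]
          del: of_real_power of_real_mult of_real_minus)
    finally show "\<Phi> f2 (T m (T m x)) + \<Phi> f1 ((- 2 / m) *\<^sub>R T m (T m (T m x))) =
        \<Phi> (\<lambda>z. deriv (regularized_deriv f c m) (z + of_real (2 * c))) x" ..
  qed
qed

end

section \<open>The integral representation, uniqueness and the formula\<close>

lemma continuous_on_Complex_line:
  assumes "g holomorphic_on RHP" "0 < c"
  shows "continuous_on UNIV (\<lambda>t. g (Complex c t))"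
  by (rule continuous_on_compose2[OF holomorphic_on_imp_continuous_on[OF assms(1)]])
     (use assms(2) in \<open>auto simp: Complex_eq RHP_def intro!: continuous_intros\<close>)

context Balg_functional
begin

text \<open>\<open>F\<close> is s p'(s) - p(s) at s = 2 \<alpha>, the primitive of s p''(s) obtained
  by integration by parts; the chain rule supplies the 4 \<alpha>. The boundary terms s p'(s) vanish
  at both ends.\<close>

lemma representation_primitive:
  assumes f: "f \<in> Balg"
  defines "F \<equiv> \<lambda>\<alpha>. (2 * \<alpha>) *\<^sub>R \<psi> (\<lambda>z. deriv f (z + of_real (2 * \<alpha>))) - \<psi> (\<lambda>z. f (z + of_real (2 * \<alpha>)))"
  shows "\<And>\<alpha>. 0 < \<alpha> \<Longrightarrow> (F has_vector_derivative (4 * \<alpha>) *\<^sub>R \<psi> (\<lambda>z. deriv (deriv f) (z + of_real (2 * \<alpha>)))) (at \<alpha>)"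
    "\<And>\<alpha>. 0 < \<alpha> \<Longrightarrow> isCont (\<lambda>\<alpha>. (4 * \<alpha>) *\<^sub>R \<psi> (\<lambda>z. deriv (deriv f) (z + of_real (2 * \<alpha>)))) \<alpha>"
    "(F \<longlongrightarrow> - \<psi> f) (at_right 0)"
    "(F \<longlongrightarrow> - \<psi> (\<lambda>_. f_infty f)) at_top"
proof -
  define p where "p s = \<psi> (\<lambda>z. f (z + of_real s))" for s
  define p1 where "p1 s = \<psi> (\<lambda>z. deriv f (z + of_real s))" for s
  define p2 where "p2 s = \<psi> (\<lambda>z. deriv (deriv f) (z + of_real s))" for s
  have Ff: "F = (\<lambda>\<alpha>. (2 * \<alpha>) *\<^sub>R p1 (2 * \<alpha>) - p (2 * \<alpha>))"
    unfolding F_def p_def p1_def ..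
  have s0: "(\<lambda>z. f (z + of_real s)) \<in> Balg" if "0 < s" for s using that by (intro Balg_shift f) auto
  have s1: "(\<lambda>z. deriv f (z + of_real s)) \<in> Balg" if "0 < s" for s by (rule has_vector_derivative_shift(1)[where g = f, OF s0 that])
  have s2: "(\<lambda>z. deriv (deriv f) (z + of_real s)) \<in> Balg" if "0 < s" for s by (rule has_vector_derivative_shift(1)[where g = "deriv f", OF s1 that])
  have d0: "(p has_vector_derivative p1 s) (at s)" if "0 < s" for s
    unfolding p_def p1_def by (rule has_vector_derivative_shift(2)[where g = f, OF s0 that])
  have d1: "(p1 has_vector_derivative p2 s) (at s)" if "0 < s" for s
    unfolding p1_def p2_def by (rule has_vector_derivative_shift(2)[where g = "deriv f", OF s1 that])
  have c2: "isCont p2 s" if "0 < s" for s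
    using has_vector_derivative_shift(2)[where g = "deriv (deriv f)", OF s2 that] unfolding p2_def by (rule has_vector_derivative_continuous)
  define G where "G s = s *\<^sub>R p1 s - p s" for s
  have FG: "F = G \<circ> (\<lambda>\<alpha>. 2 * \<alpha>)" unfolding Ff G_def by (simp add: o_def)
  have G: "(G has_vector_derivative s *\<^sub>R p2 s) (at s)" if s: "0 < s" for s
  proof -
    have "(G has_vector_derivative (s *\<^sub>R p2 s + 1 *\<^sub>R p1 s) - p1 s) (at s)"
      unfolding G_def by (intro has_vector_derivative_diff has_vector_derivative_scaleR d0 d1 s DERIV_ident)
    then show ?thesis by simp
  qed
  show "(F has_vector_derivative (4 * \<alpha>) *\<^sub>R \<psi> (\<lambda>z. deriv (deriv f) (z + of_real (2 * \<alpha>)))) (at \<alpha>)"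
    if a: "0 < \<alpha>" for \<alpha>
  proof -
    have "(G \<circ> (\<lambda>\<alpha>. 2 * \<alpha>) has_vector_derivative 2 *\<^sub>R ((2 * \<alpha>) *\<^sub>R p2 (2 * \<alpha>))) (at \<alpha>)"
      using a by (intro vector_diff_chain_at G) (auto intro!: derivative_eq_intros)
    then show ?thesis by (simp add: FG p2_def)
  qed
  show "isCont (\<lambda>\<alpha>. (4 * \<alpha>) *\<^sub>R \<psi> (\<lambda>z. deriv (deriv f) (z + of_real (2 * \<alpha>)))) \<alpha>" if a: "0 < \<alpha>" for \<alpha>
    unfolding p2_def[symmetric] using a
    by (intro continuous_intros isCont_o2[OF _ c2]) auto
  have "(G \<longlongrightarrow> 0 - \<psi> f) (at_right 0)"
    unfolding G_def p_def p1_def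
    by (intro tendsto_diff tendsto_psi_deriv_shift_at_0 tendsto_psi_shift_at_0 f)
  moreover have "filterlim (\<lambda>\<alpha>::real. 2 * \<alpha>) (at_right 0) (at_right 0)"
    by (auto simp: filterlim_at eventually_at_filter intro!: tendsto_eq_intros)
  ultimately show "(F \<longlongrightarrow> - \<psi> f) (at_right 0)"
    unfolding FG o_def by (simp add: filterlim_compose)
  have "(G \<longlongrightarrow> 0 - \<psi> (\<lambda>_. f_infty f)) at_top"
    unfolding G_def p_def p1_def
    by (intro tendsto_diff tendsto_psi_deriv_shift_at_top tendsto_psi_shift_at_top f)
  moreover have "filterlim (\<lambda>\<alpha>::real. 2 * \<alpha>) at_top at_top"
    by (rule filterlim_tendsto_pos_mult_at_top[OF tendsto_const _ filterlim_ident]) simp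
  ultimately show "(F \<longlongrightarrow> - \<psi> (\<lambda>_. f_infty f)) at_top"
    unfolding FG o_def by (simp add: filterlim_compose)
qed

end

text \<open>For the difference \<Delta> of the two calculi at x the second derivative p'' is zero,
  so the primitive of s p''(s) is constant on (0, \<infinity>). Its two end values are -\<Delta>(f)
  and -\<Delta>(f(\<infinity>)), and both calculi agree on constants.\<close>

lemma B_calculus_unique:
  fixes D :: "'a::cbanach set"
  assumes "B_calculus D A \<Phi>" "B_calculus D A \<Psi>" and f: "f \<in> Balg"
  shows "\<Psi> f = \<Phi> f"
proof
  fix x
  interpret P: B_calc D A \<Phi> by standard fact
  interpret Q: B_calc D A \<Psi> by standard fact
  define \<Delta> where "\<Delta> g = \<Phi> g x - \<Psi> g x" for g
  interpret Balg_functional \<Delta> "(P.bound + Q.bound) * norm x"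
  proof
    fix g h :: "complex \<Rightarrow> complex" and c :: real
    assume g: "g \<in> Balg"
    show "\<Delta> (\<lambda>z. of_real c * g z) = c *\<^sub>R \<Delta> g"
      unfolding \<Delta>_def P.Phi_of_real_mult[OF g] Q.Phi_of_real_mult[OF g] by (simp add: scaleR_diff_right)
    have "norm (\<Delta> g) \<le> norm (\<Phi> g x) + norm (\<Psi> g x)" unfolding \<Delta>_def by (rule norm_triangle_ineq4)
    then show "norm (\<Delta> g) \<le> (P.bound + Q.bound) * norm x * Bnorm g"
      using P.norm_Phi_le[OF g, of x] Q.norm_Phi_le[OF g, of x] by (simp add: algebra_simps)
    assume h: "h \<in> Balg"
    show "\<Delta> (\<lambda>z. g z + h z) = \<Delta> g + \<Delta> h"
      unfolding \<Delta>_def P.Phi_add[OF g h] Q.Phi_add[OF g h] by simp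
  next
    show "0 \<le> (P.bound + Q.bound) * norm x" using P.bound_nonneg Q.bound_nonneg by simp
  qed
  \<comment> \<open>Squared resolvents depend only on A. The complex factor stays inside the
    argument, where the values of the regularised derivative will appear.\<close>
  have kern0: "\<Delta> (\<lambda>z. a * kern t (z + of_real c)) = 0" if "0 < c" for a t c
    unfolding \<Delta>_def P.Phi_cmult[OF Balg_kern[OF that]] Q.Phi_cmult[OF Balg_kern[OF that]]
      P.Phi_kern[OF that] Q.Phi_kern[OF that] by simp
  have zero: "\<Delta> (\<lambda>z. deriv (deriv f) (z + of_real (2 * c))) = 0" if c: "0 < c" for c
  proof -
    have reg: "\<Delta> (\<lambda>z. deriv (regularized_deriv f c m) (z + of_real (2 * c))) = 0" if m: "2 * c < m" for m
    proof -
      let ?g = "regularized_deriv f c m"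
      have hol: "?g holomorphic_on RHP" by (rule holomorphic_regularized_deriv[OF f c m])
      have "\<Delta> (\<lambda>z. integral {-N..N} (\<lambda>t. ?g (Complex c t) * kern t (z + of_real c))) = 0" if "0 \<le> N" for N
      proof -
        have "((\<lambda>t. \<Delta> (\<lambda>z. ?g (Complex c t) * kern t (z + of_real c))) has_integral
            \<Delta> (\<lambda>z. integral {-N..N} (\<lambda>t. ?g (Complex c t) * kern t (z + of_real c)))) {-N..N}"
          using that by (intro has_integral_psi_kern c continuous_on_Complex_line hol) auto
        then have "((\<lambda>t. 0) has_integral
            \<Delta> (\<lambda>z. integral {-N..N} (\<lambda>t. ?g (Complex c t) * kern t (z + of_real c)))) {-N..N}"
          unfolding kern0[OF c] .
        then show ?thesis using has_integral_unique[OF has_integral_0] by metis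
      qed
      then have "\<forall>\<^sub>F N in at_top. \<Delta> (\<lambda>z. integral {-N..N} (\<lambda>t. ?g (Complex c t) * kern t (z + of_real c))) = 0"
        by (intro eventually_mono[OF eventually_ge_at_top[of 0]]) simp
      from tendsto_unique[OF trivial_limit_at_top_linorder
          tendsto_psi_integral_kern[OF hol c cmod_regularized_deriv_le[OF f c m]
            cmod_regularized_deriv_decay[OF f c m] Balg_deriv_regularized_deriv[OF f c m]] tendsto_eventually[OF this]]
      show ?thesis by simp
    qed
    have "((\<lambda>m. \<Delta> (\<lambda>z. deriv (regularized_deriv f c m) (z + of_real (2 * c)))) \<longlongrightarrow>
        \<Delta> (\<lambda>z. deriv (deriv f) (z + of_real (2 * c)))) at_top"
      unfolding \<Delta>_def by (intro tendsto_diff P.Phi_regularized_deriv_tendsto Q.Phi_regularized_deriv_tendsto f c)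
    moreover have "((\<lambda>m. \<Delta> (\<lambda>z. deriv (regularized_deriv f c m) (z + of_real (2 * c)))) \<longlongrightarrow> 0) at_top"
      by (rule tendsto_eventually[OF eventually_mono[OF eventually_gt_at_top[of "2 * c"] reg]])
    ultimately show ?thesis by (rule tendsto_unique[OF trivial_limit_at_top_linorder])
  qed
  define F where "F = (\<lambda>\<alpha>. (2 * \<alpha>) *\<^sub>R \<Delta> (\<lambda>z. deriv f (z + of_real (2 * \<alpha>))) - \<Delta> (\<lambda>z. f (z + of_real (2 * \<alpha>))))"
  note rep = representation_primitive[OF f, folded F_def]
  have "(F has_derivative (\<lambda>_. 0)) (at \<alpha> within {0<..})" if "\<alpha> \<in> {0<..}" for \<alpha>
    using rep(1)[of \<alpha>] zero[of \<alpha>] that by (auto simp: has_vector_derivative_def intro: has_derivative_at_withinI)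
  then obtain K where K: "\<And>\<alpha>. \<alpha> \<in> {0<..} \<Longrightarrow> F \<alpha> = K"
    using has_derivative_zero_constant[of "{0<..}" F] by (metis convex_real_interval(3))
  have "(F \<longlongrightarrow> K) (at_right 0)"
    by (rule tendsto_eventually) (auto simp: eventually_at_filter K)
  then have 1: "- \<Delta> f = K" using tendsto_unique[OF trivial_limit_at_right_real rep(3)] by simp
  have "(F \<longlongrightarrow> K) at_top"
    by (rule tendsto_eventually[OF eventually_mono[OF eventually_gt_at_top[of 0]]]) (simp add: K)
  then have "- \<Delta> (\<lambda>_. f_infty f) = K" using tendsto_unique[OF trivial_limit_at_top_linorder rep(4)] by simp
  moreover have "\<Delta> (\<lambda>_. f_infty f) = 0" unfolding \<Delta>_def P.Phi_const Q.Phi_const by simp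
  ultimately have "\<Delta> f = 0" using 1 by simp
  then show "\<Psi> f x = \<Phi> f x" by (simp add: \<Delta>_def)
qed

lemma B_calculus_formula:
  fixes D :: "'a::cbanach set"
  assumes "B_calculus D A \<Phi>" and f: "f \<in> Balg" and xs: "dual_elem xs"
  shows "xs (\<Phi> f x) = f_infty f * xs x
           - (2 / pi) * (LINT \<alpha>:{0<..}|lborel. of_real \<alpha> *
               (LINT \<beta>|lborel. xs ((resolv D A (Complex \<alpha> (- \<beta>)) \<circ> resolv D A (Complex \<alpha> (- \<beta>))) x)
                                * deriv f (Complex \<alpha> \<beta>)))"
proof -
  interpret P: B_calc D A \<Phi> by standard fact
  have bl: "bounded_linear xs" and xsC: "\<And>c y. xs (c *\<^sub>C y) = c * xs y"
    using xs by (auto simp: dual_elem_def)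
  define \<psi> where "\<psi> g = xs (\<Phi> g x)" for g
  define C where "C = onorm xs * (P.bound * norm x)"
  interpret Balg_cfunctional \<psi> C
  proof
    show "0 \<le> C" unfolding C_def using onorm_pos_le[OF bl] P.bound_nonneg by simp
    fix g h :: "complex \<Rightarrow> complex"
    assume g: "g \<in> Balg"
    show "\<psi> (\<lambda>z. c * g z) = c * \<psi> g" for c
      unfolding \<psi>_def P.Phi_cmult[OF g] by (rule xsC)
    then show "\<psi> (\<lambda>z. of_real r * g z) = r *\<^sub>R \<psi> g" for r
      by (simp add: scaleR_conv_of_real)
    have "cmod (\<psi> g) \<le> onorm xs * norm (\<Phi> g x)" unfolding \<psi>_def by (rule onorm[OF bl])
    also have "\<dots> \<le> onorm xs * (P.bound * Bnorm g * norm x)"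
      by (intro mult_left_mono P.norm_Phi_le g onorm_pos_le[OF bl])
    finally show "norm (\<psi> g) \<le> C * Bnorm g" by (simp add: C_def mult_ac)
    assume h: "h \<in> Balg"
    show "\<psi> (\<lambda>z. g z + h z) = \<psi> g + \<psi> h"
      unfolding \<psi>_def P.Phi_add[OF g h] by (simp add: bounded_linear.linear[OF bl] linear_add)
  qed
  define h where "h \<alpha> t = \<psi> (\<lambda>z. kern t (z + of_real \<alpha>))" for \<alpha> t
  have h_eq: "h \<alpha> t = xs ((resolv D A (Complex \<alpha> (- t)) \<circ> resolv D A (Complex \<alpha> (- t))) x)" if "0 < \<alpha>" for \<alpha> t
    unfolding h_def \<psi>_def P.Phi_kern[OF that] ..
  have hi: "integrable lborel (h \<alpha>)" "(LINT t|lborel. cmod (h \<alpha> t)) \<le> 5 * pi * C / \<alpha>" if "0 < \<alpha>" for \<alpha>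
    using integrable_psi_kern[OF that] by (simp_all add: h_def[abs_def])
  have hm: "h \<alpha> \<in> borel_measurable borel" if "0 < \<alpha>" for \<alpha>
    using borel_measurable_integrable[OF hi(1)[OF that]] by simp
  have hold: "deriv f holomorphic_on RHP" by (rule holomorphic_deriv_RHP[OF Balg_holomorphic[OF f]])
  \<comment> \<open>The first part passes Cauchy's formula through \<psi>; the second is what makes
    the outer integral absolutely convergent.\<close>
  have inner: "(LINT t|lborel. h \<alpha> t * deriv f (Complex \<alpha> t)) = - (2 * pi) * \<psi> (\<lambda>z. deriv (deriv f) (z + of_real (2 * \<alpha>)))"
    (is ?eq) and inner_le: "cmod (LINT t|lborel. h \<alpha> t * deriv f (Complex \<alpha> t)) \<le> 5 * pi * C / \<alpha> * deriv_sup f \<alpha>"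
    (is ?le) if a: "0 < \<alpha>" for \<alpha>
  proof -
    have [measurable]: "(\<lambda>t. deriv f (Complex \<alpha> t)) \<in> borel_measurable borel"
      by (rule borel_measurable_continuous_onI[OF continuous_on_Complex_line[OF hold a]])
    note [measurable] = hm[OF a]
    have [measurable]: "(\<lambda>t. Complex \<alpha> t) \<in> borel_measurable borel"
      unfolding Complex_eq by measurable
    define g where "g m = regularized_deriv f \<alpha> m" for m
    have fle: "cmod (deriv f (Complex \<alpha> t)) \<le> deriv_sup f \<alpha>" for t
      using a by (intro cmod_deriv_le_deriv_sup f) auto
    have reg: "(LINT t|lborel. g m (Complex \<alpha> t) * h \<alpha> t) = - (2 * pi) * \<psi> (\<lambda>z. deriv (g m) (z + of_real (2 * \<alpha>)))"
      if m: "2 * \<alpha> < m" for m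
    proof -
      have hol: "g m holomorphic_on RHP" unfolding g_def by (rule holomorphic_regularized_deriv[OF f a m])
      note cont = continuous_on_Complex_line[OF hol a]
      have [measurable]: "(\<lambda>t. g m (Complex \<alpha> t)) \<in> borel_measurable borel"
        by (rule borel_measurable_continuous_onI[OF cont])
      have "integrable lborel (\<lambda>t. g m (Complex \<alpha> t) * h \<alpha> t)"
      proof (rule Bochner_Integration.integrable_bound)
        show "integrable lborel (\<lambda>t. (deriv_sup f \<alpha> * 4) * h \<alpha> t)" using hi(1)[OF a] by simp
        show "AE t in lborel. norm (g m (Complex \<alpha> t) * h \<alpha> t) \<le> norm ((deriv_sup f \<alpha> * 4) * h \<alpha> t)"
          using cmod_regularized_deriv_le[OF f a m, of "Complex \<alpha> t" for t] deriv_sup_nonneg[OF f a]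
          by (auto simp: norm_mult g_def intro!: mult_right_mono)
      qed measurable
      note lim1 = tendsto_integral_symmetric_interval[OF this]
      have lim2: "((\<lambda>N. \<psi> (\<lambda>z. integral {-N..N} (\<lambda>t. g m (Complex \<alpha> t) * kern t (z + of_real \<alpha>)))) \<longlongrightarrow>
           (- (2 * pi)) *\<^sub>R \<psi> (\<lambda>z. deriv (g m) (z + of_real (2 * \<alpha>)))) at_top"
        unfolding g_def
        by (rule tendsto_psi_integral_kern[OF holomorphic_regularized_deriv[OF f a m] a cmod_regularized_deriv_le[OF f a m]
            cmod_regularized_deriv_decay[OF f a m] Balg_deriv_regularized_deriv[OF f a m]])
      have "\<psi> (\<lambda>z. integral {-N..N} (\<lambda>t. g m (Complex \<alpha> t) * kern t (z + of_real \<alpha>))) =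
          integral {-N..N} (\<lambda>t. g m (Complex \<alpha> t) * h \<alpha> t)" if "0 \<le> N" for N
      proof -
        have "((\<lambda>t. \<psi> (\<lambda>z. g m (Complex \<alpha> t) * kern t (z + of_real \<alpha>))) has_integral
            \<psi> (\<lambda>z. integral {-N..N} (\<lambda>t. g m (Complex \<alpha> t) * kern t (z + of_real \<alpha>)))) {-N..N}"
          using that by (intro has_integral_psi_kern a cont) auto
        then show ?thesis unfolding psi_cscale[OF Balg_kern[OF a]] h_def[symmetric]
          by (rule integral_unique[symmetric])
      qed
      then have "\<forall>\<^sub>F N in at_top. \<psi> (\<lambda>z. integral {-N..N} (\<lambda>t. g m (Complex \<alpha> t) * kern t (z + of_real \<alpha>))) =
          integral {-N..N} (\<lambda>t. g m (Complex \<alpha> t) * h \<alpha> t)"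
        by (intro eventually_mono[OF eventually_ge_at_top[of 0]]) simp
      from tendsto_unique[OF trivial_limit_at_top_linorder Lim_transform_eventually[OF lim2 this] lim1]
      show ?thesis by (simp add: scaleR_conv_of_real)
    qed
    \<comment> \<open>Removal of the regulariser on the integral side: it is bounded by 4 uniformly
      in m, and h is integrable, so only pointwise convergence remains.\<close>
    have "((\<lambda>m. LINT t|lborel. g m (Complex \<alpha> t) * h \<alpha> t) \<longlongrightarrow> (LINT t|lborel. deriv f (Complex \<alpha> t) * h \<alpha> t)) at_top"
    proof (rule integral_dominated_convergence_at_top)
      show "integrable lborel (\<lambda>t. (deriv_sup f \<alpha> * 4) * cmod (h \<alpha> t))" using hi(1)[OF a] by simp
      show "(\<lambda>t. g m (Complex \<alpha> t) * h \<alpha> t) \<in> borel_measurable lborel" for m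
        unfolding g_def regularized_deriv_def by measurable
      show "\<forall>\<^sub>F m in at_top. AE t in lborel. norm (g m (Complex \<alpha> t) * h \<alpha> t) \<le> (deriv_sup f \<alpha> * 4) * cmod (h \<alpha> t)"
      proof (rule eventually_mono[OF eventually_gt_at_top[of "2 * \<alpha>"]])
        fix m assume m: "2 * \<alpha> < m"
        show "AE t in lborel. norm (g m (Complex \<alpha> t) * h \<alpha> t) \<le> (deriv_sup f \<alpha> * 4) * cmod (h \<alpha> t)"
          using cmod_regularized_deriv_le[OF f a m, of "Complex \<alpha> t" for t]
          by (auto simp: norm_mult g_def intro!: mult_right_mono)
      qed
      have "((\<lambda>m. of_real m * inverse (of_real (m - 2 * \<alpha>) + w)) \<longlongrightarrow> 1) at_top" for w :: complex
      proof -
        have "((\<lambda>m. inverse (1 + (w - of_real (2 * \<alpha>)) * inverse (of_real m))) \<longlongrightarrow> inverse (1 + (w - of_real (2 * \<alpha>)) * 0)) at_top"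
          by (intro tendsto_intros tendsto_inverse_0[THEN filterlim_compose] filterlim_of_real_at_infinity) auto
        then have l: "((\<lambda>m. inverse (1 + (w - of_real (2 * \<alpha>)) * inverse (of_real m))) \<longlongrightarrow> 1) at_top" by simp
        show ?thesis
        proof (rule Lim_transform_eventually[OF l], rule eventually_mono[OF eventually_gt_at_top[of 0]])
          fix m :: real assume "0 < m"
          then have "of_real (m - 2 * \<alpha>) + w = of_real m * (1 + (w - of_real (2 * \<alpha>)) * inverse (of_real m))"
            by (simp add: algebra_simps)
          with \<open>0 < m\<close> show "inverse (1 + (w - of_real (2 * \<alpha>)) * inverse (of_real m)) = of_real m * inverse (of_real (m - 2 * \<alpha>) + w)"
            by (simp only: inverse_mult_distrib) simp
        qed
      qed
      then have "((\<lambda>m. deriv f w * (of_real m * inverse (of_real (m - 2 * \<alpha>) + w))\<^sup>2 * h \<alpha> t) \<longlongrightarrow> deriv f w * 1\<^sup>2 * h \<alpha> t) at_top" for w t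
        by (intro tendsto_mult tendsto_power tendsto_const)
      then show "AE t in lborel. ((\<lambda>m. g m (Complex \<alpha> t) * h \<alpha> t) \<longlongrightarrow> deriv f (Complex \<alpha> t) * h \<alpha> t) at_top"
        unfolding g_def regularized_deriv_def by (intro AE_I2) simp
    qed measurable
    \<comment> \<open>The same limit computed on the operator side, by strong convergence of m (m +
      A)^{-1}.\<close>
    moreover have "((\<lambda>m. LINT t|lborel. g m (Complex \<alpha> t) * h \<alpha> t) \<longlongrightarrow> - (2 * pi) * \<psi> (\<lambda>z. deriv (deriv f) (z + of_real (2 * \<alpha>)))) at_top"
    proof (rule Lim_transform_eventually)
      show "((\<lambda>m. - (2 * pi) * \<psi> (\<lambda>z. deriv (g m) (z + of_real (2 * \<alpha>)))) \<longlongrightarrow> - (2 * pi) * \<psi> (\<lambda>z. deriv (deriv f) (z + of_real (2 * \<alpha>)))) at_top"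
        unfolding \<psi>_def g_def
        by (intro tendsto_mult tendsto_const bounded_linear.tendsto[OF bl] P.Phi_regularized_deriv_tendsto f a)
      show "\<forall>\<^sub>F m in at_top. - (2 * pi) * \<psi> (\<lambda>z. deriv (g m) (z + of_real (2 * \<alpha>))) = (LINT t|lborel. g m (Complex \<alpha> t) * h \<alpha> t)"
        by (rule eventually_mono[OF eventually_gt_at_top[of "2 * \<alpha>"] reg[symmetric]])
    qed
    ultimately have "(LINT t|lborel. deriv f (Complex \<alpha> t) * h \<alpha> t) = - (2 * pi) * \<psi> (\<lambda>z. deriv (deriv f) (z + of_real (2 * \<alpha>)))"
      by (rule tendsto_unique[OF trivial_limit_at_top_linorder])
    then show ?eq by (simp only: mult.commute)
    \<comment> \<open>Integrability is required for comparing the integrals of the norms.\<close>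
    have I: "integrable lborel (\<lambda>t. h \<alpha> t * deriv f (Complex \<alpha> t))"
    proof (rule Bochner_Integration.integrable_bound)
      show "integrable lborel (\<lambda>t. h \<alpha> t * deriv_sup f \<alpha>)" using hi(1)[OF a] by simp
      show "AE t in lborel. norm (h \<alpha> t * deriv f (Complex \<alpha> t)) \<le> norm (h \<alpha> t * deriv_sup f \<alpha>)"
        using fle deriv_sup_nonneg[OF f a] by (auto simp: norm_mult intro!: mult_left_mono)
    qed measurable
    have "cmod (LINT t|lborel. h \<alpha> t * deriv f (Complex \<alpha> t)) \<le> (LINT t|lborel. cmod (h \<alpha> t * deriv f (Complex \<alpha> t)))"
      by (rule integral_norm_bound)
    also have "\<dots> \<le> (LINT t|lborel. cmod (h \<alpha> t) * deriv_sup f \<alpha>)"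
    proof (rule integral_mono[OF integrable_norm[OF I]])
      show "integrable lborel (\<lambda>t. cmod (h \<alpha> t) * deriv_sup f \<alpha>)" using hi(1)[OF a] by simp
      show "cmod (h \<alpha> t * deriv f (Complex \<alpha> t)) \<le> cmod (h \<alpha> t) * deriv_sup f \<alpha>" for t
        unfolding norm_mult by (intro mult_left_mono fle) simp
    qed
    also have "\<dots> = (LINT t|lborel. cmod (h \<alpha> t)) * deriv_sup f \<alpha>" by simp
    also have "\<dots> \<le> 5 * pi * C / \<alpha> * deriv_sup f \<alpha>"
      by (intro mult_right_mono hi(2) a deriv_sup_nonneg f)
    finally show ?le .
  qed
  define q where "q \<alpha> = (4 * \<alpha>) *\<^sub>R \<psi> (\<lambda>z. deriv (deriv f) (z + of_real (2 * \<alpha>)))" for \<alpha>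
  define F where "F = (\<lambda>\<alpha>. (2 * \<alpha>) *\<^sub>R \<psi> (\<lambda>z. deriv f (z + of_real (2 * \<alpha>))) - \<psi> (\<lambda>z. f (z + of_real (2 * \<alpha>))))"
  note rep = representation_primitive[OF f, folded F_def q_def]
  have q_eq: "q \<alpha> = - (2 / pi) * (of_real \<alpha> * (LINT t|lborel. h \<alpha> t * deriv f (Complex \<alpha> t)))" if a: "0 < \<alpha>" for \<alpha>
    unfolding q_def inner[OF a] by (simp add: scaleR_conv_of_real)
  \<comment> \<open>The weight \<alpha> cancels the 1/\<alpha> of the L^1 bound: (2/pi) \<alpha> (5
    pi C/\<alpha>) = 10 C, so \<open>deriv_sup f\<close> is an integrable majorant.\<close>
  have qi: "set_integrable lborel {0<..} q"
    unfolding set_integrable_def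
  proof (rule Bochner_Integration.integrable_bound)
    show "integrable lborel (\<lambda>\<alpha>. indicator {0<..} \<alpha> *\<^sub>R (10 * C * deriv_sup f \<alpha>))"
      using set_integrable_mult_right[OF set_integrable_deriv_sup[OF f], of "10 * C"] by (simp add: set_integrable_def)
    have "continuous_on {0<..} q"
      using rep(2) by (intro continuous_at_imp_continuous_on) (auto simp: q_def[abs_def])
    then show "(\<lambda>\<alpha>. indicator {0<..} \<alpha> *\<^sub>R q \<alpha>) \<in> borel_measurable lborel"
      using borel_measurable_continuous_on_indicator[of "{0<..}" q] by simp
    have "cmod (q \<alpha>) \<le> 10 * C * deriv_sup f \<alpha>" if a: "0 < \<alpha>" for \<alpha>
    proof -
      have "cmod (q \<alpha>) = (2 / pi) * (\<alpha> * cmod (LINT t|lborel. h \<alpha> t * deriv f (Complex \<alpha> t)))"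
        unfolding q_eq[OF a] using a by (simp add: norm_mult norm_divide)
      also have "\<dots> \<le> (2 / pi) * (\<alpha> * (5 * pi * C / \<alpha> * deriv_sup f \<alpha>))"
        using a by (intro mult_left_mono inner_le) auto
      also have "\<dots> = 10 * C * deriv_sup f \<alpha>" using a by simp
      finally show ?thesis .
    qed
    then show "AE \<alpha> in lborel. norm (indicator {0<..} \<alpha> *\<^sub>R q \<alpha>) \<le> norm (indicator {0<..} \<alpha> *\<^sub>R (10 * C * deriv_sup f \<alpha>))"
      by (intro AE_I2) (auto simp: indicator_def intro: order_trans[OF _ abs_ge_self])
  qed
  \<comment> \<open>The end values of the primitive \<open>F\<close> at 0 and at infinity give
    \<psi>(f) - \<psi>(f(\<infinity>)).\<close>
  have "(LBINT \<alpha>=ereal 0..\<infinity>. q \<alpha>) = - \<psi> (\<lambda>_. f_infty f) - - \<psi> f"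
  proof (rule interval_integral_FTC_integrable)
    show "(F has_vector_derivative q \<alpha>) (at \<alpha>)" if "ereal 0 < ereal \<alpha>" "ereal \<alpha> < \<infinity>" for \<alpha>
      using rep(1)[of \<alpha>] that by (simp add: q_def)
    show "isCont q \<alpha>" if "ereal 0 < ereal \<alpha>" "ereal \<alpha> < \<infinity>" for \<alpha>
      using rep(2)[of \<alpha>] that by (simp add: q_def[abs_def])
    show "set_integrable lborel (einterval (ereal 0) \<infinity>) q" using qi by (simp add: einterval_def greaterThan_def)
    show "((F \<circ> real_of_ereal) \<longlongrightarrow> - \<psi> f) (at_right (ereal 0))"
      using rep(3) by (simp only: ereal_tendsto_simps)
    show "((F \<circ> real_of_ereal) \<longlongrightarrow> - \<psi> (\<lambda>_. f_infty f)) (at_left \<infinity>)"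
      using rep(4) by (simp only: ereal_tendsto_simps)
  qed simp
  moreover have "(LBINT \<alpha>=ereal 0..\<infinity>. q \<alpha>) = (LINT \<alpha>:{0<..}|lborel. q \<alpha>)"
    by (simp add: interval_lebesgue_integral_def einterval_def greaterThan_def)
  moreover have "(LINT \<alpha>:{0<..}|lborel. q \<alpha>) = - (2 / pi) * (LINT \<alpha>:{0<..}|lborel. of_real \<alpha> *
               (LINT \<beta>|lborel. xs ((resolv D A (Complex \<alpha> (- \<beta>)) \<circ> resolv D A (Complex \<alpha> (- \<beta>))) x)
                                * deriv f (Complex \<alpha> \<beta>)))"
    unfolding set_integral_mult_right[symmetric]
    by (intro set_lebesgue_integral_cong) (auto simp: q_eq h_eq)
  moreover have "\<psi> (\<lambda>_. f_infty f) = f_infty f * xs x"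
    unfolding \<psi>_def P.Phi_const by (rule xsC)
  ultimately show ?thesis unfolding \<psi>_def by (simp add: algebra_simps)
qed

theorem mainTheorem12:
  fixes D :: "'a::cbanach set" and A :: "'a \<Rightarrow> 'a"
    and \<Phi> :: "(complex \<Rightarrow> complex) \<Rightarrow> 'a \<Rightarrow> 'a"
  assumes "B_calculus D A \<Phi>"
  shows "(\<forall>\<Psi>. B_calculus D A \<Psi> \<longrightarrow> (\<forall>f\<in>Balg. \<Psi> f = \<Phi> f))
    \<and> (\<forall>f\<in>Balg. \<forall>x. \<forall>xs. dual_elem xs \<longrightarrow>
         xs (\<Phi> f x) = f_infty f * xs x
           - (2 / pi) * (LINT \<alpha>:{0<..}|lborel. of_real \<alpha> *
               (LINT \<beta>|lborel. xs ((resolv D A (Complex \<alpha> (- \<beta>)) \<circ> resolv D A (Complex \<alpha> (- \<beta>))) x)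
                                * deriv f (Complex \<alpha> \<beta>))))"
  using B_calculus_unique[OF assms] B_calculus_formula[OF assms] by blast

end
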